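(* Let $(M^{m+1},g(t),p(t))$, $t\in[0,T)$, be a solution to the conformal Ricci flow on a closed connected manifold of dimension $m+1\ge 3$ with constant scalar curvature $R_{g(t)}\equiv -m(m+1)$, and let $v$ be a solution of the linear heat equation $\partial_t v-\Delta_{g(t)}v=\bar p(t)v$, where $\bar p(t)=\max_{x\in M}p(x,t)$. Let $h,k$ be smooth functions of $t$ and suppose that $$\mathscr{R}ic_f\le\Big(\frac{k(t)}{2h(t)}+\frac{R_g}{m+1}\Big)g ,\qquad R_g=-m(m+1).$$ Let $Q(t)$ be the parabolic frequency of $v$, $$Q(t)=\frac{h(t)\int_M|\nabla v|_{g(t)}^2\,dV_{g(t)}}{\int_M v^2\,dV_{g(t)}}\exp\Big(-\int_{t_0}^t\Big(2\bar p(s)+\frac{h'(s)+k(s)}{h(s)}\Big)ds\Big).$$ (i) If $h(t)>0$, then $Q(t)$ is monotone nonincreasing along the conformal Ricci flow. (ii) If $h(t)<0$, then $Q(t)$ is monotone nondecreasing along the conformal Ricci flow. Furthermore, $Q'(t)=0$ only if $v$ is an eigenfunction of $\mathscr{L}_f$ satisfying $-\mathscr{L}_f v=c(t)v$ (for some $c(t)$ depending only on $t$).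
   Context: $M$ is a closed (compact, without boundary) connected manifold of dimension $m+1\ge3$ and $T>0$. $(M^{m+1},g(t),p(t))$, $t\in[0,T)$, solves the conformal Ricci flow if $g(t)$ is a smooth family of Riemannian metrics and $p(t)=p(\cdot,t)\ge 0$ a family of functions (the conformal pressure) on $M$ with $$\partial_t g=-2\big(Ric(t)+(m+p(t))g(t)\big),\qquad (-\Delta_{g(t)}+(m+1))p(t)=\tfrac1m|Ric+mg|^2\quad\text{on }M\times[0,T),$$ $g(0)=g_0$, where $g_0$ has constant scalar curvature $-m(m+1)$; the flow preserves $R_{g(t)}\equiv-m(m+1)$. $Ric$, $\Delta_{g(t)}$, $\nabla$, $d\mu_{g(t)}$ are the Ricci tensor, Laplace-Beltrami operator, Levi-Civita connection/gradient and volume element of $g(t)$. Weighted measure: let $\tau(t)=T-t$ and let $H(t)=(4\pi\tau(t))^{-\frac{m+1}{2}}e^{-f(t)}$ be the (positive) fundamental solution of the conjugate heat equation $\partial_tH=-\Delta_{g(t)}H+(m+1)p(t)H$ along the flow; this defines $f=f(t)$, which satisfies $\partial_tf=-\Delta f+|\nabla f|^2-(m+1)\big(p-\frac{1}{2\tau}\big)$. The weighted measure is $dV_{g(t)}=H(t)\,d\mu_{g(t)}$, with $\int_M dV_{g(t)}=1$. Drifting Laplacian: $\mathscr{L}_f u=e^f\operatorname{div}(e^{-f}\nabla u)=\Delta u-\langle\nabla f,\nabla u\rangle$. Bakry-Émery Ricci tensor: $\mathscr{R}ic_f=Ric+\operatorname{Hess}f$. Inequalities between symmetric 2-tensors are in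 the sense of quadratic forms. The functions $h$ (of fixed sign) and $k$ are smooth in $t$, and $Q(t)$ is considered for $t\in[t_0,t_1]\subset[0,T)$ (where $\int_M v^2dV_{g(t)}\ne0$). The function $v$ is smooth with $v(\cdot,t),\partial_tv(\cdot,t)\in W^{2,2}_0(dV)$. *)

theory Defs
  imports "HOL-Analysis.Analysis"
begin

section \<open>Smooth maps\<close>

text \<open>Derivatives are taken within the set, so on sets such as \<open>{0..<T} \<times> U\<close> with \<open>U\<close> open,
  smoothness is smoothness up to the boundary \<open>t = 0\<close> (one-sided time derivatives there).\<close>

primrec Ck_on ::
  "nat \<Rightarrow> 'a::real_normed_vector set \<Rightarrow> ('a \<Rightarrow> 'b::real_normed_vector) \<Rightarrow> bool" where
  "Ck_on 0 S f \<longleftrightarrow> continuous_on S f"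
| "Ck_on (Suc k) S f \<longleftrightarrow>
     (\<exists>f'. (\<forall>x\<in>S. (f has_derivative f' x) (at x within S)) \<and> (\<forall>v. Ck_on k S (\<lambda>x. f' x v)))"

definition smooth_on ::
  "'a::real_normed_vector set \<Rightarrow> ('a \<Rightarrow> 'b::real_normed_vector) \<Rightarrow> bool" where
  "smooth_on S f \<longleftrightarrow> (\<forall>k. Ck_on k S f)"


section \<open>Closed smooth manifolds\<close>

text \<open>The manifold is the whole type \<open>'a\<close> (a Hausdorff space) and \<open>'n\<close> indexes the coordinates,
  so its dimension is \<open>CARD('n)\<close>. A chart is a pair of its domain and its coordinate map.\<close>

type_synonym ('a, 'n) chart = "'a set \<times> ('a \<Rightarrow> real^'n)"

abbreviation chart_dom :: "('a, 'n) chart \<Rightarrow> 'a set" where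
  "chart_dom c \<equiv> fst c"

abbreviation chart_img :: "('a, 'n) chart \<Rightarrow> (real^'n) set" where
  "chart_img c \<equiv> snd c ` fst c"

definition chart_inv :: "('a, 'n) chart \<Rightarrow> real^'n \<Rightarrow> 'a" where
  "chart_inv c = inv_into (fst c) (snd c)"

definition smooth_atlas :: "('a::t2_space, 'n::finite) chart set \<Rightarrow> bool" where
  "smooth_atlas A \<longleftrightarrow>
     (\<forall>c\<in>A. open (chart_dom c) \<and> open (chart_img c) \<and>
        homeomorphism (chart_dom c) (chart_img c) (snd c) (chart_inv c)) \<and>
     (\<Union>c\<in>A. chart_dom c) = UNIV \<and>
     (\<forall>c\<in>A. \<forall>d\<in>A. smooth_on (snd c ` (chart_dom c \<inter> chart_dom d)) (snd d \<circ> chart_inv c))"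

text \<open>Second countability is not required separately: it follows from compactness.\<close>

definition closed_connected_manifold :: "('a::t2_space, 'n::finite) chart set \<Rightarrow> bool" where
  "closed_connected_manifold A \<longleftrightarrow>
     smooth_atlas A \<and> compact (UNIV :: 'a set) \<and> connected (UNIV :: 'a set)"

definition smooth_family_in ::
  "('a, 'n::finite) chart \<Rightarrow> real set \<Rightarrow> (real \<Rightarrow> 'a \<Rightarrow> 'b::real_normed_vector) \<Rightarrow> bool" where
  "smooth_family_in c I u \<longleftrightarrow> smooth_on (I \<times> chart_img c) (\<lambda>(t, y). u t (chart_inv c y))"

definition smooth_family ::
  "('a, 'n::finite) chart set \<Rightarrow> real set \<Rightarrow> (real \<Rightarrow> 'a \<Rightarrow> real) \<Rightarrow> bool" where
  "smooth_family A I u \<longleftrightarrow> (\<forall>c\<in>A. smooth_family_in c I u)"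

definition smooth_fun :: "('a, 'n::finite) chart set \<Rightarrow> ('a \<Rightarrow> real) \<Rightarrow> bool" where
  "smooth_fun A u \<longleftrightarrow> (\<forall>c\<in>A. smooth_on (chart_img c) (u \<circ> chart_inv c))"

text \<open>\<open>pd c i u x\<close> is the coordinate derivative \<open>\<partial>u/\<partial>x\<^sup>i\<close> in the chart \<open>c\<close>, at a point \<open>x\<close> of
  its domain.\<close>

definition pd :: "('a, 'n::finite) chart \<Rightarrow> 'n \<Rightarrow> ('a \<Rightarrow> real) \<Rightarrow> 'a \<Rightarrow> real" where
  "pd c i u x = deriv (\<lambda>s. u (chart_inv c (snd c x + s *\<^sub>R axis i 1))) 0"


section \<open>Riemannian geometry in coordinates\<close>

text \<open>A covariant 2-tensor field is given by its component matrices \<open>S c x\<close>, one for each chart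
  \<open>c\<close> and each point \<open>x\<close> in the domain of \<open>c\<close>, subject to the transformation law below. Vector
  fields in a fixed chart are likewise given by their components.\<close>

type_synonym ('a, 'n) tensor2 = "('a, 'n) chart \<Rightarrow> 'a \<Rightarrow> real^'n^'n"

definition coord_jacobian ::
  "('a, 'n::finite) chart \<Rightarrow> ('a, 'n) chart \<Rightarrow> 'a \<Rightarrow> real^'n^'n" where
  "coord_jacobian c d x = (\<chi> a i. pd c i (\<lambda>y. snd d y $ a) x)"

definition covariant2 :: "('a, 'n::finite) chart set \<Rightarrow> ('a, 'n) tensor2 \<Rightarrow> bool" where
  "covariant2 A S \<longleftrightarrow>
     (\<forall>c\<in>A. \<forall>d\<in>A. \<forall>x \<in> chart_dom c \<inter> chart_dom d.
        S c x = transpose (coord_jacobian c d x) ** S d x ** coord_jacobian c d x)"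

text \<open>Smoothness is imposed separately, jointly in space and time.\<close>

definition riemannian_metric :: "('a, 'n::finite) chart set \<Rightarrow> ('a, 'n) tensor2 \<Rightarrow> bool" where
  "riemannian_metric A g \<longleftrightarrow> covariant2 A g \<and>
     (\<forall>c\<in>A. \<forall>x\<in>chart_dom c. transpose (g c x) = g c x \<and>
        (\<forall>\<xi>. \<xi> \<noteq> 0 \<longrightarrow> \<xi> \<bullet> (g c x *v \<xi>) > 0))"

definition christoffel ::
  "('a, 'n::finite) tensor2 \<Rightarrow> ('a, 'n) chart \<Rightarrow> 'n \<Rightarrow> 'n \<Rightarrow> 'n \<Rightarrow> 'a \<Rightarrow> real" where
  "christoffel g c k i j x = 1/2 * (\<Sum>l\<in>UNIV. matrix_inv (g c x) $ k $ l *
     (pd c i (\<lambda>y. g c y $ j $ l) x + pd c j (\<lambda>y. g c y $ i $ l) x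
        - pd c l (\<lambda>y. g c y $ i $ j) x))"

text \<open>\<open>riem g c l k i j\<close> is \<open>R\<^sup>l\<^sub>k\<^sub>i\<^sub>j\<close>, where \<open>R(\<partial>\<^sub>i, \<partial>\<^sub>j)\<partial>\<^sub>k = R\<^sup>l\<^sub>k\<^sub>i\<^sub>j \<partial>\<^sub>l\<close> and
  \<open>R(X, Y) = [\<nabla>\<^sub>X, \<nabla>\<^sub>Y] - \<nabla>\<^bsub>[X, Y]\<^esub>\<close>. With \<open>Ric\<^sub>j\<^sub>k = R\<^sup>i\<^sub>k\<^sub>i\<^sub>j\<close> the round sphere has positive Ricci
  curvature.\<close>

definition riem ::
  "('a, 'n::finite) tensor2 \<Rightarrow> ('a, 'n) chart \<Rightarrow> 'n \<Rightarrow> 'n \<Rightarrow> 'n \<Rightarrow> 'n \<Rightarrow> 'a \<Rightarrow> real" where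
  "riem g c l k i j x =
     pd c i (christoffel g c l j k) x - pd c j (christoffel g c l i k) x
     + (\<Sum>q\<in>UNIV. christoffel g c l i q x * christoffel g c q j k x
                 - christoffel g c l j q x * christoffel g c q i k x)"

definition Ric :: "('a, 'n::finite) tensor2 \<Rightarrow> ('a, 'n) tensor2" where
  "Ric g c x = (\<chi> j k. \<Sum>i\<in>UNIV. riem g c i k i j x)"

definition scal :: "('a, 'n::finite) tensor2 \<Rightarrow> ('a, 'n) chart \<Rightarrow> 'a \<Rightarrow> real" where
  "scal g c x = (\<Sum>i\<in>UNIV. \<Sum>j\<in>UNIV. matrix_inv (g c x) $ i $ j * Ric g c x $ i $ j)"

definition tensor_norm2 ::
  "('a, 'n::finite) tensor2 \<Rightarrow> ('a, 'n) chart \<Rightarrow> 'a \<Rightarrow> real^'n^'n \<Rightarrow> real" where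
  "tensor_norm2 g c x S =
     (\<Sum>i\<in>UNIV. \<Sum>j\<in>UNIV. \<Sum>a\<in>UNIV. \<Sum>b\<in>UNIV.
        matrix_inv (g c x) $ i $ a * matrix_inv (g c x) $ j $ b * S $ i $ j * S $ a $ b)"

definition grad ::
  "('a, 'n::finite) tensor2 \<Rightarrow> ('a, 'n) chart \<Rightarrow> ('a \<Rightarrow> real) \<Rightarrow> 'a \<Rightarrow> real^'n" where
  "grad g c u x = matrix_inv (g c x) *v (\<chi> j. pd c j u x)"

definition grad_norm2 ::
  "('a, 'n::finite) tensor2 \<Rightarrow> ('a, 'n) chart \<Rightarrow> ('a \<Rightarrow> real) \<Rightarrow> 'a \<Rightarrow> real" where
  "grad_norm2 g c u x = grad g c u x \<bullet> (g c x *v grad g c u x)"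

definition divergence ::
  "('a, 'n::finite) tensor2 \<Rightarrow> ('a, 'n) chart \<Rightarrow> ('a \<Rightarrow> real^'n) \<Rightarrow> 'a \<Rightarrow> real" where
  "divergence g c X x =
     (\<Sum>i\<in>UNIV. pd c i (\<lambda>y. X y $ i) x + (\<Sum>j\<in>UNIV. christoffel g c i i j x * X x $ j))"

definition laplacian ::
  "('a, 'n::finite) tensor2 \<Rightarrow> ('a, 'n) chart \<Rightarrow> ('a \<Rightarrow> real) \<Rightarrow> 'a \<Rightarrow> real" where
  "laplacian g c u = divergence g c (grad g c u)"

definition hessian :: "('a, 'n::finite) tensor2 \<Rightarrow> ('a \<Rightarrow> real) \<Rightarrow> ('a, 'n) tensor2" where
  "hessian g u c x =
     (\<chi> i j. pd c i (pd c j u) x - (\<Sum>k\<in>UNIV. christoffel g c k i j x * pd c k u x))"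

definition tensor_le :: "real^'n^'n::finite \<Rightarrow> real^'n^'n \<Rightarrow> bool" where
  "tensor_le S S' \<longleftrightarrow> (\<forall>\<xi>. \<xi> \<bullet> (S *v \<xi>) \<le> \<xi> \<bullet> (S' *v \<xi>))"

text \<open>\<open>in_chart A F\<close> turns a scalar quantity given chart by chart (and independent of the chart)
  into a function on the manifold, by evaluating it in some chart around each point.\<close>

definition in_chart :: "('a, 'n) chart set \<Rightarrow> (('a, 'n) chart \<Rightarrow> 'a \<Rightarrow> real) \<Rightarrow> 'a \<Rightarrow> real" where
  "in_chart A F x = F (SOME c. c \<in> A \<and> x \<in> chart_dom c) x"

text \<open>The Riemannian volume measure is the unique Borel measure that is \<open>sqrt (det g) dx\<close> in every
  chart.\<close>

definition riemannian_volume ::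
  "('a::t2_space, 'n::finite) chart set \<Rightarrow> ('a, 'n) tensor2 \<Rightarrow> 'a measure \<Rightarrow> bool" where
  "riemannian_volume A g \<mu> \<longleftrightarrow> sets \<mu> = sets borel \<and>
     (\<forall>c\<in>A. \<forall>B\<in>sets borel. B \<subseteq> chart_dom c \<longrightarrow>
        emeasure \<mu> B = (\<integral>\<^sup>+y. ennreal (sqrt (det (g c (chart_inv c y)))) * indicator (snd c ` B) y \<partial>lborel))"


section \<open>Weighted geometry\<close>

definition weighted_measure :: "'a measure \<Rightarrow> ('a \<Rightarrow> real) \<Rightarrow> 'a measure" where
  "weighted_measure \<mu> H = density \<mu> (\<lambda>x. ennreal (H x))"

definition drift_laplacian ::
  "('a, 'n::finite) tensor2 \<Rightarrow> ('a \<Rightarrow> real) \<Rightarrow> ('a, 'n) chart \<Rightarrow> ('a \<Rightarrow> real) \<Rightarrow> 'a \<Rightarrow> real" where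
  "drift_laplacian g f c u x =
     exp (f x) * divergence g c (\<lambda>y. exp (- f y) *\<^sub>R grad g c u y) x"

definition bakry_emery_Ric ::
  "('a, 'n::finite) tensor2 \<Rightarrow> ('a \<Rightarrow> real) \<Rightarrow> ('a, 'n) tensor2" where
  "bakry_emery_Ric g f c x = Ric g c x + hessian g f c x"

definition drift_eigenfunction ::
  "('a, 'n::finite) chart set \<Rightarrow> ('a, 'n) tensor2 \<Rightarrow> ('a \<Rightarrow> real) \<Rightarrow> real \<Rightarrow> ('a \<Rightarrow> real) \<Rightarrow> bool" where
  "drift_eigenfunction A g f ev u \<longleftrightarrow> (\<exists>x. u x \<noteq> 0) \<and>
     (\<forall>c\<in>A. \<forall>x\<in>chart_dom c. - drift_laplacian g f c u x = ev * u x)"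

definition W22_norm2 ::
  "('a, 'n::finite) chart set \<Rightarrow> ('a, 'n) tensor2 \<Rightarrow> 'a measure \<Rightarrow> ('a \<Rightarrow> real) \<Rightarrow> real" where
  "W22_norm2 A g V u =
     (\<integral>x. (u x)\<^sup>2 + in_chart A (\<lambda>c. grad_norm2 g c u) x
          + in_chart A (\<lambda>c x. tensor_norm2 g c x (hessian g u c x)) x \<partial>V)"

text \<open>\<open>W\<^sup>2\<^sup>,\<^sup>2\<^sub>0(V)\<close> as the completion of the compactly supported smooth functions in the
  \<open>W\<^sup>2\<^sup>,\<^sup>2\<close>-norm, realised inside \<open>L\<^sup>2(V)\<close>: the \<open>L\<^sup>2\<close>-limits of \<open>W\<^sup>2\<^sup>,\<^sup>2\<close>-Cauchy sequences.\<close>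

definition W22_0 ::
  "('a::t2_space, 'n::finite) chart set \<Rightarrow> ('a, 'n) tensor2 \<Rightarrow> 'a measure \<Rightarrow> ('a \<Rightarrow> real) set" where
  "W22_0 A g V = {u. u \<in> borel_measurable V \<and> integrable V (\<lambda>x. (u x)\<^sup>2) \<and>
     (\<exists>\<phi>. (\<forall>n::nat. smooth_fun A (\<phi> n) \<and> compact (closure {x. \<phi> n x \<noteq> 0})) \<and>
        (\<forall>e>0. \<exists>N. \<forall>i\<ge>N. \<forall>j\<ge>N. W22_norm2 A g V (\<lambda>x. \<phi> i x - \<phi> j x) < e) \<and>
        (\<lambda>n. \<integral>x. (u x - \<phi> n x)\<^sup>2 \<partial>V) \<longlonglongrightarrow> 0)}"


section \<open>The conformal Ricci flow\<close>

definition conformal_Ricci_flow ::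
  "('a, 'n::finite) chart set \<Rightarrow> nat \<Rightarrow> real \<Rightarrow> (real \<Rightarrow> ('a, 'n) tensor2) \<Rightarrow> (real \<Rightarrow> 'a \<Rightarrow> real) \<Rightarrow> bool"
where
  "conformal_Ricci_flow A m T g p \<longleftrightarrow>
     (\<forall>t\<in>{0..<T}. riemannian_metric A (g t)) \<and>
     (\<forall>c\<in>A. smooth_family_in c {0..<T} (\<lambda>t. g t c)) \<and>
     smooth_family A {0..<T} p \<and>
     (\<forall>t\<in>{0..<T}. \<forall>x. p t x \<ge> 0) \<and>
     (\<forall>t\<in>{0..<T}. \<forall>c\<in>A. \<forall>x\<in>chart_dom c.
        ((\<lambda>s. g s c x) has_vector_derivative
           (-2) *\<^sub>R (Ric (g t) c x + (real m + p t x) *\<^sub>R g t c x)) (at t within {0..<T}) \<and>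
        - laplacian (g t) c (p t) x + (real m + 1) * p t x
          = 1 / real m * tensor_norm2 (g t) c x (Ric (g t) c x + real m *\<^sub>R g t c x))"

text \<open>\<open>\<mu> t\<close> is the volume measure of \<open>g t\<close>. ``Fundamental solution'' means that \<open>H(t) d\<mu>(t)\<close> tends
  weakly to the unit mass at the pole \<open>x0\<close> as \<open>t\<close> increases to \<open>T\<close>.\<close>

definition fundamental_conjugate_heat_solution ::
  "('a::t2_space, 'n::finite) chart set \<Rightarrow> nat \<Rightarrow> real \<Rightarrow> (real \<Rightarrow> ('a, 'n) tensor2) \<Rightarrow>
   (real \<Rightarrow> 'a \<Rightarrow> real) \<Rightarrow> (real \<Rightarrow> 'a measure) \<Rightarrow> 'a \<Rightarrow> (real \<Rightarrow> 'a \<Rightarrow> real) \<Rightarrow> bool" where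
  "fundamental_conjugate_heat_solution A m T g p \<mu> x0 H \<longleftrightarrow>
     smooth_family A {0..<T} H \<and>
     (\<forall>t\<in>{0..<T}. \<forall>x. H t x > 0) \<and>
     (\<forall>t\<in>{0..<T}. \<forall>c\<in>A. \<forall>x\<in>chart_dom c.
        ((\<lambda>s. H s x) has_real_derivative
           - laplacian (g t) c (H t) x + (real m + 1) * p t x * H t x) (at t within {0..<T})) \<and>
     (\<forall>\<phi>. continuous_on UNIV \<phi> \<longrightarrow>
        ((\<lambda>t. \<integral>x. \<phi> x * H t x \<partial>\<mu> t) \<longlongrightarrow> \<phi> x0) (at_left T))"

text \<open>The maximum is attained when \<open>p t\<close> is continuous on a compact manifold.\<close>

definition max_pressure :: "(real \<Rightarrow> 'a \<Rightarrow> real) \<Rightarrow> real \<Rightarrow> real" where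
  "max_pressure p t = (SUP x. p t x)"

definition heat_solution ::
  "('a, 'n::finite) chart set \<Rightarrow> real \<Rightarrow> (real \<Rightarrow> ('a, 'n) tensor2) \<Rightarrow> (real \<Rightarrow> 'a \<Rightarrow> real) \<Rightarrow>
   (real \<Rightarrow> 'a \<Rightarrow> real) \<Rightarrow> bool" where
  "heat_solution A T g p v \<longleftrightarrow>
     (\<forall>t\<in>{0..<T}. \<forall>c\<in>A. \<forall>x\<in>chart_dom c. \<exists>v'.
        ((\<lambda>s. v s x) has_real_derivative v') (at t within {0..<T}) \<and>
        v' - laplacian (g t) c (v t) x = max_pressure p t * v t x)"

text \<open>\<open>V t\<close> is the weighted measure at time \<open>t\<close>. The derivative of \<open>h\<close> is one-sided at \<open>t0\<close> and
  \<open>t1\<close>.\<close>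

definition parabolic_frequency ::
  "('a, 'n::finite) chart set \<Rightarrow> (real \<Rightarrow> ('a, 'n) tensor2) \<Rightarrow> (real \<Rightarrow> 'a \<Rightarrow> real) \<Rightarrow>
   (real \<Rightarrow> 'a measure) \<Rightarrow> (real \<Rightarrow> 'a \<Rightarrow> real) \<Rightarrow> (real \<Rightarrow> real) \<Rightarrow> (real \<Rightarrow> real) \<Rightarrow>
   real \<Rightarrow> real \<Rightarrow> real \<Rightarrow> real" where
  "parabolic_frequency A g p V v h k t0 t1 t =
     h t * (\<integral>x. in_chart A (\<lambda>c. grad_norm2 (g t) c (v t)) x \<partial>V t) / (\<integral>x. (v t x)\<^sup>2 \<partial>V t)
     * exp (- integral {t0..t} (\<lambda>s. 2 * max_pressure p s
         + (vector_derivative h (at s within {t0..t1}) + k s) / h s))"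

end

theory Submission
  imports Defs
begin

text \<open>
  Write \<open>\<L> = \<Delta> - \<langle>\<nabla>f, \<nabla>\<cdot>\<rangle>\<close> for the drifting Laplacian, \<open>dV = H d\<mu>\<close>, and
  \<open>N = \<integral>v\<^sup>2 dV\<close>, \<open>D = \<integral>|\<nabla>v|\<^sup>2 dV\<close>, \<open>E = \<integral>(\<L>v)\<^sup>2 dV\<close>; in the code these are \<open>mass\<close>,
  \<open>energy\<close> and \<open>drift_mass\<close>, with \<open>\<L>v\<close> called \<open>drift\<close>. Because the scalar curvature is
  \<open>-m(m+1)\<close>, the volume form loses exactly \<open>(m+1)p d\<mu>\<close> (\<open>DERIV_vol\<close>), which the conjugate heat
  equation for \<open>H\<close> compensates, so that \<open>\<partial>\<^sub>t(H d\<mu>) = -(\<Delta>H) d\<mu>\<close> (\<open>DERIV_weighted_integral\<close>).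
  Together with Green's formula for \<open>dV\<close> this gives \<open>N' = 2 pbar N - 2 D\<close> (\<open>DERIV_mass\<close>).

  For \<open>D'\<close> the two sources of \<open>Ric + Hess f\<close> are kept apart until the end. The Ricci tensor appears
  when \<open>\<partial>\<^sub>t\<close> hits the metric in \<open>|\<nabla>v|\<^sup>2\<close>. The Hessian appears because the terms
  \<open>\<langle>\<nabla>v, \<nabla>\<langle>\<nabla>f, \<nabla>v\<rangle>\<rangle>\<close> and \<open>\<langle>\<nabla>f, \<nabla>|\<nabla>v|\<^sup>2\<rangle>\<close>, produced by integration by parts, combine to
  \<open>Hess f (\<nabla>v, \<nabla>v)\<close> (\<open>hessian_grad_grad\<close>). Hence
  \<open>D' = \<integral> 2 Ric\<^sub>f(\<nabla>v, \<nabla>v) + 2 (m + p + pbar) |\<nabla>v|\<^sup>2 dV - 2 E\<close>, and the curvature bound and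
  \<open>p \<le> pbar\<close> yield \<open>D' \<le> (k/h + 4 pbar) D - 2 E\<close> (\<open>DERIV_energy\<close>). The exponential weight in \<open>Q\<close>
  is chosen so that all first order terms cancel and \<open>h Q'\<close> is at most a positive multiple of
  \<open>D\<^sup>2 - N E\<close> (\<open>frequency_derivative_algebra\<close>). This is nonpositive by the Cauchy-Schwarz
  inequality, since \<open>D = -\<integral> v \<L>v dV\<close>, and it vanishes only if \<open>\<L>v + (D/N) v = 0\<close>
  (\<open>energy_square_le\<close>).

  The geometry is done in charts, for families \<open>u t x\<close> that are \<open>C\<^sup>k\<close> jointly in time and space. The
  gradient product \<open>\<langle>\<nabla>a, \<nabla>b\<rangle>\<close> is chart independent by the chain rule
  (\<open>chart_inner_invariant\<close>), and the Laplacians of \<open>v\<close> and \<open>H\<close> are so because the evolution equations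
  express them without charts. Both Green's formula (\<open>green\<close>) and the first variation of an integral
  (\<open>DERIV_integral\<close>) reduce through a partition of unity to one chart; there they rest on
  differentiation under the integral sign, Jacobi's formula for the determinant and, for Green's
  formula, the translation invariance of Lebesgue measure.
\<close>

section \<open>Finite differentiability classes\<close>

lemma Ck_on_cong:
  assumes "\<And>x. x \<in> S \<Longrightarrow> f x = g x"
  shows "Ck_on k S f \<longleftrightarrow> Ck_on k S g"
proof (cases k)
  case 0
  then show ?thesis using assms by (simp cong: continuous_on_cong)
next
  case (Suc n)
  have "(f has_derivative F) (at x within S) \<longleftrightarrow> (g has_derivative F) (at x within S)"
    if "x \<in> S" for x F
    using assms that by (metis has_derivative_transform)
  then show ?thesis using Suc by auto
qed

lemma Ck_on_Suc_imp: "Ck_on (Suc k) S f \<Longrightarrow> Ck_on k S f"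
proof (induction k arbitrary: f)
  case 0
  then obtain f' where "\<forall>x\<in>S. (f has_derivative f' x) (at x within S)" unfolding Ck_on.simps(2)[of 0] by blast
  then have "continuous (at x within S) f" if "x \<in> S" for x
    using that by (blast dest: has_derivative_continuous)
  then show ?case
    unfolding Ck_on.simps continuous_on_eq_continuous_within by simp
next
  case (Suc k)
  then obtain f' where f': "\<forall>x\<in>S. (f has_derivative f' x) (at x within S)"
    "\<forall>v. Ck_on (Suc k) S (\<lambda>x. f' x v)" unfolding Ck_on.simps(2)[of "Suc k"] by blast
  then show ?case using Suc.IH unfolding Ck_on.simps(2)[of k] by blast
qed

lemma Ck_on_continuous: "Ck_on k S f \<Longrightarrow> continuous_on S f"
  by (induction k) (simp, blast dest: Ck_on_Suc_imp)

lemma Ck_on_subset: "Ck_on k S f \<Longrightarrow> S' \<subseteq> S \<Longrightarrow> Ck_on k S' f"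
proof (induction k arbitrary: f)
  case 0
  then show ?case by (auto intro: continuous_on_subset)
next
  case (Suc k)
  then obtain f' where f': "\<forall>x\<in>S. (f has_derivative f' x) (at x within S)"
    "\<forall>v. Ck_on k S (\<lambda>x. f' x v)" by auto
  have "\<forall>x\<in>S'. (f has_derivative f' x) (at x within S')"
    using f' Suc.prems by (meson has_derivative_subset subsetD)
  then show ?case using f' Suc by auto
qed

lemma Ck_on_const: "Ck_on k S (\<lambda>x. c)"
proof (induction k arbitrary: c)
  case (Suc k)
  show ?case unfolding Ck_on.simps using Suc by (intro exI[of _ "\<lambda>_ _. 0"]) simp
qed auto

lemma Ck_on_linear:
  assumes "bounded_linear L"
  shows "Ck_on k S f \<Longrightarrow> Ck_on k S (\<lambda>x. L (f x))"
proof (induction k arbitrary: f)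
  case 0
  then show ?case by (auto intro: bounded_linear.continuous_on[OF assms])
next
  case (Suc k)
  then obtain f' where f': "\<forall>x\<in>S. (f has_derivative f' x) (at x within S)"
    "\<forall>v. Ck_on k S (\<lambda>x. f' x v)" by auto
  then show ?case using Suc.IH
    by (auto intro!: exI[of _ "\<lambda>x v. L (f' x v)"] bounded_linear.has_derivative[OF assms])
qed

lemma Ck_on_add: "Ck_on k S f \<Longrightarrow> Ck_on k S g \<Longrightarrow> Ck_on k S (\<lambda>x. f x + g x)"
proof (induction k arbitrary: f g)
  case 0
  then show ?case by (auto intro: continuous_intros)
next
  case (Suc k)
  from Suc.prems obtain f' g' where f': "\<forall>x\<in>S. (f has_derivative f' x) (at x within S)"
    "\<forall>v. Ck_on k S (\<lambda>x. f' x v)" "\<forall>x\<in>S. (g has_derivative g' x) (at x within S)"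
    "\<forall>v. Ck_on k S (\<lambda>x. g' x v)" by auto
  then show ?case using Suc.IH
    by (auto intro!: exI[of _ "\<lambda>x v. f' x v + g' x v"] has_derivative_add)
qed

lemma Ck_on_mult:
  fixes f g :: "'a::real_normed_vector \<Rightarrow> real"
  shows "Ck_on k S f \<Longrightarrow> Ck_on k S g \<Longrightarrow> Ck_on k S (\<lambda>x. f x * g x)"
proof (induction k arbitrary: f g)
  case 0
  then show ?case by (auto intro: continuous_intros)
next
  case (Suc k)
  from Suc.prems obtain f' g' where f': "\<forall>x\<in>S. (f has_derivative f' x) (at x within S)"
    "\<forall>v. Ck_on k S (\<lambda>x. f' x v)" "\<forall>x\<in>S. (g has_derivative g' x) (at x within S)"
    "\<forall>v. Ck_on k S (\<lambda>x. g' x v)" by auto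
  have fg: "Ck_on k S f" "Ck_on k S g" using Suc.prems Ck_on_Suc_imp by blast+
  show ?case
    unfolding Ck_on.simps
  proof (intro exI conjI ballI allI)
    show "((\<lambda>x. f x * g x) has_derivative (\<lambda>v. f x * g' x v + f' x v * g x)) (at x within S)"
      if "x \<in> S" for x using f' that by (auto intro!: has_derivative_mult)
    show "Ck_on k S (\<lambda>x. f x * g' x v + f' x v * g x)" for v
      using f' fg by (intro Ck_on_add Suc.IH) auto
  qed
qed

lemma Ck_on_cmult:
  fixes f :: "'a::real_normed_vector \<Rightarrow> real"
  shows "Ck_on k S f \<Longrightarrow> Ck_on k S (\<lambda>x. c * f x)"
  by (rule Ck_on_mult[OF Ck_on_const])

lemma Ck_on_minus: "Ck_on k S f \<Longrightarrow> Ck_on k S (\<lambda>x. - f x)"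
  using Ck_on_linear[OF bounded_linear_minus[OF bounded_linear_ident]] .

lemma Ck_on_diff: "Ck_on k S f \<Longrightarrow> Ck_on k S g \<Longrightarrow> Ck_on k S (\<lambda>x. f x - g x)"
  using Ck_on_add[OF _ Ck_on_minus] by fastforce

lemma Ck_on_sum: "(\<And>i. i \<in> F \<Longrightarrow> Ck_on k S (f i)) \<Longrightarrow> Ck_on k S (\<lambda>x. \<Sum>i\<in>F. f i x)"
  by (induction F rule: infinite_finite_induct) (auto intro: Ck_on_const Ck_on_add)

lemma Ck_on_prod:
  fixes f :: "'i \<Rightarrow> 'a::real_normed_vector \<Rightarrow> real"
  shows "(\<And>i. i \<in> F \<Longrightarrow> Ck_on k S (f i)) \<Longrightarrow> Ck_on k S (\<lambda>x. \<Prod>i\<in>F. f i x)"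
  by (induction F rule: infinite_finite_induct) (auto intro: Ck_on_const Ck_on_mult)

text \<open>The induction runs on the differential equation that the composite satisfies: its derivative
  is a product of the factor \<open>F' \<circ> f\<close>, which is as regular as \<open>F \<circ> f\<close>, with the derivative of \<open>f\<close>.\<close>

lemma Ck_on_chain:
  fixes f :: "'a::real_normed_vector \<Rightarrow> real"
  assumes deriv: "\<And>x. x \<in> S \<Longrightarrow> (F has_field_derivative F' (f x)) (at (f x))"
    and step: "\<And>k. Ck_on k S f \<Longrightarrow> Ck_on k S (\<lambda>x. F (f x)) \<Longrightarrow> Ck_on k S (\<lambda>x. F' (f x))"
    and f: "Ck_on k S f"
  shows "Ck_on k S (\<lambda>x. F (f x))"
  using f
proof (induction k)
  case 0
  have "continuous_on (f ` S) F"
    using deriv by (auto intro!: continuous_at_imp_continuous_on dest: DERIV_isCont)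
  then show ?case using 0 by (auto intro: continuous_on_compose2)
next
  case (Suc k)
  from Suc.prems obtain f' where f': "\<forall>x\<in>S. (f has_derivative f' x) (at x within S)"
    "\<forall>v. Ck_on k S (\<lambda>x. f' x v)" by auto
  have fk: "Ck_on k S f" using Suc.prems Ck_on_Suc_imp by blast
  show ?case
    unfolding Ck_on.simps
  proof (intro exI conjI ballI allI)
    show "((\<lambda>x. F (f x)) has_derivative (\<lambda>v. F' (f x) * f' x v)) (at x within S)"
      if "x \<in> S" for x
      using has_derivative_compose[OF f'(1)[rule_format, OF that]
          deriv[OF that, unfolded has_field_derivative_def]] by simp
    show "Ck_on k S (\<lambda>x. F' (f x) * f' x v)" for v
      using f' by (intro Ck_on_mult step Suc.IH fk) auto
  qed
qed

lemma Ck_on_inverse: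
  fixes f :: "'a::real_normed_vector \<Rightarrow> real"
  assumes "\<And>x. x \<in> S \<Longrightarrow> f x \<noteq> 0" "Ck_on k S f"
  shows "Ck_on k S (\<lambda>x. inverse (f x))"
proof (rule Ck_on_chain[where F = inverse and f = f and F' = "\<lambda>y. - (inverse y * inverse y)"])
  show "(inverse has_real_derivative - (inverse (f x) * inverse (f x))) (at (f x))" if "x \<in> S" for x
    using assms that by (auto intro!: derivative_eq_intros)
qed (auto intro: Ck_on_minus Ck_on_mult assms)

lemma Ck_on_divide:
  fixes f :: "'a::real_normed_vector \<Rightarrow> real"
  assumes "Ck_on k S f" "Ck_on k S g" "\<And>x. x \<in> S \<Longrightarrow> g x \<noteq> 0"
  shows "Ck_on k S (\<lambda>x. f x / g x)"
  unfolding divide_inverse using assms by (intro Ck_on_mult Ck_on_inverse) auto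

lemma Ck_on_ln:
  fixes f :: "'a::real_normed_vector \<Rightarrow> real"
  assumes "\<And>x. x \<in> S \<Longrightarrow> f x > 0" "Ck_on k S f"
  shows "Ck_on k S (\<lambda>x. ln (f x))"
proof (rule Ck_on_chain[where F = ln and f = f and F' = inverse])
  show "(ln has_real_derivative inverse (f x)) (at (f x))" if "x \<in> S" for x
    using assms that by (auto intro!: derivative_eq_intros simp: divide_inverse)
  show "Ck_on k S (\<lambda>x. inverse (f x))" if "Ck_on k S f" for k
    using assms that by (intro Ck_on_inverse) (auto simp: less_imp_neq[symmetric])
qed (rule assms)

lemma Ck_on_sqrt:
  fixes f :: "'a::real_normed_vector \<Rightarrow> real"
  assumes "\<And>x. x \<in> S \<Longrightarrow> f x > 0" "Ck_on k S f"
  shows "Ck_on k S (\<lambda>x. sqrt (f x))"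
proof (rule Ck_on_chain[where F = sqrt and f = f and F' = "\<lambda>y. inverse (sqrt y) / 2"])
  show "(sqrt has_real_derivative inverse (sqrt (f x)) / 2) (at (f x))" if "x \<in> S" for x
    using assms that by (intro DERIV_real_sqrt) auto
  show "Ck_on k S (\<lambda>x. inverse (sqrt (f x)) / 2)" if "Ck_on k S (\<lambda>x. sqrt (f x))" for k
    using assms that by (intro Ck_on_divide Ck_on_inverse Ck_on_const) (auto simp: less_imp_neq[symmetric])
qed (rule assms)

section \<open>Inverses and determinants of matrix families\<close>

lemma
  fixes M :: "real^'n^'n"
  assumes "invertible M"
  shows matrix_inv_right: "M ** matrix_inv M = mat 1"
    and matrix_inv_left: "matrix_inv M ** M = mat 1"
  using someI_ex[OF assms[unfolded invertible_def]] by (simp_all add: matrix_inv_def)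

text \<open>Cramer's rule exhibits the entries of the inverse as rational functions of the entries of the
  matrix. Regularity and continuity of the inverse metric are read off from it.\<close>

lemma matrix_inv_cramer:
  fixes M :: "real^'n^'n"
  assumes "det M \<noteq> 0"
  shows "matrix_inv M $ i $ j =
    det (\<chi> a b. if b = i then (if a = j then 1 else 0) else M $ a $ b) / det M"
proof -
  have inv: "invertible M" using assms by (simp add: invertible_det_nz)
  have "M *v (matrix_inv M *v axis j 1) = axis j 1"
    using matrix_inv_right[OF inv] by (simp add: matrix_vector_mul_assoc)
  then have "matrix_inv M *v axis j 1 =
      (\<chi> k. det (\<chi> a b. if b = k then axis j 1 $ a else M $ a $ b) / det M)"
    using cramer[OF assms] by blast
  then have "(matrix_inv M *v axis j 1) $ i =
      det (\<chi> a b. if b = i then (if a = j then 1 else 0) else M $ a $ b) / det M"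
    by (simp add: axis_def if_distrib eq_commute cong: if_cong)
  moreover have "(matrix_inv M *v axis j 1) $ i = matrix_inv M $ i $ j"
    by (simp add: matrix_vector_mul_component inner_axis)
  ultimately show ?thesis by simp
qed

lemma Ck_on_det:
  fixes M :: "'a::real_normed_vector \<Rightarrow> real^'n^'n"
  assumes "\<And>i j. Ck_on k S (\<lambda>x. M x $ i $ j)"
  shows "Ck_on k S (\<lambda>x. det (M x))"
  unfolding det_def by (intro Ck_on_sum Ck_on_mult Ck_on_const Ck_on_prod assms)

lemma Ck_on_matrix_inv:
  fixes M :: "'a::real_normed_vector \<Rightarrow> real^'n^'n"
  assumes M: "\<And>i j. Ck_on k S (\<lambda>x. M x $ i $ j)" and det: "\<And>x. x \<in> S \<Longrightarrow> det (M x) \<noteq> 0"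
  shows "Ck_on k S (\<lambda>x. matrix_inv (M x) $ i $ j)"
proof -
  have "Ck_on k S (\<lambda>x. det (\<chi> a b. if b = i then (if a = j then 1 else 0) else M x $ a $ b) / det (M x))"
  proof (intro Ck_on_divide Ck_on_det det M)
    show "Ck_on k S (\<lambda>x. (\<chi> a b. if b = i then (if a = j then 1 else 0) else M x $ a $ b) $ r $ s)"
      for r s by (cases "s = i") (simp_all add: Ck_on_const M)
  qed
  then show ?thesis using det by (subst Ck_on_cong) (auto simp: matrix_inv_cramer)
qed

lemma tendsto_det:
  fixes M :: "'a \<Rightarrow> real^'n^'n"
  assumes "\<And>i j. ((\<lambda>s. M s $ i $ j) \<longlongrightarrow> N $ i $ j) F"
  shows "((\<lambda>s. det (M s)) \<longlongrightarrow> det N) F"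
  unfolding det_def by (intro tendsto_sum tendsto_mult tendsto_const tendsto_prod assms)

lemma tendsto_matrix_inv:
  fixes M :: "'a \<Rightarrow> real^'n^'n"
  assumes M: "\<And>i j. ((\<lambda>s. M s $ i $ j) \<longlongrightarrow> N $ i $ j) F" and N: "det N \<noteq> 0"
  shows "((\<lambda>s. matrix_inv (M s) $ i $ j) \<longlongrightarrow> matrix_inv N $ i $ j) F"
proof -
  have d: "((\<lambda>s. det (M s)) \<longlongrightarrow> det N) F" by (rule tendsto_det[OF M])
  have "\<forall>\<^sub>F s in F. det (M s) \<noteq> 0" by (rule tendsto_imp_eventually_ne[OF d N])
  have "((\<lambda>s. det (\<chi> a b. if b = i then (if a = j then 1 else 0) else M s $ a $ b) / det (M s))
     \<longlongrightarrow> det (\<chi> a b. if b = i then (if a = j then 1 else 0) else N $ a $ b) / det N) F"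
  proof (rule tendsto_divide[OF tendsto_det d N])
    show "((\<lambda>s. (\<chi> a b. if b = i then (if a = j then 1 else 0) else M s $ a $ b) $ r $ q)
       \<longlongrightarrow> (\<chi> a b. if b = i then (if a = j then 1 else 0) else N $ a $ b) $ r $ q) F" for r q
      by (cases "q = i") (simp_all add: M)
  qed
  moreover have "\<forall>\<^sub>F s in F. det (\<chi> a b. if b = i then (if a = j then 1 else 0) else M s $ a $ b) / det (M s)
      = matrix_inv (M s) $ i $ j"
    using \<open>\<forall>\<^sub>F s in F. det (M s) \<noteq> 0\<close> by eventually_elim (rule matrix_inv_cramer[symmetric])
  ultimately show ?thesis
    unfolding matrix_inv_cramer[OF N] by (rule Lim_transform_eventually)
qed

text \<open>Divide \<open>M\<^sub>s\<^sup>-\<^sup>1 - M\<^sub>t\<^sup>-\<^sup>1 = - M\<^sub>s\<^sup>-\<^sup>1 (M\<^sub>s - M\<^sub>t) M\<^sub>t\<^sup>-\<^sup>1\<close> by \<open>s - t\<close> and let \<open>s\<close> tend to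
  \<open>t\<close>.\<close>

lemma DERIV_matrix_inv:
  fixes M :: "real \<Rightarrow> real^'n^'n"
  assumes M: "\<And>i j. ((\<lambda>s. M s $ i $ j) has_real_derivative M' $ i $ j) (at t within S)"
    and det: "det (M t) \<noteq> 0"
  shows "((\<lambda>s. matrix_inv (M s) $ i $ j) has_real_derivative
           - (matrix_inv (M t) ** M' ** matrix_inv (M t)) $ i $ j) (at t within S)"
proof -
  let ?F = "at t within S" and ?N = "\<lambda>s. matrix_inv (M s)"
  have lim: "((\<lambda>s. M s $ i $ j) \<longlongrightarrow> M t $ i $ j) ?F" for i j
    using DERIV_continuous[OF M] by (simp add: continuous_within)
  have "\<forall>\<^sub>F s in ?F. det (M s) \<noteq> 0"
    by (rule tendsto_imp_eventually_ne[OF tendsto_det[OF lim] det])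
  moreover have "(?N s $ i $ j - ?N t $ i $ j) / (s - t) =
      - (\<Sum>a\<in>UNIV. (\<Sum>b\<in>UNIV. ?N s $ i $ b * ((M s $ b $ a - M t $ b $ a) / (s - t))) * ?N t $ a $ j)"
    if "det (M s) \<noteq> 0" for s
  proof -
    have "invertible (M s)" "invertible (M t)" using that det by (auto simp: invertible_det_nz)
    note I = matrix_inv_left[OF this(1)] matrix_inv_right[OF this(2)]
    have "?N s ** (M s - M t) ** ?N t = ?N s ** M s ** ?N t - ?N s ** (M t ** ?N t)"
      unfolding matrix_mul_assoc
      by (simp add: matrix_matrix_mult_def vec_eq_iff sum_subtractf left_diff_distrib right_diff_distrib)
    then have "?N s - ?N t = - (?N s ** (M s - M t) ** ?N t)"
      using I by simp
    then have "?N s $ i $ j - ?N t $ i $ j = - ((?N s ** (M s - M t) ** ?N t) $ i $ j)"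
      by (subst vector_minus_component[symmetric])+ simp
    then show ?thesis
      by (simp add: matrix_matrix_mult_def sum_divide_distrib sum_distrib_right sum_negf)
  qed
  moreover have "((\<lambda>s. - (\<Sum>a\<in>UNIV. (\<Sum>b\<in>UNIV. ?N s $ i $ b * ((M s $ b $ a - M t $ b $ a) / (s - t))) * ?N t $ a $ j))
     \<longlongrightarrow> - (\<Sum>a\<in>UNIV. (\<Sum>b\<in>UNIV. ?N t $ i $ b * M' $ b $ a) * ?N t $ a $ j)) ?F"
    using M by (intro tendsto_intros tendsto_matrix_inv[OF lim det]) (simp add: has_field_derivative_iff)
  ultimately have ev: "\<forall>\<^sub>F s in ?F. - (\<Sum>a\<in>UNIV. (\<Sum>b\<in>UNIV. ?N s $ i $ b * ((M s $ b $ a - M t $ b $ a) / (s - t))) * ?N t $ a $ j)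
      = (?N s $ i $ j - ?N t $ i $ j) / (s - t)"
    and lim': "((\<lambda>s. - (\<Sum>a\<in>UNIV. (\<Sum>b\<in>UNIV. ?N s $ i $ b * ((M s $ b $ a - M t $ b $ a) / (s - t))) * ?N t $ a $ j))
     \<longlongrightarrow> - (\<Sum>a\<in>UNIV. (\<Sum>b\<in>UNIV. ?N t $ i $ b * M' $ b $ a) * ?N t $ a $ j)) ?F"
    by (auto elim!: eventually_mono)
  have "((\<lambda>s. (?N s $ i $ j - ?N t $ i $ j) / (s - t))
     \<longlongrightarrow> - (\<Sum>a\<in>UNIV. (\<Sum>b\<in>UNIV. ?N t $ i $ b * M' $ b $ a) * ?N t $ a $ j)) ?F"
    by (rule Lim_transform_eventually[OF lim' ev])
  then show ?thesis by (simp add: has_field_derivative_iff matrix_matrix_mult_def)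
qed

lemma DERIV_prod_within:
  fixes f :: "'i \<Rightarrow> real \<Rightarrow> real"
  assumes "\<And>i. i \<in> F \<Longrightarrow> (f i has_real_derivative f' i) (at t within S)"
  shows "((\<lambda>s. \<Prod>i\<in>F. f i s) has_real_derivative (\<Sum>i\<in>F. f' i * (\<Prod>j\<in>F - {i}. f j t))) (at t within S)"
proof -
  have "((\<lambda>s. \<Prod>i\<in>F. f i s) has_derivative
      (\<lambda>y. \<Sum>i\<in>F. f' i * y * (\<Prod>j\<in>F - {i}. f j t))) (at t within S)"
    by (rule has_derivative_prod) (use assms in \<open>simp add: has_field_derivative_def\<close>)
  then show ?thesis
    unfolding has_field_derivative_def
    by (rule has_derivative_eq_rhs) (simp add: fun_eq_iff sum_distrib_left sum_distrib_right mult_ac)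
qed

text \<open>Every permutation other than the identity moves at least two indices, so its term in the Leibniz
  expansion vanishes to second order at the unit matrix; the linear part is the trace.\<close>

lemma DERIV_det_at_one:
  fixes M :: "real \<Rightarrow> real^'n^'n"
  assumes M: "\<And>i j. ((\<lambda>s. M s $ i $ j) has_real_derivative M' $ i $ j) (at t within S)"
    and one: "M t = mat 1"
  shows "((\<lambda>s. det (M s)) has_real_derivative (\<Sum>i\<in>UNIV. M' $ i $ i)) (at t within S)"
proof -
  let ?P = "{p. p permutes (UNIV :: 'n set)}"
  have "((\<lambda>s. det (M s)) has_real_derivative
     (\<Sum>p\<in>?P. of_int (sign p) * (\<Sum>i\<in>UNIV. M' $ i $ p i * (\<Prod>j\<in>UNIV - {i}. M t $ j $ p j)))) (at t within S)"
    unfolding det_def by (intro DERIV_sum DERIV_cmult DERIV_prod_within M)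
  moreover have "(\<Sum>p\<in>?P. of_int (sign p) * (\<Sum>i\<in>UNIV. M' $ i $ p i * (\<Prod>j\<in>UNIV - {i}. M t $ j $ p j)))
     = (\<Sum>p\<in>?P. if p = id then (\<Sum>i\<in>UNIV. M' $ i $ i) else 0)"
  proof (intro sum.cong refl)
    fix p assume p: "p \<in> ?P"
    show "of_int (sign p) * (\<Sum>i\<in>UNIV. M' $ i $ p i * (\<Prod>j\<in>UNIV - {i}. M t $ j $ p j))
      = (if p = id then (\<Sum>i\<in>UNIV. M' $ i $ i) else 0)"
    proof (cases "p = id")
      case True
      then show ?thesis by (simp add: one mat_def sign_id)
    next
      case False
      then obtain a where a: "p a \<noteq> a" by (auto simp: fun_eq_iff)
      have pa: "p (p a) \<noteq> p a" using a p permutes_inj[of p UNIV] by (auto dest: injD)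
      have "(\<Prod>j\<in>UNIV - {i}. M t $ j $ p j) = 0" for i
      proof -
        obtain b where "b \<noteq> i" "p b \<noteq> b" using a pa by metis
        then show ?thesis by (intro prod_zero) (auto simp: one mat_def intro!: bexI[of _ b])
      qed
      then show ?thesis using False by (simp only: mult_zero_right sum.neutral_const if_False)
    qed
  qed
  moreover have "id \<in> ?P" by (simp add: permutes_id)
  moreover have "finite ?P" by (simp add: finite_permutations)
  ultimately show ?thesis by (simp add: sum.delta)
qed

text \<open>Jacobi's formula follows from the expansion at the unit matrix applied to \<open>M\<^sub>t\<^sup>-\<^sup>1 M\<^sub>s\<close>.\<close>

lemma DERIV_det:
  fixes M :: "real \<Rightarrow> real^'n^'n"
  assumes M: "\<And>i j. ((\<lambda>s. M s $ i $ j) has_real_derivative M' $ i $ j) (at t within S)"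
    and det: "det (M t) \<noteq> 0"
  shows "((\<lambda>s. det (M s)) has_real_derivative
     det (M t) * (\<Sum>i\<in>UNIV. \<Sum>j\<in>UNIV. matrix_inv (M t) $ i $ j * M' $ j $ i)) (at t within S)"
proof -
  let ?N = "matrix_inv (M t)"
  have inv: "invertible (M t)" using det by (simp add: invertible_det_nz)
  have "((\<lambda>s. det (?N ** M s)) has_real_derivative (\<Sum>i\<in>UNIV. (?N ** M') $ i $ i)) (at t within S)"
  proof (rule DERIV_det_at_one)
    show "((\<lambda>s. (?N ** M s) $ i $ j) has_real_derivative (?N ** M') $ i $ j) (at t within S)" for i j
      unfolding matrix_matrix_mult_def by (auto intro!: derivative_eq_intros M sum.cong)
    show "?N ** M t = mat 1" by (rule matrix_inv_left[OF inv])
  qed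
  from DERIV_cmult[OF this, of "det (M t)"]
  have "((\<lambda>s. det (M t) * det (?N ** M s)) has_real_derivative
     det (M t) * (\<Sum>i\<in>UNIV. (?N ** M') $ i $ i)) (at t within S)" .
  moreover have "det (M t) * det (?N ** M s) = det (M s)" for s
    using matrix_inv_right[OF inv] by (simp flip: det_mul add: matrix_mul_assoc)
  ultimately show ?thesis by (simp add: matrix_matrix_mult_def)
qed

lemma DERIV_sqrt_det:
  fixes M :: "real \<Rightarrow> real^'n^'n"
  assumes M: "\<And>i j. ((\<lambda>s. M s $ i $ j) has_real_derivative M' $ i $ j) (at t within S)"
    and det: "det (M t) > 0"
  shows "((\<lambda>s. sqrt (det (M s))) has_real_derivative
     sqrt (det (M t)) * (1/2 * (\<Sum>i\<in>UNIV. \<Sum>j\<in>UNIV. matrix_inv (M t) $ i $ j * M' $ j $ i))) (at t within S)"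
proof -
  let ?d = "det (M t)"
  let ?tr = "\<Sum>i\<in>UNIV. \<Sum>j\<in>UNIV. matrix_inv (M t) $ i $ j * M' $ j $ i"
  have "?d * inverse (sqrt ?d) = sqrt ?d"
    using real_div_sqrt[of ?d] det by (simp add: divide_inverse)
  then have eq: "inverse (sqrt ?d) / 2 * (?d * ?tr) = sqrt ?d * (1/2 * ?tr)"
    by (simp add: mult_ac)
  show ?thesis
    using DERIV_chain2[OF DERIV_real_sqrt[OF det] DERIV_det[OF M less_imp_neq[OF det, symmetric]]]
    unfolding eq .
qed

section \<open>Differentiation of parameter integrals\<close>

lemma has_real_derivative_unique_within:
  fixes f :: "real \<Rightarrow> real"
  assumes "(f has_real_derivative a) (at t within S)" "(f has_real_derivative b) (at t within S)"
    "at t within S \<noteq> bot"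
  shows "a = b"
  using vector_derivative_unique_within[OF assms(3), of f a b] assms(1,2)
  by (simp add: has_real_derivative_iff_has_vector_derivative)

lemma continuous_on_slice:
  assumes "continuous_on (I \<times> J) (\<lambda>(t, s). F t s)" "t \<in> I"
  shows "continuous_on J (F t)"
proof -
  have "continuous_on J (\<lambda>s. (\<lambda>(t, s). F t s) (t, s))"
    by (rule continuous_on_compose2[OF assms(1)]) (use assms(2) in \<open>auto intro!: continuous_intros\<close>)
  then show ?thesis by simp
qed

text \<open>Integrate \<open>\<partial>\<^sub>s F\<close> in \<open>s\<close> and differentiate under the integral in \<open>t\<close>; the result exhibits
  \<open>\<partial>\<^sub>t F\<close> as an indefinite integral in \<open>s\<close>. Derivatives in \<open>t\<close> are taken within \<open>I\<close>, so the
  initial time of a flow is covered.\<close>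

lemma mixed_partials_commute:
  fixes F :: "real \<Rightarrow> real \<Rightarrow> real"
  assumes I: "convex I" "t \<in> I" "at t within I \<noteq> bot" and r: "a < r" "r < b"
    and D1: "\<And>s. s \<in> {a..b} \<Longrightarrow> ((\<lambda>t. F t s) has_real_derivative F1 s) (at t within I)"
    and D2: "\<And>t s. t \<in> I \<Longrightarrow> s \<in> {a..b} \<Longrightarrow> (F t has_real_derivative F2 t s) (at s within {a..b})"
    and D21: "\<And>t s. t \<in> I \<Longrightarrow> s \<in> {a..b} \<Longrightarrow> ((\<lambda>t. F2 t s) has_real_derivative F21 t s) (at t within I)"
    and cont2: "\<And>t. t \<in> I \<Longrightarrow> continuous_on {a..b} (F2 t)"
    and cont21: "continuous_on (I \<times> {a..b}) (\<lambda>(t, s). F21 t s)"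
  shows "(F1 has_real_derivative F21 t r) (at r)"
proof -
  have ftc: "integral {a..s} (F2 t) = F t s - F t a" if "t \<in> I" "s \<in> {a..b}" for t s
  proof (rule integral_unique, rule fundamental_theorem_of_calculus)
    show "a \<le> s" using that by simp
    show "(F t has_vector_derivative F2 t x) (at x within {a..s})" if "x \<in> {a..s}" for x
      using D2[OF \<open>t \<in> I\<close>, of x] that \<open>s \<in> {a..b}\<close>
      by (auto simp: has_real_derivative_iff_has_vector_derivative[symmetric]
          intro: has_field_derivative_subset)
  qed
  have F1: "F1 s = F1 a + integral {a..s} (F21 t)" if s: "s \<in> {a..b}" for s
  proof -
    have "((\<lambda>t. integral (cbox a s) (F2 t)) has_real_derivative integral (cbox a s) (F21 t)) (at t within I)"
    proof (rule leibniz_rule_field_derivative[OF _ _ _ I(2,1)])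
      show "continuous_on (I \<times> cbox a s) (\<lambda>(t, s). F21 t s)"
        by (rule continuous_on_subset[OF cont21]) (use s in auto)
      show "F2 t integrable_on cbox a s" if "t \<in> I" for t
        using s by (intro integrable_continuous continuous_on_subset[OF cont2[OF that]]) auto
      show "((\<lambda>x. F2 x t) has_real_derivative F21 x t) (at x within I)"
        if "x \<in> I" "t \<in> cbox a s" for x t using D21 that s by auto
    qed
    moreover have "((\<lambda>t. F t s - F t a) has_real_derivative F1 s - F1 a) (at t within I)"
      using D1[OF s] D1[of a] r by (intro DERIV_diff) auto
    ultimately have "integral {a..s} (F21 t) = F1 s - F1 a"
      using ftc s I(2) by (intro has_real_derivative_unique_within[OF _ _ I(3)])
        (auto elim!: has_field_derivative_transform_within[where d = 1])
    then show ?thesis by simp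
  qed
  have "continuous_on {a..b} (F21 t)"
    by (rule continuous_on_slice[OF cont21 I(2)])
  then have "((\<lambda>s. F1 a + integral {a..s} (F21 t)) has_real_derivative F21 t r) (at r within {a..b})"
    using r by (auto intro!: derivative_eq_intros integral_has_real_derivative)
  then have "(F1 has_real_derivative F21 t r) (at r within {a..b})"
  proof (rule has_field_derivative_transform_within[where d = 1])
    show "F1 a + integral {a..s} (F21 t) = F1 s" if "s \<in> {a..b}" for s
      by (rule F1[OF that, symmetric])
  qed (use r in auto)
  then show ?thesis using r by (simp add: at_within_Icc_at)
qed

lemma integrable_compact_support:
  fixes f :: "'e::euclidean_space \<Rightarrow> real"
  assumes "continuous_on UNIV f" "compact K" "\<And>y. y \<notin> K \<Longrightarrow> f y = 0"
  shows "integrable lborel f"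
proof -
  have "integrable lborel (\<lambda>x. indicator K x *\<^sub>R f x)"
    by (rule borel_integrable_compact) (use assms continuous_on_subset[OF assms(1)] in auto)
  moreover have "(\<lambda>x. indicator K x *\<^sub>R f x) = f"
    using assms(3) by (auto simp: fun_eq_iff indicator_def)
  ultimately show ?thesis by simp
qed

lemma deriv_lborel_integral_compact_support:
  fixes F F' :: "real \<Rightarrow> 'e::euclidean_space \<Rightarrow> real"
  assumes I: "convex I" "t0 \<in> I" and K: "compact K"
    and supp: "\<And>t y. t \<in> I \<Longrightarrow> y \<notin> K \<Longrightarrow> F t y = 0" "\<And>t y. t \<in> I \<Longrightarrow> y \<notin> K \<Longrightarrow> F' t y = 0"
    and cont: "continuous_on (I \<times> UNIV) (\<lambda>(t, y). F t y)" "continuous_on (I \<times> UNIV) (\<lambda>(t, y). F' t y)"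
    and deriv: "\<And>t y. t \<in> I \<Longrightarrow> ((\<lambda>t. F t y) has_real_derivative F' t y) (at t within I)"
  shows "((\<lambda>t. \<integral>y. F t y \<partial>lborel) has_real_derivative (\<integral>y. F' t0 y \<partial>lborel)) (at t0 within I)"
proof -
  obtain a where a: "K \<subseteq> cbox (- a) a"
    using bounded_subset_cbox_symmetric[OF compact_imp_bounded[OF K]] by blast
  have box: "(\<integral>y. f y \<partial>lborel) = integral (cbox (- a) a) f"
    if f: "continuous_on UNIV f" "\<And>y. y \<notin> K \<Longrightarrow> f y = 0" for f :: "'e \<Rightarrow> real"
  proof -
    have "(f has_integral (\<integral>y. f y \<partial>lborel)) UNIV"
      by (rule has_integral_integral_lborel[OF integrable_compact_support[OF f(1) K f(2)]])
    moreover have "(\<lambda>y. if y \<in> cbox (- a) a then f y else 0) = f"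
      using f(2) a by (auto simp: fun_eq_iff)
    ultimately have "(f has_integral (\<integral>y. f y \<partial>lborel)) (cbox (- a) a)"
      using has_integral_restrict[of "cbox (- a) a" UNIV f] by simp
    then show ?thesis by (simp add: integral_unique)
  qed
  have slice: "continuous_on UNIV (F t)" "continuous_on UNIV (F' t)" if "t \<in> I" for t
    using that continuous_on_slice cont by blast+
  have "((\<lambda>t. integral (cbox (- a) a) (F t)) has_real_derivative integral (cbox (- a) a) (F' t0)) (at t0 within I)"
  proof (rule leibniz_rule_field_derivative[OF _ _ _ I(2,1)])
    show "continuous_on (I \<times> cbox (- a) a) (\<lambda>(t, s). F' t s)"
      by (rule continuous_on_subset[OF cont(2)]) auto
    show "F t integrable_on cbox (- a) a" if "t \<in> I" for t
      by (intro integrable_continuous continuous_on_subset[OF slice(1)[OF that]]) auto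
  qed (rule deriv)
  moreover have "integral (cbox (- a) a) (F' t0) = (\<integral>y. F' t0 y \<partial>lborel)"
    using I(2) by (intro box[symmetric] slice supp)
  ultimately have "((\<lambda>t. integral (cbox (- a) a) (F t)) has_real_derivative (\<integral>y. F' t0 y \<partial>lborel)) (at t0 within I)"
    by simp
  then show ?thesis
  proof (rule has_field_derivative_transform_within[where d = 1])
    show "integral (cbox (- a) a) (F t) = (\<integral>y. F t y \<partial>lborel)" if "t \<in> I" for t
      using that by (intro box[symmetric] slice supp)
  qed (use I(2) in auto)
qed

text \<open>The integral of \<open>y \<mapsto> f (y + s b)\<close> does not depend on \<open>s\<close>; differentiate it at \<open>s = 0\<close>.\<close>

lemma lborel_integral_directional_derivative_eq_0:
  fixes f f' :: "'e::euclidean_space \<Rightarrow> real"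
  assumes K: "compact K" and supp: "\<And>y. y \<notin> K \<Longrightarrow> f y = 0" "\<And>y. y \<notin> K \<Longrightarrow> f' y = 0"
    and cont: "continuous_on UNIV f" "continuous_on UNIV f'"
    and deriv: "\<And>y. ((\<lambda>s. f (y + s *\<^sub>R b)) has_real_derivative f' y) (at 0)"
  shows "(\<integral>y. f' y \<partial>lborel) = 0"
proof -
  let ?I = "{-1..1::real}" and ?K = "(\<lambda>(y, s). y - s *\<^sub>R b) ` (K \<times> {-1..1})"
  have K': "compact ?K"
    by (intro compact_continuous_image compact_Times K) (auto simp: case_prod_unfold intro!: continuous_intros)
  have out: "y + s *\<^sub>R b \<notin> K" if "s \<in> ?I" "y \<notin> ?K" for s y
    using that by (force simp: image_iff)
  have D: "((\<lambda>s. f (y + s *\<^sub>R b)) has_real_derivative f' (y + s *\<^sub>R b)) (at s within ?I)" for y s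
  proof -
    have "((\<lambda>h. f (y + (h + s) *\<^sub>R b)) has_real_derivative f' (y + s *\<^sub>R b)) (at 0)"
      using deriv[of "y + s *\<^sub>R b"] by (simp add: algebra_simps)
    then have "((\<lambda>h. f (y + h *\<^sub>R b)) has_real_derivative f' (y + s *\<^sub>R b)) (at (0 + s))"
      by (subst DERIV_shift)
    then show ?thesis by (simp add: has_field_derivative_at_within)
  qed
  have "((\<lambda>s. \<integral>y. f (y + s *\<^sub>R b) \<partial>lborel) has_real_derivative (\<integral>y. f' (y + 0 *\<^sub>R b) \<partial>lborel)) (at 0 within ?I)"
  proof (rule deriv_lborel_integral_compact_support[OF _ _ K'])
    have c: "continuous_on (?I \<times> UNIV) (\<lambda>p. g (snd p + fst p *\<^sub>R b))"
      if "continuous_on UNIV g" for g :: "'e \<Rightarrow> real"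
      by (rule continuous_on_compose2[OF that]) (auto intro!: continuous_intros)
    show "continuous_on (?I \<times> UNIV) (\<lambda>(s, y). f (y + s *\<^sub>R b))"
      "continuous_on (?I \<times> UNIV) (\<lambda>(s, y). f' (y + s *\<^sub>R b))"
      using c[OF cont(1)] c[OF cont(2)] by (simp_all add: case_prod_unfold)
  qed (use out supp D in auto)
  moreover have "(\<integral>y. f (y + s *\<^sub>R b) \<partial>lborel) = (\<integral>y. f y \<partial>lborel)" for s
  proof -
    have "(\<integral>y. f y \<partial>lborel) = (\<integral>y. f y \<partial>distr lborel borel ((+) (s *\<^sub>R b)))"
      by (simp only: lborel_distr_plus)
    also have "\<dots> = (\<integral>y. f (s *\<^sub>R b + y) \<partial>lborel)"
      by (rule integral_distr) (use borel_measurable_continuous_onI[OF cont(1)] in auto)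
    finally show ?thesis by (simp add: add.commute)
  qed
  ultimately have "((\<lambda>s::real. \<integral>y. f y \<partial>lborel) has_real_derivative (\<integral>y. f' y \<partial>lborel)) (at 0 within ?I)"
    by simp
  then have "((\<lambda>s::real. \<integral>y. f y \<partial>lborel) has_real_derivative (\<integral>y. f' y \<partial>lborel)) (at 0)"
    by (simp add: at_within_Icc_at)
  then show ?thesis using DERIV_const DERIV_unique by blast
qed

section \<open>Coordinate calculus of families of functions\<close>

text \<open>Time and space are differentiated jointly. Derivatives of coordinate derivatives in time, and
  their continuity up to the end points of \<open>I\<close>, are thereby available.\<close>

definition Ck_in :: "('a, 'n::finite) chart \<Rightarrow> nat \<Rightarrow> real set \<Rightarrow> (real \<Rightarrow> 'a \<Rightarrow> real) \<Rightarrow> bool" where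
  "Ck_in c k I u \<longleftrightarrow> Ck_on k (I \<times> chart_img c) (\<lambda>(t, y). u t (chart_inv c y))"

definition Ck_family :: "('a, 'n::finite) chart set \<Rightarrow> nat \<Rightarrow> real set \<Rightarrow> (real \<Rightarrow> 'a \<Rightarrow> real) \<Rightarrow> bool" where
  "Ck_family A k I u \<longleftrightarrow> (\<forall>c\<in>A. Ck_in c k I u)"

definition time_deriv :: "real set \<Rightarrow> (real \<Rightarrow> 'a \<Rightarrow> real) \<Rightarrow> real \<Rightarrow> 'a \<Rightarrow> real" where
  "time_deriv I u t x = vector_derivative (\<lambda>s. u s x) (at t within I)"

lemma Ck_familyD: "Ck_family A k I u \<Longrightarrow> c \<in> A \<Longrightarrow> Ck_in c k I u"
  by (simp add: Ck_family_def)

lemma Ck_in_const: "Ck_in c k I (\<lambda>t x. r)"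
  by (simp add: Ck_in_def case_prod_unfold Ck_on_const)

lemma Ck_in_add: "Ck_in c k I u \<Longrightarrow> Ck_in c k I w \<Longrightarrow> Ck_in c k I (\<lambda>t x. u t x + w t x)"
  unfolding Ck_in_def using Ck_on_add by (fastforce simp: case_prod_unfold)

lemma Ck_in_diff: "Ck_in c k I u \<Longrightarrow> Ck_in c k I w \<Longrightarrow> Ck_in c k I (\<lambda>t x. u t x - w t x)"
  unfolding Ck_in_def using Ck_on_diff by (fastforce simp: case_prod_unfold)

lemma Ck_in_mult: "Ck_in c k I u \<Longrightarrow> Ck_in c k I w \<Longrightarrow> Ck_in c k I (\<lambda>t x. u t x * w t x)"
  unfolding Ck_in_def using Ck_on_mult by (fastforce simp: case_prod_unfold)

lemma Ck_in_sum: "(\<And>i. i \<in> F \<Longrightarrow> Ck_in c k I (u i)) \<Longrightarrow> Ck_in c k I (\<lambda>t x. \<Sum>i\<in>F. u i t x)"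
  by (induction F rule: infinite_finite_induct) (auto intro: Ck_in_const Ck_in_add)

lemma Ck_in_subset: "Ck_in c k I u \<Longrightarrow> J \<subseteq> I \<Longrightarrow> Ck_in c k J u"
  unfolding Ck_in_def by (erule Ck_on_subset) auto

lemma Ck_in_Suc_imp: "Ck_in c (Suc k) I u \<Longrightarrow> Ck_in c k I u"
  unfolding Ck_in_def by (rule Ck_on_Suc_imp)

locale manifold =
  fixes A :: "('a::t2_space, 'n::finite) chart set"
  assumes closed_manifold: "closed_connected_manifold A"
begin

lemma
  assumes "c \<in> A"
  shows open_chart_dom: "open (chart_dom c)"
    and open_chart_img: "open (chart_img c)"
    and chart_homeomorphism: "homeomorphism (chart_dom c) (chart_img c) (snd c) (chart_inv c)"
  using closed_manifold assms by (auto simp: closed_connected_manifold_def smooth_atlas_def)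

lemma
  assumes "c \<in> A"
  shows chart_inv_in: "y \<in> chart_img c \<Longrightarrow> chart_inv c y \<in> chart_dom c"
    and chart_chart_inv: "y \<in> chart_img c \<Longrightarrow> snd c (chart_inv c y) = y"
    and chart_inv_chart: "x \<in> chart_dom c \<Longrightarrow> chart_inv c (snd c x) = x"
    and continuous_on_chart: "continuous_on (chart_dom c) (snd c)"
    and continuous_on_chart_inv: "continuous_on (chart_img c) (chart_inv c)"
  using chart_homeomorphism[OF assms] unfolding homeomorphism_def by auto

lemma chart_covers: obtains c where "c \<in> A" "x \<in> chart_dom c"
  using closed_manifold unfolding closed_connected_manifold_def smooth_atlas_def by blast

lemma compact_UNIV: "compact (UNIV :: 'a set)"
  using closed_manifold by (simp add: closed_connected_manifold_def)

lemma smooth_transition: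
  assumes "c \<in> A" "d \<in> A"
  shows "smooth_on (snd c ` (chart_dom c \<inter> chart_dom d)) (snd d \<circ> chart_inv c)"
  using closed_manifold assms by (auto simp: closed_connected_manifold_def smooth_atlas_def)

lemma chart_image_open:
  assumes "c \<in> A" "open U" "U \<subseteq> chart_dom c"
  shows "open (snd c ` U)"
proof -
  have "snd c ` U = chart_img c \<inter> chart_inv c -` U"
  proof (intro equalityI subsetI)
    fix y assume "y \<in> snd c ` U"
    then obtain x where "x \<in> U" "y = snd c x" by blast
    then show "y \<in> chart_img c \<inter> chart_inv c -` U"
      using assms(3) chart_inv_chart[OF assms(1), of x] by auto
  next
    fix y assume "y \<in> chart_img c \<inter> chart_inv c -` U"
    then show "y \<in> snd c ` U"
      using chart_chart_inv[OF assms(1), of y] by (metis IntD1 IntD2 image_eqI vimageE)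
  qed
  moreover have "open (chart_img c \<inter> chart_inv c -` U)"
    by (rule continuous_open_preimage[OF continuous_on_chart_inv[OF assms(1)] open_chart_img[OF assms(1)] assms(2)])
  ultimately show ?thesis by simp
qed

lemma continuous_on_UNIV_chartwise:
  fixes u :: "'a \<Rightarrow> 'b::topological_space"
  assumes "\<And>c. c \<in> A \<Longrightarrow> continuous_on (chart_img c) (\<lambda>y. u (chart_inv c y))"
  shows "continuous_on UNIV u"
proof -
  have "isCont u x" for x
  proof -
    obtain c where c: "c \<in> A" "x \<in> chart_dom c" by (rule chart_covers)
    have "continuous_on (chart_dom c) (\<lambda>x. u (chart_inv c (snd c x)))"
      by (rule continuous_on_compose2[OF assms[OF c(1)] continuous_on_chart[OF c(1)]]) auto
    then have "continuous_on (chart_dom c) u"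
      by (rule continuous_on_eq) (simp add: chart_inv_chart c)
    then show ?thesis
      using c open_chart_dom continuous_on_eq_continuous_at by blast
  qed
  then show ?thesis by (simp add: continuous_at_imp_continuous_on)
qed

lemma Ck_in_continuous_slice:
  assumes "Ck_in c k I u" "t \<in> I"
  shows "continuous_on (chart_img c) (\<lambda>y. u t (chart_inv c y))"
  using continuous_on_slice[OF Ck_on_continuous[OF assms(1)[unfolded Ck_in_def]] assms(2)] .

lemma Ck_family_continuous:
  assumes "Ck_family A k I u" "t \<in> I"
  shows "continuous_on UNIV (u t)"
  by (rule continuous_on_UNIV_chartwise)
    (use assms Ck_in_continuous_slice Ck_familyD in blast)

lemma Ck_in_cong:
  assumes "c \<in> A" "\<And>t x. t \<in> I \<Longrightarrow> x \<in> chart_dom c \<Longrightarrow> u t x = w t x"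
  shows "Ck_in c k I u \<longleftrightarrow> Ck_in c k I w"
  unfolding Ck_in_def
proof (rule Ck_on_cong)
  fix p assume "p \<in> I \<times> chart_img c"
  then obtain t y where "p = (t, y)" "t \<in> I" "y \<in> chart_img c" by blast
  then show "(case p of (t, y) \<Rightarrow> u t (chart_inv c y)) = (case p of (t, y) \<Rightarrow> w t (chart_inv c y))"
    by (simp add: assms(2) chart_inv_in[OF assms(1)] del: imageE)
qed

lemma Ck_in_time_continuous:
  assumes "c \<in> A" "Ck_in c k I u" "x \<in> chart_dom c"
  shows "continuous_on I (\<lambda>t. u t x)"
proof -
  have "continuous_on I (\<lambda>t. (\<lambda>(t, y). u t (chart_inv c y)) (t, snd c x))"
    by (rule continuous_on_compose2[OF Ck_on_continuous[OF assms(2)[unfolded Ck_in_def]]])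
      (use assms in \<open>auto intro!: continuous_intros\<close>)
  then show ?thesis using assms by (simp add: chart_inv_chart)
qed

text \<open>A joint differential in time and space restricts to the coordinate lines and to the time
  lines.\<close>

lemma Ck_in_differential:
  assumes c: "c \<in> A" and u: "Ck_in c (Suc k) I u"
  obtains D :: "real \<times> (real^'n) \<Rightarrow> real \<times> (real^'n) \<Rightarrow> real" where "\<And>w. Ck_on k (I \<times> chart_img c) (\<lambda>p. D p w)"
    and "\<And>q. q \<in> I \<times> chart_img c \<Longrightarrow>
      ((\<lambda>(t, y). u t (chart_inv c y)) has_derivative D q) (at q within I \<times> chart_img c)"
    and "\<And>t x i. t \<in> I \<Longrightarrow> x \<in> chart_dom c \<Longrightarrow>
      ((\<lambda>s. u t (chart_inv c (snd c x + s *\<^sub>R axis i 1))) has_real_derivative D (t, snd c x) (0, axis i 1)) (at 0)"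
    and "\<And>t x. t \<in> I \<Longrightarrow> x \<in> chart_dom c \<Longrightarrow>
      ((\<lambda>s. u s x) has_real_derivative D (t, snd c x) (1, 0)) (at t within I)"
proof -
  let ?f = "\<lambda>(t, y). u t (chart_inv c y)" and ?S = "I \<times> chart_img c"
  from u obtain D where D: "\<forall>p\<in>?S. (?f has_derivative D p) (at p within ?S)"
    "\<forall>w. Ck_on k ?S (\<lambda>p. D p w)" unfolding Ck_in_def Ck_on.simps by blast
  show thesis
  proof (rule that)
    show "Ck_on k ?S (\<lambda>p. D p w)" for w using D by blast
    show "(?f has_derivative D q) (at q within ?S)" if "q \<in> ?S" for q using D that by blast
    have Dp: "(?f has_derivative D (t, snd c x)) (at (t, snd c x) within ?S)"
      if "t \<in> I" "x \<in> chart_dom c" for t x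
      using D(1) that by blast
    have lin: "linear (D (t, snd c x))" if "t \<in> I" "x \<in> chart_dom c" for t x
      using Dp[OF that] has_derivative_linear by blast
    show "((\<lambda>s. u t (chart_inv c (snd c x + s *\<^sub>R axis i 1))) has_real_derivative D (t, snd c x) (0, axis i 1)) (at 0)"
      if t: "t \<in> I" and x: "x \<in> chart_dom c" for t x i
    proof -
      let ?\<gamma> = "\<lambda>s. (t, snd c x + s *\<^sub>R axis i (1::real))"
      let ?N = "(\<lambda>s. snd c x + s *\<^sub>R axis i (1::real)) -` chart_img c"
      have N: "open ?N" "0 \<in> ?N"
        using x by (auto intro!: open_vimage open_chart_img c continuous_intros)
      have "(?\<gamma> has_derivative (\<lambda>s. (0, s *\<^sub>R axis i 1))) (at 0 within ?N)"
        by (auto intro!: derivative_eq_intros)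
      moreover have "(?f has_derivative D (t, snd c x)) (at (?\<gamma> 0) within ?\<gamma> ` ?N)"
        by (simp, rule has_derivative_subset[OF Dp[OF t x]]) (use t in auto)
      ultimately have "((\<lambda>s. ?f (?\<gamma> s)) has_derivative (\<lambda>s. D (t, snd c x) (0, s *\<^sub>R axis i 1))) (at 0 within ?N)"
        by (rule has_derivative_in_compose)
      moreover have "(\<lambda>s. D (t, snd c x) (0, s *\<^sub>R axis i 1)) = (*) (D (t, snd c x) (0, axis i 1))"
        using linear_scale[OF lin[OF t x], of _ "(0, axis i 1)"] by (simp add: fun_eq_iff mult.commute)
      ultimately have "((\<lambda>s. u t (chart_inv c (snd c x + s *\<^sub>R axis i 1))) has_derivative
          (*) (D (t, snd c x) (0, axis i 1))) (at 0 within ?N)"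
        by (simp only: prod.case)
      then show ?thesis
        unfolding has_field_derivative_def at_within_open[OF N(2,1)] .
    qed
    show "((\<lambda>s. u s x) has_real_derivative D (t, snd c x) (1, 0)) (at t within I)"
      if t: "t \<in> I" and x: "x \<in> chart_dom c" for t x
    proof -
      let ?\<gamma> = "\<lambda>s. (s, snd c x)"
      have "(?\<gamma> has_derivative (\<lambda>s. (s, 0))) (at t within I)"
        by (auto intro!: derivative_eq_intros)
      moreover have "(?f has_derivative D (t, snd c x)) (at (?\<gamma> t) within ?\<gamma> ` I)"
        by (rule has_derivative_subset[OF Dp[OF t x]]) (use x in auto)
      ultimately have "((\<lambda>s. ?f (?\<gamma> s)) has_derivative (\<lambda>s. D (t, snd c x) (s, 0))) (at t within I)"
        by (rule has_derivative_in_compose)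
      moreover have "(\<lambda>s. D (t, snd c x) (s, 0)) = (*) (D (t, snd c x) (1, 0))"
      proof (rule ext)
        show "D (t, snd c x) (s, 0) = D (t, snd c x) (1, 0) * s" for s
          using linear_scale[OF lin[OF t x], of s "(1, 0)"] by (simp add: mult.commute)
      qed
      ultimately have "((\<lambda>s. u s x) has_derivative (*) (D (t, snd c x) (1, 0))) (at t within I)"
        by (simp only: prod.case chart_inv_chart[OF c x])
      then show ?thesis
        unfolding has_field_derivative_def .
    qed
  qed
qed

lemma DERIV_pd:
  assumes "c \<in> A" "Ck_in c (Suc k) I u" "t \<in> I" "x \<in> chart_dom c"
  shows "((\<lambda>s. u t (chart_inv c (snd c x + s *\<^sub>R axis i 1))) has_real_derivative pd c i (u t) x) (at 0)"
proof (rule Ck_in_differential[OF assms(1,2)])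
  fix D :: "real \<times> (real^'n) \<Rightarrow> real \<times> (real^'n) \<Rightarrow> real" assume "\<And>t x i. t \<in> I \<Longrightarrow> x \<in> chart_dom c \<Longrightarrow>
      ((\<lambda>s. u t (chart_inv c (snd c x + s *\<^sub>R axis i 1))) has_real_derivative D (t, snd c x) (0, axis i 1)) (at 0)"
  note der = this[OF assms(3,4), of i]
  then show ?thesis
    using DERIV_imp_deriv[OF der] by (simp add: pd_def)
qed

lemma DERIV_pd_line:
  assumes "c \<in> A" "Ck_in c (Suc k) I u" "t \<in> I" "y + r *\<^sub>R axis i 1 \<in> chart_img c"
  shows "((\<lambda>s. u t (chart_inv c (y + s *\<^sub>R axis i 1))) has_real_derivative
           pd c i (u t) (chart_inv c (y + r *\<^sub>R axis i 1))) (at r)"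
proof -
  let ?x = "chart_inv c (y + r *\<^sub>R axis i 1)"
  have "((\<lambda>s. u t (chart_inv c (y + (s + r) *\<^sub>R axis i 1))) has_real_derivative pd c i (u t) ?x) (at 0)"
    using DERIV_pd[OF assms(1-3) chart_inv_in[OF assms(1,4)], of i]
    by (simp add: chart_chart_inv[OF assms(1,4)] algebra_simps)
  then have "((\<lambda>s. u t (chart_inv c (y + s *\<^sub>R axis i 1))) has_real_derivative pd c i (u t) ?x) (at (0 + r))"
    by (subst DERIV_shift)
  then show ?thesis by simp
qed

lemma pd_eqI:
  assumes "((\<lambda>s. u (chart_inv c (snd c x + s *\<^sub>R axis i 1))) has_real_derivative D) (at 0)"
  shows "pd c i u x = D"
  using assms DERIV_imp_deriv unfolding pd_def by blast

lemma Ck_in_pd: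
  assumes c: "c \<in> A" and u: "Ck_in c (Suc k) I u"
  shows "Ck_in c k I (\<lambda>t. pd c i (u t))"
proof (rule Ck_in_differential[OF c u])
  fix D :: "real \<times> (real^'n) \<Rightarrow> real \<times> (real^'n) \<Rightarrow> real" assume "\<And>w. Ck_on k (I \<times> chart_img c) (\<lambda>p. D p w)"
  note D = this[of "(0, axis i 1)"]
  assume der: "\<And>t x i. t \<in> I \<Longrightarrow> x \<in> chart_dom c \<Longrightarrow>
      ((\<lambda>s. u t (chart_inv c (snd c x + s *\<^sub>R axis i 1))) has_real_derivative D (t, snd c x) (0, axis i 1)) (at 0)"
  show ?thesis
    unfolding Ck_in_def
  proof (rule Ck_on_cong[THEN iffD2, OF _ D])
    fix p assume "p \<in> I \<times> chart_img c"
    then obtain t y where p: "p = (t, y)" "t \<in> I" "y \<in> chart_img c" by blast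
    then show "(case p of (t, y) \<Rightarrow> pd c i (u t) (chart_inv c y)) = D p (0, axis i 1)"
      using pd_eqI[OF der[OF p(2) chart_inv_in[OF c p(3)]]] chart_chart_inv[OF c p(3)] by simp
  qed
qed

lemma DERIV_time_deriv:
  assumes "c \<in> A" "Ck_in c (Suc k) I u" "t \<in> I" "x \<in> chart_dom c" "at t within I \<noteq> bot"
  shows "((\<lambda>s. u s x) has_real_derivative time_deriv I u t x) (at t within I)"
proof (rule Ck_in_differential[OF assms(1,2)])
  fix D :: "real \<times> (real^'n) \<Rightarrow> real \<times> (real^'n) \<Rightarrow> real" assume "\<And>t x. t \<in> I \<Longrightarrow> x \<in> chart_dom c \<Longrightarrow>
      ((\<lambda>s. u s x) has_real_derivative D (t, snd c x) (1, 0)) (at t within I)"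
  note D = this[OF assms(3,4)]
  have "time_deriv I u t x = D (t, snd c x) (1, 0)"
    using D unfolding time_deriv_def has_real_derivative_iff_has_vector_derivative
    by (rule vector_derivative_within[OF assms(5)])
  then show ?thesis using D by simp
qed

lemma Ck_in_time_deriv:
  assumes c: "c \<in> A" and u: "Ck_in c (Suc k) I u" and I: "\<And>t. t \<in> I \<Longrightarrow> at t within I \<noteq> bot"
  shows "Ck_in c k I (time_deriv I u)"
proof (rule Ck_in_differential[OF c u])
  fix D :: "real \<times> (real^'n) \<Rightarrow> real \<times> (real^'n) \<Rightarrow> real" assume "\<And>w. Ck_on k (I \<times> chart_img c) (\<lambda>p. D p w)"
  note D = this[of "(1, 0)"]
  assume der: "\<And>t x. t \<in> I \<Longrightarrow> x \<in> chart_dom c \<Longrightarrow>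
      ((\<lambda>s. u s x) has_real_derivative D (t, snd c x) (1, 0)) (at t within I)"
  have "time_deriv I u t x = D (t, snd c x) (1, 0)" if "t \<in> I" "x \<in> chart_dom c" for t x
    unfolding time_deriv_def
    by (rule vector_derivative_within[OF I[OF that(1)]])
      (use der[OF that] in \<open>simp add: has_real_derivative_iff_has_vector_derivative\<close>)
  note td = this
  show ?thesis
    unfolding Ck_in_def
  proof (rule Ck_on_cong[THEN iffD2, OF _ D])
    fix p assume "p \<in> I \<times> chart_img c"
    then obtain t y where p: "p = (t, y)" "t \<in> I" "y \<in> chart_img c" by blast
    then show "(case p of (t, y) \<Rightarrow> time_deriv I u t (chart_inv c y)) = D p (1, 0)"
      using td[OF p(2) chart_inv_in[OF c p(3)]] chart_chart_inv[OF c p(3)] by simp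
  qed
qed

lemma chart_segment:
  assumes "c \<in> A" "x \<in> chart_dom c"
  obtains e :: real where "e > 0"
    "\<And>r s i j. \<bar>r\<bar> \<le> e \<Longrightarrow> \<bar>s\<bar> \<le> e \<Longrightarrow> snd c x + r *\<^sub>R axis i 1 + s *\<^sub>R axis j 1 \<in> chart_img c"
proof -
  have "snd c x \<in> chart_img c" using assms by auto
  then obtain e where e: "e > 0" "cball (snd c x) e \<subseteq> chart_img c"
    using open_chart_img[OF assms(1)] open_contains_cball by blast
  have "snd c x + r *\<^sub>R axis i 1 + s *\<^sub>R axis j 1 \<in> cball (snd c x) e"
    if "\<bar>r\<bar> \<le> e / 2" "\<bar>s\<bar> \<le> e / 2" for r s i j
  proof -
    have "norm (r *\<^sub>R axis i 1 + s *\<^sub>R axis j (1::real)) \<le> \<bar>r\<bar> + \<bar>s\<bar>"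
      using norm_triangle_ineq[of "r *\<^sub>R axis i (1::real)" "s *\<^sub>R axis j (1::real)"] by simp
    then have "norm (r *\<^sub>R axis i 1 + s *\<^sub>R axis j (1::real)) \<le> e" using that by linarith
    then show ?thesis by (simp add: dist_norm norm_minus_commute add_ac)
  qed
  then show thesis using e by (intro that[of "e / 2"]) auto
qed

text \<open>\<open>\<partial>\<^sub>t\<close> commutes with \<open>\<partial>\<^sub>i\<close>: apply the exchange of mixed derivatives to \<open>u\<close> on a short
  coordinate segment through \<open>x\<close>.\<close>

lemma DERIV_pd_time:
  assumes c: "c \<in> A" and u: "Ck_in c (Suc (Suc k)) I u" and t: "t \<in> I" and x: "x \<in> chart_dom c"
    and I: "convex I" "\<And>t. t \<in> I \<Longrightarrow> at t within I \<noteq> bot"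
  shows "((\<lambda>s. pd c i (u s) x) has_real_derivative pd c i (time_deriv I u t) x) (at t within I)"
proof -
  obtain e where e: "e > 0" "\<And>r s i j. \<bar>r\<bar> \<le> e \<Longrightarrow> \<bar>s\<bar> \<le> e \<Longrightarrow>
      snd c x + r *\<^sub>R axis i 1 + s *\<^sub>R axis j 1 \<in> chart_img c"
    using chart_segment[OF c x] by blast
  let ?l = "\<lambda>s. snd c x + s *\<^sub>R axis i 1" and ?w = "\<lambda>t. pd c i (u t)"
  have l: "?l s \<in> chart_img c" if "s \<in> {-e..e}" for s
    using e(2)[of s 0 i i] that e(1) by auto
  have l': "chart_inv c (?l s) \<in> chart_dom c" if "s \<in> {-e..e}" for s
    by (rule chart_inv_in[OF c l[OF that]])
  have w: "Ck_in c (Suc k) I ?w" by (rule Ck_in_pd[OF c u])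
  have cont: "continuous_on (I \<times> {-e..e}) (\<lambda>(t, s). v t (chart_inv c (?l s)))"
    if v: "Ck_in c j I v" for v j
  proof -
    have "continuous_on (I \<times> {-e..e}) (\<lambda>p. (\<lambda>(t, y). v t (chart_inv c y)) (fst p, ?l (snd p)))"
      by (rule continuous_on_compose2[OF Ck_on_continuous[OF v[unfolded Ck_in_def]]])
        (use l in \<open>auto intro!: continuous_intros\<close>)
    then show ?thesis by (simp add: case_prod_unfold)
  qed
  have "((\<lambda>s. time_deriv I u t (chart_inv c (?l s))) has_real_derivative
      time_deriv I ?w t (chart_inv c (?l 0))) (at 0)"
  proof (rule mixed_partials_commute[OF I(1) t I(2)[OF t], where a = "-e" and b = e
        and F = "\<lambda>t s. u t (chart_inv c (?l s))" and ?F2.0 = "\<lambda>t s. ?w t (chart_inv c (?l s))"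
        and ?F21.0 = "\<lambda>t s. time_deriv I ?w t (chart_inv c (?l s))"])
    show "((\<lambda>t. u t (chart_inv c (?l s))) has_real_derivative time_deriv I u t (chart_inv c (?l s))) (at t within I)"
      if "s \<in> {-e..e}" for s
      by (rule DERIV_time_deriv[OF c u t l'[OF that] I(2)[OF t]])
    show "((\<lambda>s. u t (chart_inv c (?l s))) has_real_derivative ?w t (chart_inv c (?l s))) (at s within {-e..e})"
      if "t \<in> I" "s \<in> {-e..e}" for t s
      by (rule has_field_derivative_at_within[OF DERIV_pd_line[OF c u that(1) l[OF that(2)]]])
    show "((\<lambda>t. ?w t (chart_inv c (?l s))) has_real_derivative time_deriv I ?w t (chart_inv c (?l s))) (at t within I)"
      if "t \<in> I" "s \<in> {-e..e}" for t s
      by (rule DERIV_time_deriv[OF c w that(1) l'[OF that(2)] I(2)[OF that(1)]])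
    show "continuous_on {-e..e} (\<lambda>s. ?w t (chart_inv c (?l s)))" if "t \<in> I" for t
      by (rule continuous_on_slice[OF cont[OF w] that])
    show "continuous_on (I \<times> {-e..e}) (\<lambda>(t, s). time_deriv I ?w t (chart_inv c (?l s)))"
      by (rule cont[OF Ck_in_time_deriv[OF c w I(2)]])
  qed (use e in auto)
  then have "pd c i (time_deriv I u t) x = time_deriv I ?w t x"
    using chart_inv_chart[OF c x] by (intro pd_eqI) simp
  then show ?thesis
    using DERIV_time_deriv[OF c w t x I(2)[OF t]] by simp
qed

lemma pd_commute:
  assumes c: "c \<in> A" and u: "Ck_in c (Suc (Suc k)) I u" and t: "t \<in> I" and x: "x \<in> chart_dom c"
  shows "pd c i (pd c j (u t)) x = pd c j (pd c i (u t)) x"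
proof -
  obtain e where e: "e > 0" "\<And>r s i j. \<bar>r\<bar> \<le> e \<Longrightarrow> \<bar>s\<bar> \<le> e \<Longrightarrow>
      snd c x + r *\<^sub>R axis i 1 + s *\<^sub>R axis j 1 \<in> chart_img c"
    using chart_segment[OF c x] by blast
  let ?I = "{-e..e}"
  let ?l = "\<lambda>r s. snd c x + r *\<^sub>R axis i 1 + s *\<^sub>R axis j 1"
  have l: "?l r s \<in> chart_img c" if "r \<in> ?I" "s \<in> ?I" for r s
    using e(2)[of r s i j] that by auto
  have w: "Ck_in c (Suc k) I (\<lambda>t. pd c j (u t))" by (rule Ck_in_pd[OF c u])
  have cont: "continuous_on (?I \<times> ?I) (\<lambda>(r, s). v t (chart_inv c (?l r s)))"
    if v: "Ck_in c m I v" for v m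
  proof -
    have "continuous_on (?I \<times> ?I) (\<lambda>p. (\<lambda>y. v t (chart_inv c y)) (?l (fst p) (snd p)))"
      by (rule continuous_on_compose2[OF Ck_in_continuous_slice[OF v t]])
        (use l in \<open>auto intro!: continuous_intros\<close>)
    then show ?thesis by (simp add: case_prod_unfold)
  qed
  have nb: "at 0 within ?I \<noteq> bot" using e by (simp add: at_within_Icc_at)
  have i: "((\<lambda>r. v t (chart_inv c (?l r s))) has_real_derivative pd c i (v t) (chart_inv c (?l r s))) (at r within ?I)"
    if v: "Ck_in c (Suc m) I v" and rs: "r \<in> ?I" "s \<in> ?I" for v m r s
  proof -
    have "((\<lambda>r. v t (chart_inv c ((snd c x + s *\<^sub>R axis j 1) + r *\<^sub>R axis i 1))) has_real_derivative
        pd c i (v t) (chart_inv c ((snd c x + s *\<^sub>R axis j 1) + r *\<^sub>R axis i 1))) (at r within ?I)"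
      by (rule has_field_derivative_at_within, rule DERIV_pd_line[OF c v t])
        (use l[OF rs] in \<open>simp add: algebra_simps\<close>)
    then show ?thesis by (simp add: algebra_simps)
  qed
  have "((\<lambda>s. pd c i (u t) (chart_inv c (?l 0 s))) has_real_derivative
      pd c i (pd c j (u t)) (chart_inv c (?l 0 0))) (at 0)"
  proof (rule mixed_partials_commute[where I = ?I and a = "-e" and b = e
        and F = "\<lambda>r s. u t (chart_inv c (?l r s))" and ?F2.0 = "\<lambda>r s. pd c j (u t) (chart_inv c (?l r s))"
        and ?F21.0 = "\<lambda>r s. pd c i (pd c j (u t)) (chart_inv c (?l r s))"])
    show "((\<lambda>t'. u t (chart_inv c (?l t' s))) has_real_derivative pd c i (u t) (chart_inv c (?l 0 s))) (at 0 within ?I)"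
      if "s \<in> ?I" for s using i[OF u _ that, of 0] e by simp
    show "((\<lambda>s. u t (chart_inv c (?l r s))) has_real_derivative pd c j (u t) (chart_inv c (?l r s))) (at s within ?I)"
      if "r \<in> ?I" "s \<in> ?I" for r s
      by (rule has_field_derivative_at_within[OF DERIV_pd_line[OF c u t l[OF that]]])
    show "((\<lambda>r. pd c j (u t) (chart_inv c (?l r s))) has_real_derivative pd c i (pd c j (u t)) (chart_inv c (?l r s))) (at r within ?I)"
      if "r \<in> ?I" "s \<in> ?I" for r s by (rule i[OF w that])
    show "continuous_on ?I (\<lambda>s. pd c j (u t) (chart_inv c (?l r s)))" if "r \<in> ?I" for r
      by (rule continuous_on_slice[OF cont[OF w] that])
    show "continuous_on (?I \<times> ?I) (\<lambda>(r, s). pd c i (pd c j (u t)) (chart_inv c (?l r s)))"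
      by (rule cont[OF Ck_in_pd[OF c w]])
  qed (use e nb in auto)
  then show ?thesis
    using chart_inv_chart[OF c x] by (intro pd_eqI[symmetric]) simp
qed

end

section \<open>Symmetric matrices\<close>

lemma matrix_inv_symmetric:
  fixes M :: "real^'n^'n"
  assumes "transpose M = M" "det M \<noteq> 0"
  shows "transpose (matrix_inv M) = matrix_inv M"
proof -
  have inv: "invertible M" using assms(2) by (simp add: invertible_det_nz)
  have "transpose (matrix_inv M) ** M = mat 1"
    using matrix_inv_right[OF inv] assms(1) by (metis matrix_transpose_mul transpose_mat)
  then have "transpose (matrix_inv M) ** M ** matrix_inv M = matrix_inv M" by simp
  then show ?thesis using matrix_inv_right[OF inv] by (simp flip: matrix_mul_assoc)
qed

lemma inner_symmetric_matrix:
  fixes N :: "real^'n^'n"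
  assumes "transpose N = N"
  shows "x \<bullet> (N *v y) = (N *v x) \<bullet> y"
  using assms by (metis dot_lmul_matrix transpose_matrix_vector)

text \<open>The segment from the unit matrix to a positive definite matrix consists of positive definite,
  hence invertible, matrices, so the determinant keeps its sign along it.\<close>

lemma det_pos_if_positive_definite:
  fixes M :: "real^'n^'n"
  assumes pos: "\<And>\<xi>. \<xi> \<noteq> 0 \<Longrightarrow> \<xi> \<bullet> (M *v \<xi>) > 0"
  shows "det M > 0"
proof (rule ccontr)
  let ?P = "\<lambda>s::real. mat (1 - s) + s *\<^sub>R M"
  assume "\<not> det M > 0"
  then have "det (?P 1) \<le> 0" "det (?P 0) \<ge> 0" by (simp_all add: mat_0)
  moreover have "continuous_on {0..1} (\<lambda>s. ?P s $ i $ j)" for i j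
    by (cases "i = j") (auto simp: mat_def intro!: continuous_intros)
  then have "continuous_on {0..1} (\<lambda>s. det (?P s))"
    unfolding det_def
    by (intro continuous_on_sum continuous_on_mult continuous_on_prod continuous_on_const) auto
  ultimately obtain s where s: "0 \<le> s" "s \<le> 1" "det (?P s) = 0"
    using IVT2'[of "\<lambda>s. det (?P s)" 1 0 0] by auto
  then have "\<not> invertible (?P s)" by (simp add: invertible_det_nz)
  then obtain \<xi> where \<xi>: "\<xi> \<noteq> 0" "?P s *v \<xi> = 0"
    by (metis invertible_def matrix_left_invertible_ker invertible_left_inverse)
  have "mat (1 - s) *v \<xi> = (1 - s) *\<^sub>R \<xi>"
    by (simp add: vec_eq_iff matrix_vector_mult_def mat_def if_distrib[of "\<lambda>a. a * _"] cong: if_cong)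
  then have "(1 - s) *\<^sub>R \<xi> + s *\<^sub>R (M *v \<xi>) = 0"
    using \<xi>(2) by (simp add: matrix_vector_mult_add_rdistrib scaleR_matrix_vector_assoc)
  then have "0 = \<xi> \<bullet> ((1 - s) *\<^sub>R \<xi> + s *\<^sub>R (M *v \<xi>))" by simp
  then have "0 = (1 - s) * (\<xi> \<bullet> \<xi>) + s * (\<xi> \<bullet> (M *v \<xi>))"
    by (simp only: inner_add_right inner_scaleR_right)
  moreover have "(1 - s) * (\<xi> \<bullet> \<xi>) \<ge> 0" "s * (\<xi> \<bullet> (M *v \<xi>)) \<ge> 0" "\<xi> \<bullet> \<xi> > 0"
    using s pos[OF \<xi>(1)] \<xi>(1) by auto
  ultimately have "(1 - s) * (\<xi> \<bullet> \<xi>) = 0" "s * (\<xi> \<bullet> (M *v \<xi>)) = 0" by linarith+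
  then show False using pos[OF \<xi>(1)] \<open>\<xi> \<bullet> \<xi> > 0\<close> by simp
qed

text \<open>With \<open>M\<close> the metric and \<open>p\<close>, \<open>q\<close> the differentials of two functions this is the derivative of
  their gradient product, along coordinate lines as well as in time.\<close>

lemma DERIV_inverse_form:
  fixes M :: "real \<Rightarrow> real^'n^'n" and p q :: "real \<Rightarrow> real^'n"
  assumes M: "\<And>i j. ((\<lambda>s. M s $ i $ j) has_real_derivative M' $ i $ j) (at t within S)"
    and p: "\<And>i. ((\<lambda>s. p s $ i) has_real_derivative p' $ i) (at t within S)"
    and q: "\<And>i. ((\<lambda>s. q s $ i) has_real_derivative q' $ i) (at t within S)"
    and M_sym: "transpose (M t) = M t" and det: "det (M t) \<noteq> 0"
  defines "N \<equiv> matrix_inv (M t)"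
  shows "((\<lambda>s. p s \<bullet> (matrix_inv (M s) *v q s)) has_real_derivative
     p' \<bullet> (N *v q t) + (N *v p t) \<bullet> q' - (N *v p t) \<bullet> (M' *v (N *v q t))) (at t within S)"
proof -
  have N: "transpose N = N" unfolding N_def by (rule matrix_inv_symmetric[OF M_sym det])
  let ?N' = "- (N ** M' ** N)"
  have N': "((\<lambda>s. matrix_inv (M s) $ i $ j) has_real_derivative ?N' $ i $ j) (at t within S)" for i j
    using DERIV_matrix_inv[OF M det, of i j] by (simp add: N_def)
  have Nq: "((\<lambda>s. \<Sum>j\<in>UNIV. matrix_inv (M s) $ i $ j * q s $ j) has_real_derivative
      (\<Sum>j\<in>UNIV. ?N' $ i $ j * q t $ j + q' $ j * N $ i $ j)) (at t within S)" for i
    using DERIV_sum[OF DERIV_mult[OF N' q]] by (simp add: N_def)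
  have "((\<lambda>s. \<Sum>i\<in>UNIV. p s $ i * (\<Sum>j\<in>UNIV. matrix_inv (M s) $ i $ j * q s $ j)) has_real_derivative
     (\<Sum>i\<in>UNIV. p' $ i * (\<Sum>j\<in>UNIV. N $ i $ j * q t $ j)
       + (\<Sum>j\<in>UNIV. ?N' $ i $ j * q t $ j + q' $ j * N $ i $ j) * p t $ i)) (at t within S)"
    using DERIV_sum[OF DERIV_mult[OF p Nq]] by (simp add: N_def)
  moreover have "(\<lambda>s. p s \<bullet> (matrix_inv (M s) *v q s)) =
      (\<lambda>s. \<Sum>i\<in>UNIV. p s $ i * (\<Sum>j\<in>UNIV. matrix_inv (M s) $ i $ j * q s $ j))"
    by (simp add: inner_vec_def matrix_vector_mult_def)
  moreover have "(\<Sum>i\<in>UNIV. p' $ i * (\<Sum>j\<in>UNIV. N $ i $ j * q t $ j)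
       + (\<Sum>j\<in>UNIV. ?N' $ i $ j * q t $ j + q' $ j * N $ i $ j) * p t $ i)
     = p' \<bullet> (N *v q t) + (p t \<bullet> (?N' *v q t) + p t \<bullet> (N *v q'))"
    by (simp only: inner_vec_def matrix_vector_mult_def sum.distrib vec_lambda_beta inner_real_def)
      (simp add: sum.distrib algebra_simps)
  moreover have "p t \<bullet> (N *v q') = (N *v p t) \<bullet> q'" by (rule inner_symmetric_matrix[OF N])
  moreover have "p t \<bullet> (?N' *v q t) = - ((N *v p t) \<bullet> (M' *v (N *v q t)))"
  proof -
    have "?N' *v q t = - (N *v (M' *v (N *v q t)))"
      by (simp add: matrix_vector_mul_assoc matrix_mul_assoc)
        (simp add: vec_eq_iff matrix_vector_mult_def sum_negf)
    then show ?thesis by (simp add: inner_symmetric_matrix[OF N])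
  qed
  ultimately show ?thesis by (simp add: add_diff_eq)
qed

section \<open>The gradient inner product\<close>

text \<open>\<open>\<langle>\<nabla>a, \<nabla>b\<rangle> = da(\<nabla>b)\<close>, in a chart and on the manifold.\<close>

definition chart_inner ::
  "('a, 'n::finite) tensor2 \<Rightarrow> ('a, 'n) chart \<Rightarrow> ('a \<Rightarrow> real) \<Rightarrow> ('a \<Rightarrow> real) \<Rightarrow> 'a \<Rightarrow> real" where
  "chart_inner g c a b x = (\<chi> i. pd c i a x) \<bullet> grad g c b x"

definition grad_inner ::
  "('a, 'n::finite) chart set \<Rightarrow> ('a, 'n) tensor2 \<Rightarrow> ('a \<Rightarrow> real) \<Rightarrow> ('a \<Rightarrow> real) \<Rightarrow> 'a \<Rightarrow> real" where
  "grad_inner A g a b = in_chart A (\<lambda>c. chart_inner g c a b)"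

lemma grad_component: "grad g c u x $ i = (\<Sum>j\<in>UNIV. matrix_inv (g c x) $ i $ j * pd c j u x)"
  by (simp add: grad_def matrix_vector_mult_def)

lemma chart_inner_sum: "chart_inner g c a b x = (\<Sum>i\<in>UNIV. pd c i a x * grad g c b x $ i)"
  by (simp add: chart_inner_def inner_vec_def)

context manifold
begin

lemma pd_cong_open:
  assumes "c \<in> A" "x \<in> chart_dom c" "open U" "x \<in> U" "\<And>y. y \<in> chart_dom c \<Longrightarrow> y \<in> U \<Longrightarrow> u y = w y"
  shows "pd c i u x = pd c i w x"
  unfolding pd_def
proof (rule deriv_cong_ev)
  have "open (snd c ` (U \<inter> chart_dom c))"
    by (rule chart_image_open[OF assms(1) open_Int[OF assms(3) open_chart_dom[OF assms(1)]]]) auto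
  then have "open ((\<lambda>s. snd c x + s *\<^sub>R axis i (1::real)) -` snd c ` (U \<inter> chart_dom c))"
    by (intro open_vimage continuous_intros)
  moreover have "0 \<in> (\<lambda>s. snd c x + s *\<^sub>R axis i (1::real)) -` snd c ` (U \<inter> chart_dom c)"
    using assms by auto
  ultimately have "\<forall>\<^sub>F s in nhds 0. s \<in> (\<lambda>s. snd c x + s *\<^sub>R axis i (1::real)) -` snd c ` (U \<inter> chart_dom c)"
    by (rule eventually_nhds_in_open)
  then show "\<forall>\<^sub>F s in nhds 0. u (chart_inv c (snd c x + s *\<^sub>R axis i 1)) = w (chart_inv c (snd c x + s *\<^sub>R axis i 1))"
  proof eventually_elim
    case (elim s)
    then obtain y where "y \<in> U" "y \<in> chart_dom c" "snd c x + s *\<^sub>R axis i 1 = snd c y" by auto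
    then show ?case using assms(5) chart_inv_chart[OF assms(1)] by simp
  qed
qed simp

lemma pd_cong:
  assumes "c \<in> A" "x \<in> chart_dom c" "\<And>y. y \<in> chart_dom c \<Longrightarrow> u y = w y"
  shows "pd c i u x = pd c i w x"
  by (rule pd_cong_open[OF assms(1,2) open_UNIV]) (simp_all add: assms(3))

lemma in_chart_eq:
  assumes "\<And>c. c \<in> A \<Longrightarrow> x \<in> chart_dom c \<Longrightarrow> F c x = r"
  shows "in_chart A F x = r"
proof -
  have "\<exists>c. c \<in> A \<and> x \<in> chart_dom c" using chart_covers by blast
  from someI_ex[OF this] show ?thesis unfolding in_chart_def using assms by blast
qed

text \<open>The chain rule for the coordinate change: partial derivatives transform with the Jacobian.\<close>

lemma pd_change_chart:
  assumes c: "c \<in> A" and d: "d \<in> A" and x: "x \<in> chart_dom c" "x \<in> chart_dom d"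
    and u: "Ck_in d (Suc k) I u" and t: "t \<in> I"
  shows "pd c i (u t) x = (\<Sum>a\<in>UNIV. pd d a (u t) x * coord_jacobian c d x $ a $ i)"
proof -
  let ?U = "snd c ` (chart_dom c \<inter> chart_dom d)" and ?\<tau> = "snd d \<circ> chart_inv c"
  let ?l = "\<lambda>s. snd c x + s *\<^sub>R axis i (1::real)"
  let ?N = "?l -` ?U"
  have U: "open ?U" by (rule chart_image_open[OF c open_Int[OF open_chart_dom[OF c] open_chart_dom[OF d]]]) auto
  have N: "open ?N" "0 \<in> ?N"
    using x by (auto intro!: open_vimage U continuous_intros)
  have \<tau>_in: "?\<tau> y \<in> chart_img d" "chart_inv d (?\<tau> y) = chart_inv c y" if "y \<in> ?U" for y
    using that chart_inv_chart[OF c] chart_inv_chart[OF d] by auto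
  have \<tau>0: "?\<tau> (?l 0) = snd d x" using chart_inv_chart[OF c x(1)] by simp
  have "Ck_on 1 ?U ?\<tau>" using smooth_transition[OF c d] by (simp only: smooth_on_def)
  then obtain T where T: "\<And>y. y \<in> ?U \<Longrightarrow> (?\<tau> has_derivative T y) (at y within ?U)"
    by (auto simp: One_nat_def)
  have Tx: "(?\<tau> has_derivative T (?l 0)) (at (?l 0) within ?l ` ?N)"
    by (rule has_derivative_subset[OF T]) (use N(2) in auto)
  have "(?l has_derivative (\<lambda>s. s *\<^sub>R axis i 1)) (at 0 within ?N)"
    by (auto intro!: derivative_eq_intros)
  from has_derivative_in_compose[OF this Tx]
  have line: "((\<lambda>s. ?\<tau> (?l s)) has_derivative (\<lambda>s. T (?l 0) (s *\<^sub>R axis i 1))) (at 0 within ?N)" .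
  define J where "J = T (?l 0) (axis i 1)"
  have "T (?l 0) (s *\<^sub>R axis i 1) = s *\<^sub>R J" for s
    using has_derivative_linear[OF Tx] unfolding J_def by (rule linear_scale)
  with line have line': "((\<lambda>s. ?\<tau> (?l s)) has_derivative (\<lambda>s. s *\<^sub>R J)) (at 0 within ?N)" by simp
  have J: "coord_jacobian c d x $ a $ i = J $ a" for a
  proof -
    have "((\<lambda>s. ?\<tau> (?l s) $ a) has_derivative (\<lambda>s. s *\<^sub>R J $ a)) (at 0 within ?N)"
      using bounded_linear.has_derivative[OF bounded_linear_vec_nth line'] by simp
    moreover have "(\<lambda>s. s *\<^sub>R J $ a) = (*) (J $ a)" by (simp add: fun_eq_iff mult.commute)
    ultimately have "((\<lambda>s. snd d (chart_inv c (?l s)) $ a) has_real_derivative J $ a) (at 0)"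
      unfolding has_field_derivative_def at_within_open[OF N(2,1)] by simp
    then show ?thesis
      by (simp add: coord_jacobian_def pd_eqI)
  qed
  show ?thesis
  proof (rule Ck_in_differential[OF d u])
    let ?f = "\<lambda>(t, y). u t (chart_inv d y)" and ?S = "I \<times> chart_img d"
    fix D :: "real \<times> (real^'n) \<Rightarrow> real \<times> (real^'n) \<Rightarrow> real"
    assume "\<And>q. q \<in> ?S \<Longrightarrow> (?f has_derivative D q) (at q within ?S)"
    then have D: "(?f has_derivative D (t, snd d x)) (at (t, snd d x) within ?S)" using t x by auto
    have Dlin: "linear (D (t, snd d x))" using D has_derivative_linear by blast
    assume "\<And>t x i. t \<in> I \<Longrightarrow> x \<in> chart_dom d \<Longrightarrow>
      ((\<lambda>s. u t (chart_inv d (snd d x + s *\<^sub>R axis i 1))) has_real_derivative D (t, snd d x) (0, axis i 1)) (at 0)"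
    from pd_eqI[OF this[OF t x(2)]]
    have D_axis: "D (t, snd d x) (0, axis a 1) = pd d a (u t) x" for a by simp
    have "((\<lambda>s. (t, ?\<tau> (?l s))) has_derivative (\<lambda>s. (0, s *\<^sub>R J))) (at 0 within ?N)"
      by (rule has_derivative_Pair[OF has_derivative_const line'])
    moreover have "(?f has_derivative D (t, snd d x)) (at (t, ?\<tau> (?l 0)) within (\<lambda>s. (t, ?\<tau> (?l s))) ` ?N)"
      unfolding \<tau>0 by (rule has_derivative_subset[OF D]) (use t \<tau>_in(1) in blast)
    ultimately have "((\<lambda>s. ?f (t, ?\<tau> (?l s))) has_derivative (\<lambda>s. D (t, snd d x) (0, s *\<^sub>R J))) (at 0 within ?N)"
      by (rule has_derivative_in_compose)
    then have "((\<lambda>s. u t (chart_inv c (?l s))) has_derivative (\<lambda>s. D (t, snd d x) (0, s *\<^sub>R J))) (at 0 within ?N)"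
      by (rule has_derivative_transform[rotated 2]) (use N \<tau>_in(2) in auto)
    moreover have "(\<lambda>s. D (t, snd d x) (0, s *\<^sub>R J)) = (*) (D (t, snd d x) (0, J))"
      using linear_scale[OF Dlin, of _ "(0, J)"] by (simp add: fun_eq_iff mult.commute)
    ultimately have "((\<lambda>s. u t (chart_inv c (?l s))) has_real_derivative D (t, snd d x) (0, J)) (at 0)"
      unfolding has_field_derivative_def at_within_open[OF N(2,1)] by (simp only:)
    then have "pd c i (u t) x = D (t, snd d x) (0, J)" by (rule pd_eqI)
    also have "(0, J) = (\<Sum>a\<in>UNIV. J $ a *\<^sub>R (0::real, axis a (1::real)))"
      by (subst basis_expansion[symmetric]) (simp add: prod_eq_iff fst_sum snd_sum scalar_mult_eq_scaleR)
    also have "D (t, snd d x) \<dots> = (\<Sum>a\<in>UNIV. J $ a *\<^sub>R D (t, snd d x) (0, axis a 1))"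
      by (simp only: linear_sum[OF Dlin] linear_scale[OF Dlin])
    finally show ?thesis by (simp add: D_axis J mult.commute)
  qed
qed

end

section \<open>Families of Riemannian metrics\<close>

text \<open>Both sides of the identity that compares iterated gradient products with the Hessian are
  cubic sums over the first derivatives \<open>D k i j = \<partial>\<^sub>k g\<^sub>i\<^sub>j\<close>; relabelling the summation
  indices matches them.\<close>

lemma hessian_sum_identity:
  fixes V F :: "'n::finite \<Rightarrow> real" and f2 v2 :: "'n \<Rightarrow> 'n \<Rightarrow> real" and D :: "'n \<Rightarrow> 'n \<Rightarrow> 'n \<Rightarrow> real"
  assumes v2: "\<And>i j. v2 i j = v2 j i" and D: "\<And>k i j. D k i j = D k j i"
  shows "2 * (\<Sum>k\<in>UNIV. V k * ((\<Sum>i\<in>UNIV. f2 k i * V i) + (\<Sum>i\<in>UNIV. F i * v2 k i)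
             - (\<Sum>i\<in>UNIV. F i * (\<Sum>j\<in>UNIV. D k i j * V j))))
       - (\<Sum>k\<in>UNIV. F k * ((\<Sum>i\<in>UNIV. v2 k i * V i) + (\<Sum>i\<in>UNIV. V i * v2 k i)
             - (\<Sum>i\<in>UNIV. V i * (\<Sum>j\<in>UNIV. D k i j * V j))))
     = 2 * (\<Sum>i\<in>UNIV. V i * (\<Sum>j\<in>UNIV. (f2 i j
             - 1/2 * (\<Sum>l\<in>UNIV. F l * (D i j l + D j i l - D l i j))) * V j))"
proof -
  let ?S = "\<lambda>h::'n \<Rightarrow> real. sum h UNIV"
  define T1 where "T1 = ?S (\<lambda>k. ?S (\<lambda>i. V k * f2 k i * V i))"
  define T2 where "T2 = ?S (\<lambda>k. ?S (\<lambda>i. V k * F i * v2 k i))"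
  define T3 where "T3 = ?S (\<lambda>k. ?S (\<lambda>i. ?S (\<lambda>j. V k * F i * D k i j * V j)))"
  define T4 where "T4 = ?S (\<lambda>k. ?S (\<lambda>i. ?S (\<lambda>j. F k * V i * D k i j * V j)))"
  have T2': "?S (\<lambda>k. ?S (\<lambda>i. F k * v2 k i * V i)) = T2"
    unfolding T2_def by (subst sum.swap) (simp add: v2 mult_ac)
  have T3a: "?S (\<lambda>i. ?S (\<lambda>j. ?S (\<lambda>l. V i * F l * D i j l * V j))) = T3"
    unfolding T3_def by (rule sum.cong[OF refl], subst sum.swap) (simp add: D)
  have T3b: "?S (\<lambda>i. ?S (\<lambda>j. ?S (\<lambda>l. V i * F l * D j i l * V j))) = T3"
    unfolding T3a[symmetric] by (subst sum.swap) (simp add: mult_ac)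
  have T4': "?S (\<lambda>i. ?S (\<lambda>j. ?S (\<lambda>l. V i * F l * D l i j * V j))) = T4"
  proof -
    have "?S (\<lambda>i. ?S (\<lambda>j. ?S (\<lambda>l. V i * F l * D l i j * V j)))
        = ?S (\<lambda>i. ?S (\<lambda>l. ?S (\<lambda>j. V i * F l * D l i j * V j)))"
      by (rule sum.cong[OF refl], rule sum.swap)
    also have "\<dots> = ?S (\<lambda>l. ?S (\<lambda>i. ?S (\<lambda>j. V i * F l * D l i j * V j)))" by (rule sum.swap)
    finally show ?thesis unfolding T4_def by (simp add: mult_ac)
  qed
  have e1: "?S (\<lambda>k. V k * (?S (\<lambda>i. f2 k i * V i) + ?S (\<lambda>i. F i * v2 k i)
             - ?S (\<lambda>i. F i * ?S (\<lambda>j. D k i j * V j)))) = T1 + T2 - T3"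
    by (simp add: T1_def T2_def T3_def sum_distrib_left sum.distrib sum_subtractf distrib_left
        right_diff_distrib mult.assoc)
  have e2: "?S (\<lambda>k. F k * (?S (\<lambda>i. v2 k i * V i) + ?S (\<lambda>i. V i * v2 k i)
             - ?S (\<lambda>i. V i * ?S (\<lambda>j. D k i j * V j)))) = 2 * T2 - T4"
  proof -
    have "?S (\<lambda>k. F k * (?S (\<lambda>i. v2 k i * V i) + ?S (\<lambda>i. V i * v2 k i)
             - ?S (\<lambda>i. V i * ?S (\<lambda>j. D k i j * V j))))
      = ?S (\<lambda>k. ?S (\<lambda>i. F k * v2 k i * V i)) + ?S (\<lambda>k. ?S (\<lambda>i. F k * v2 k i * V i)) - T4"
      by (simp add: T4_def sum_distrib_left sum.distrib sum_subtractf distrib_left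
          right_diff_distrib mult_ac)
    then show ?thesis by (simp add: T2')
  qed
  have e3: "?S (\<lambda>i. V i * ?S (\<lambda>j. (f2 i j - 1/2 * ?S (\<lambda>l. F l * (D i j l + D j i l - D l i j))) * V j))
      = T1 - 1/2 * (T3 + T3 - T4)"
  proof -
    have "V i * ((f2 i j - 1/2 * ?S (\<lambda>l. F l * (D i j l + D j i l - D l i j))) * V j)
      = V i * f2 i j * V j - 1/2 * (?S (\<lambda>l. V i * F l * D i j l * V j) + ?S (\<lambda>l. V i * F l * D j i l * V j)
          - ?S (\<lambda>l. V i * F l * D l i j * V j))" for i j
    proof -
      have "?S (\<lambda>l. V i * F l * D i j l * V j) + ?S (\<lambda>l. V i * F l * D j i l * V j)
          - ?S (\<lambda>l. V i * F l * D l i j * V j) = V i * V j * ?S (\<lambda>l. F l * (D i j l + D j i l - D l i j))"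
        by (simp add: sum_distrib_left flip: sum.distrib sum_subtractf) (simp add: algebra_simps)
      then show ?thesis by (simp add: algebra_simps)
    qed
    then have "?S (\<lambda>i. V i * ?S (\<lambda>j. (f2 i j - 1/2 * ?S (\<lambda>l. F l * (D i j l + D j i l - D l i j))) * V j))
      = ?S (\<lambda>i. ?S (\<lambda>j. V i * f2 i j * V j - 1/2 * (?S (\<lambda>l. V i * F l * D i j l * V j) + ?S (\<lambda>l. V i * F l * D j i l * V j)
          - ?S (\<lambda>l. V i * F l * D l i j * V j))))"
      by (simp only: sum_distrib_left)
    also have "\<dots> = T1 - 1/2 * (?S (\<lambda>i. ?S (\<lambda>j. ?S (\<lambda>l. V i * F l * D i j l * V j)))
        + ?S (\<lambda>i. ?S (\<lambda>j. ?S (\<lambda>l. V i * F l * D j i l * V j)))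
        - ?S (\<lambda>i. ?S (\<lambda>j. ?S (\<lambda>l. V i * F l * D l i j * V j))))"
      by (simp only: T1_def sum_subtractf sum.distrib flip: sum_distrib_left)
    finally show ?thesis by (simp only: T3a T3b T4')
  qed
  show ?thesis unfolding e1 e2 e3 by (simp add: field_simps)
qed

locale riemannian_family = manifold A
  for A :: "('a::t2_space, 'n::finite) chart set" +
  fixes I :: "real set" and g :: "real \<Rightarrow> ('a, 'n) tensor2"
  assumes metric: "\<And>t. t \<in> I \<Longrightarrow> riemannian_metric A (g t)"
    and smooth_metric: "\<And>c. c \<in> A \<Longrightarrow> smooth_family_in c I (\<lambda>t. g t c)"
begin

lemma Ck_in_metric: "c \<in> A \<Longrightarrow> Ck_in c k I (\<lambda>t x. g t c x $ i $ j)"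
proof -
  assume "c \<in> A"
  then have "Ck_on k (I \<times> chart_img c) (\<lambda>(t, y). g t c (chart_inv c y))"
    using smooth_metric by (simp add: smooth_family_in_def smooth_on_def)
  then have "Ck_on k (I \<times> chart_img c) (\<lambda>p. (case p of (t, y) \<Rightarrow> g t c (chart_inv c y)) $ i $ j)"
    by (intro Ck_on_linear[OF bounded_linear_vec_nth])
  then show ?thesis by (simp add: Ck_in_def case_prod_unfold)
qed

lemma
  assumes "c \<in> A" "t \<in> I" "x \<in> chart_dom c"
  shows metric_transpose: "transpose (g t c x) = g t c x"
    and metric_det_pos: "det (g t c x) > 0"
  using metric[OF assms(2)] assms(1,3)
  by (auto simp: riemannian_metric_def intro!: det_pos_if_positive_definite)

lemma metric_symmetric:
  assumes "c \<in> A" "t \<in> I" "x \<in> chart_dom c"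
  shows "g t c x $ i $ j = g t c x $ j $ i"
  using arg_cong[OF metric_transpose[OF assms], of "\<lambda>M. M $ j $ i"] by (simp add: transpose_def)

lemma metric_inv_transpose:
  assumes "c \<in> A" "t \<in> I" "x \<in> chart_dom c"
  shows "transpose (matrix_inv (g t c x)) = matrix_inv (g t c x)"
  by (rule matrix_inv_symmetric[OF metric_transpose[OF assms]]) (use metric_det_pos[OF assms] in simp)

lemma metric_inv_symmetric:
  assumes "c \<in> A" "t \<in> I" "x \<in> chart_dom c"
  shows "matrix_inv (g t c x) $ i $ j = matrix_inv (g t c x) $ j $ i"
  using arg_cong[OF metric_inv_transpose[OF assms], of "\<lambda>M. M $ j $ i"] by (simp add: transpose_def)

lemma metric_invertible:
  assumes "c \<in> A" "t \<in> I" "x \<in> chart_dom c"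
  shows "invertible (g t c x)"
  using metric_det_pos[OF assms] by (simp add: invertible_det_nz)

lemma metric_grad:
  assumes "c \<in> A" "t \<in> I" "x \<in> chart_dom c"
  shows "g t c x *v grad (g t) c u x = (\<chi> j. pd c j u x)"
  unfolding grad_def matrix_vector_mul_assoc matrix_inv_right[OF metric_invertible[OF assms]] by simp

lemma grad_norm2_eq:
  assumes "c \<in> A" "t \<in> I" "x \<in> chart_dom c"
  shows "grad_norm2 (g t) c u x = chart_inner (g t) c u u x"
  unfolding grad_norm2_def metric_grad[OF assms] chart_inner_def by (rule inner_commute)

lemma chart_inner_commute:
  assumes "c \<in> A" "t \<in> I" "x \<in> chart_dom c"
  shows "chart_inner (g t) c a b x = chart_inner (g t) c b a x"
  unfolding chart_inner_def grad_def
  by (subst inner_symmetric_matrix[OF metric_inv_transpose[OF assms]]) (rule inner_commute)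

lemma chart_inner_metric:
  assumes "c \<in> A" "t \<in> I" "x \<in> chart_dom c"
  shows "grad (g t) c a x \<bullet> (g t c x *v grad (g t) c b x) = chart_inner (g t) c a b x"
  unfolding metric_grad[OF assms] chart_inner_commute[OF assms, of a b]
  by (simp add: chart_inner_def inner_commute)

lemma Ck_in_matrix_inv: "c \<in> A \<Longrightarrow> Ck_in c k I (\<lambda>t x. matrix_inv (g t c x) $ i $ j)"
proof -
  assume c: "c \<in> A"
  have "Ck_on k (I \<times> chart_img c) (\<lambda>p. matrix_inv (g (fst p) c (chart_inv c (snd p))) $ i $ j)"
  proof (rule Ck_on_matrix_inv)
    show "Ck_on k (I \<times> chart_img c) (\<lambda>p. g (fst p) c (chart_inv c (snd p)) $ i $ j)" for i j
      using Ck_in_metric[OF c, of k i j] by (simp add: Ck_in_def case_prod_unfold)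
    show "det (g (fst p) c (chart_inv c (snd p))) \<noteq> 0" if "p \<in> I \<times> chart_img c" for p
      using metric_det_pos[OF c _ chart_inv_in[OF c], of "fst p" "snd p"] that by (auto simp del: imageE)
  qed
  then show ?thesis by (simp add: Ck_in_def case_prod_unfold)
qed

lemma Ck_in_sqrt_det: "c \<in> A \<Longrightarrow> Ck_in c k I (\<lambda>t x. sqrt (det (g t c x)))"
proof -
  assume c: "c \<in> A"
  have "Ck_on k (I \<times> chart_img c) (\<lambda>p. sqrt (det (g (fst p) c (chart_inv c (snd p)))))"
  proof (intro Ck_on_sqrt Ck_on_det)
    show "Ck_on k (I \<times> chart_img c) (\<lambda>p. g (fst p) c (chart_inv c (snd p)) $ i $ j)" for i j
      using Ck_in_metric[OF c, of k i j] by (simp add: Ck_in_def case_prod_unfold)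
    show "det (g (fst p) c (chart_inv c (snd p))) > 0" if "p \<in> I \<times> chart_img c" for p
      using metric_det_pos[OF c _ chart_inv_in[OF c], of "fst p" "snd p"] that by (auto simp del: imageE)
  qed
  then show ?thesis by (simp add: Ck_in_def case_prod_unfold)
qed

lemma Ck_in_grad:
  assumes "c \<in> A" "Ck_in c (Suc k) I u"
  shows "Ck_in c k I (\<lambda>t x. grad (g t) c (u t) x $ i)"
  unfolding grad_component
  by (intro Ck_in_sum Ck_in_mult Ck_in_matrix_inv Ck_in_pd assms)

lemma Ck_in_chart_inner:
  assumes "c \<in> A" "Ck_in c (Suc k) I a" "Ck_in c (Suc k) I b"
  shows "Ck_in c k I (\<lambda>t. chart_inner (g t) c (a t) (b t))"
  unfolding chart_inner_sum[abs_def]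
  by (intro Ck_in_sum Ck_in_mult Ck_in_grad Ck_in_pd assms)

text \<open>With \<open>J\<close> the Jacobian of the coordinate change, differentials transform by \<open>J\<^sup>T\<close> and the metric
  by \<open>J\<^sup>T g J\<close>; hence gradients transform by \<open>J\<close>.\<close>

lemma chart_inner_invariant:
  assumes c: "c \<in> A" and d: "d \<in> A" and x: "x \<in> chart_dom c" "x \<in> chart_dom d" and t: "t \<in> I"
    and a: "Ck_in d (Suc k) I a" and b: "Ck_in d (Suc k) I b"
  shows "chart_inner (g t) c (a t) (b t) x = chart_inner (g t) d (a t) (b t) x"
proof -
  let ?J = "coord_jacobian c d x"
  let ?p = "\<lambda>e u. \<chi> i. pd e i (u t) x"
  have p: "?p c u = transpose ?J *v ?p d u" if "Ck_in d (Suc k) I u" for u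
    unfolding vec_eq_iff pd_change_chart[OF c d x that t]
    by (simp add: matrix_vector_mult_def transpose_def mult.commute)
  have gJ: "g t c x = transpose ?J ** g t d x ** ?J"
    using metric[OF t] c d x unfolding riemannian_metric_def covariant2_def by blast
  have "det ?J \<noteq> 0" using metric_det_pos[OF c t x(1)] unfolding gJ by (auto simp: det_mul)
  then have J: "invertible (transpose ?J)" by (simp add: invertible_det_nz det_transpose)
  let ?w = "grad (g t) c (b t) x"
  have "transpose ?J *v (g t d x *v (?J *v ?w)) = g t c x *v ?w"
    by (simp only: gJ matrix_vector_mul_assoc matrix_mul_assoc)
  also have "\<dots> = transpose ?J *v ?p d b" unfolding metric_grad[OF c t x(1)] by (rule p[OF b])
  finally have "matrix_inv (transpose ?J) *v (transpose ?J *v (g t d x *v (?J *v ?w)))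
      = matrix_inv (transpose ?J) *v (transpose ?J *v ?p d b)" by (rule arg_cong)
  then have gd: "g t d x *v (?J *v ?w) = ?p d b"
    by (simp only: matrix_vector_mul_assoc matrix_mul_assoc matrix_inv_left[OF J] matrix_mul_lid matrix_vector_mul_lid)
  have "?J *v ?w = matrix_inv (g t d x) *v (g t d x *v (?J *v ?w))"
    by (simp only: matrix_vector_mul_assoc matrix_mul_assoc matrix_inv_left[OF metric_invertible[OF d t x(2)]]
        matrix_mul_lid)
  then have Jw: "?J *v ?w = grad (g t) d (b t) x"
    unfolding gd by (simp only: grad_def)
  have "(transpose ?J *v ?p d a) \<bullet> ?w = ?p d a \<bullet> (?J *v ?w)"
    by (simp only: transpose_matrix_vector dot_lmul_matrix)
  then show ?thesis unfolding chart_inner_def p[OF a] Jw .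
qed

lemma grad_inner_eq:
  assumes "c \<in> A" "x \<in> chart_dom c" "t \<in> I" "Ck_family A (Suc k) I a" "Ck_family A (Suc k) I b"
  shows "grad_inner A (g t) (a t) (b t) x = chart_inner (g t) c (a t) (b t) x"
  unfolding grad_inner_def
  by (rule in_chart_eq) (use chart_inner_invariant assms Ck_familyD in metis)

lemma Ck_family_grad_inner:
  assumes "Ck_family A (Suc k) I a" "Ck_family A (Suc k) I b"
  shows "Ck_family A k I (\<lambda>t. grad_inner A (g t) (a t) (b t))"
  unfolding Ck_family_def
proof
  fix c assume c: "c \<in> A"
  show "Ck_in c k I (\<lambda>t. grad_inner A (g t) (a t) (b t))"
    using Ck_in_chart_inner[OF c Ck_familyD[OF assms(1) c] Ck_familyD[OF assms(2) c]]
    by (subst Ck_in_cong[OF c]) (use grad_inner_eq[OF c _ _ assms] in auto)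
qed

lemma pd_mult:
  assumes "c \<in> A" "t \<in> I" "x \<in> chart_dom c" "Ck_in c (Suc k) I a" "Ck_in c (Suc k) I b"
  shows "pd c i (\<lambda>x. a t x * b t x) x = a t x * pd c i (b t) x + b t x * pd c i (a t) x"
  by (rule pd_eqI)
    (use DERIV_mult[OF DERIV_pd[OF assms(1,4,2,3), of i] DERIV_pd[OF assms(1,5,2,3), of i]]
      chart_inv_chart[OF assms(1,3)] in \<open>simp add: algebra_simps\<close>)

lemma pd_sum:
  assumes "c \<in> A" "t \<in> I" "x \<in> chart_dom c" "\<And>j. j \<in> F \<Longrightarrow> Ck_in c (Suc k) I (a j)"
  shows "pd c i (\<lambda>x. \<Sum>j\<in>F. a j t x) x = (\<Sum>j\<in>F. pd c i (a j t) x)"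
  by (rule pd_eqI, rule DERIV_sum) (use DERIV_pd assms in blast)

text \<open>The volume density, differentiated along a coordinate line; the sum is \<open>2 \<Gamma>\<^sup>i\<^sub>i\<^sub>k\<close>.\<close>

lemma pd_sqrt_det:
  assumes c: "c \<in> A" and t: "t \<in> I" and x: "x \<in> chart_dom c"
  shows "pd c k (\<lambda>y. sqrt (det (g t c y))) x =
     sqrt (det (g t c x)) * (\<Sum>i\<in>UNIV. christoffel (g t) c i i k x)"
proof -
  let ?N = "matrix_inv (g t c x)" and ?D = "\<lambda>k i j. pd c k (\<lambda>y. g t c y $ i $ j) x"
  have N: "?N $ i $ j = ?N $ j $ i" for i j by (rule metric_inv_symmetric[OF c t x])
  have D: "?D k i j = ?D k j i" for k i j
    by (rule pd_cong[OF c x]) (rule metric_symmetric[OF c t])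
  have "pd c k (\<lambda>y. sqrt (det (g t c y))) x =
     sqrt (det (g t c x)) * (1/2 * (\<Sum>i\<in>UNIV. \<Sum>j\<in>UNIV. ?N $ i $ j * (\<chi> i j. ?D k i j) $ j $ i))"
    using DERIV_sqrt_det[of "\<lambda>s. g t c (chart_inv c (snd c x + s *\<^sub>R axis k 1))" "\<chi> i j. ?D k i j" 0 UNIV]
      DERIV_pd[OF c Ck_in_metric[OF c] t x] chart_inv_chart[OF c x] metric_det_pos[OF c t x]
    by (intro pd_eqI) simp
  moreover have "(\<Sum>i\<in>UNIV. christoffel (g t) c i i k x) = 1/2 * (\<Sum>i\<in>UNIV. \<Sum>j\<in>UNIV. ?N $ i $ j * ?D k j i)"
  proof -
    have "(\<Sum>i\<in>UNIV. \<Sum>l\<in>UNIV. ?N $ i $ l * ?D l i k) = (\<Sum>i\<in>UNIV. \<Sum>l\<in>UNIV. ?N $ i $ l * ?D i k l)"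
      by (subst sum.swap) (simp add: N D)
    then show ?thesis
      by (simp add: christoffel_def flip: sum_divide_distrib)
        (simp add: algebra_simps sum.distrib sum_subtractf D)
  qed
  ultimately show ?thesis by (simp only: vec_lambda_beta)
qed

lemma divergence_density:
  assumes c: "c \<in> A" and t: "t \<in> I" and x: "x \<in> chart_dom c"
    and X: "\<And>i. Ck_in c (Suc k) I (\<lambda>t x. X t x $ i)"
  shows "(\<Sum>i\<in>UNIV. pd c i (\<lambda>y. sqrt (det (g t c y)) * X t y $ i) x)
    = sqrt (det (g t c x)) * divergence (g t) c (X t) x"
proof -
  define C where "C i = (\<Sum>j\<in>UNIV. christoffel (g t) c j j i x)" for i
  have "pd c i (\<lambda>y. sqrt (det (g t c y)) * X t y $ i) x = sqrt (det (g t c x)) * pd c i (\<lambda>y. X t y $ i) x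
      + X t x $ i * (sqrt (det (g t c x)) * C i)" for i
    using pd_mult[OF c t x Ck_in_sqrt_det[OF c] X] by (simp add: pd_sqrt_det[OF c t x] C_def)
  then have "(\<Sum>i\<in>UNIV. pd c i (\<lambda>y. sqrt (det (g t c y)) * X t y $ i) x)
      = sqrt (det (g t c x)) * ((\<Sum>i\<in>UNIV. pd c i (\<lambda>y. X t y $ i) x) + (\<Sum>i\<in>UNIV. X t x $ i * C i))"
    by (simp add: sum.distrib sum_distrib_left distrib_left mult_ac)
  moreover have "(\<Sum>i\<in>UNIV. X t x $ i * C i)
      = (\<Sum>i\<in>UNIV. \<Sum>j\<in>UNIV. christoffel (g t) c i i j x * X t x $ j)"
    unfolding sum_distrib_left C_def by (subst sum.swap) (simp add: mult.commute)
  ultimately show ?thesis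
    by (simp add: divergence_def sum.distrib)
qed

lemma divergence_scaled:
  assumes c: "c \<in> A" and t: "t \<in> I" and x: "x \<in> chart_dom c"
    and w: "Ck_in c (Suc k) I w" and X: "\<And>i. Ck_in c (Suc k) I (\<lambda>t x. X t x $ i)"
  shows "divergence (g t) c (\<lambda>y. w t y *\<^sub>R X t y) x
    = w t x * divergence (g t) c (X t) x + (\<Sum>i\<in>UNIV. pd c i (w t) x * X t x $ i)"
proof -
  have "pd c i (\<lambda>y. (w t y *\<^sub>R X t y) $ i) x = w t x * pd c i (\<lambda>y. X t y $ i) x + X t x $ i * pd c i (w t) x" for i
    using pd_mult[OF c t x w X] by simp
  then show ?thesis
    by (simp add: divergence_def sum.distrib sum_distrib_left distrib_left mult_ac)
qed

lemma DERIV_chart_inner_line: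
  assumes c: "c \<in> A" and t: "t \<in> I" and x: "x \<in> chart_dom c"
    and a: "Ck_in c (Suc (Suc k)) I a" and b: "Ck_in c (Suc (Suc k)) I b"
  shows "pd c l (chart_inner (g t) c (a t) (b t)) x =
     (\<Sum>i\<in>UNIV. pd c l (pd c i (a t)) x * grad (g t) c (b t) x $ i)
     + (\<Sum>i\<in>UNIV. grad (g t) c (a t) x $ i * pd c l (pd c i (b t)) x)
     - (\<Sum>i\<in>UNIV. grad (g t) c (a t) x $ i *
          (\<Sum>j\<in>UNIV. pd c l (\<lambda>y. g t c y $ i $ j) x * grad (g t) c (b t) x $ j))"
proof -
  let ?l = "\<lambda>s. chart_inv c (snd c x + s *\<^sub>R axis l 1)"
  have l0: "?l 0 = x" using chart_inv_chart[OF c x] by simp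
  have "((\<lambda>s. (\<chi> i. pd c i (a t) (?l s)) \<bullet> (matrix_inv (g t c (?l s)) *v (\<chi> i. pd c i (b t) (?l s)))) has_real_derivative
     (\<chi> i. pd c l (pd c i (a t)) x) \<bullet> (matrix_inv (g t c (?l 0)) *v (\<chi> i. pd c i (b t) (?l 0)))
     + (matrix_inv (g t c (?l 0)) *v (\<chi> i. pd c i (a t) (?l 0))) \<bullet> (\<chi> i. pd c l (pd c i (b t)) x)
     - (matrix_inv (g t c (?l 0)) *v (\<chi> i. pd c i (a t) (?l 0)))
        \<bullet> ((\<chi> i j. pd c l (\<lambda>y. g t c y $ i $ j) x) *v (matrix_inv (g t c (?l 0)) *v (\<chi> i. pd c i (b t) (?l 0))))) (at 0)"
    by (rule DERIV_inverse_form)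
      (simp_all only: vec_lambda_beta l0 metric_transpose[OF c t x] less_imp_neq[OF metric_det_pos[OF c t x], symmetric] not_False_eq_True
        DERIV_pd[OF c Ck_in_metric[OF c] t x] DERIV_pd[OF c Ck_in_pd[OF c a] t x] DERIV_pd[OF c Ck_in_pd[OF c b] t x])
  then have "pd c l (chart_inner (g t) c (a t) (b t)) x =
     (\<chi> i. pd c l (pd c i (a t)) x) \<bullet> grad (g t) c (b t) x
     + grad (g t) c (a t) x \<bullet> (\<chi> i. pd c l (pd c i (b t)) x)
     - grad (g t) c (a t) x \<bullet> ((\<chi> i j. pd c l (\<lambda>y. g t c y $ i $ j) x) *v grad (g t) c (b t) x)"
    unfolding l0 chart_inner_def grad_def by (rule pd_eqI)
  then show ?thesis
    by (simp add: inner_vec_def matrix_vector_mult_def)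
qed

text \<open>Iterated gradient products determine the Hessian of \<open>f\<close> in the direction \<open>\<nabla>v\<close>. This is
  \<open>\<langle>\<nabla>v, \<nabla>\<langle>\<nabla>f, \<nabla>v\<rangle>\<rangle> = Hess f (\<nabla>v, \<nabla>v) + Hess v (\<nabla>f, \<nabla>v)\<close> together with
  \<open>\<langle>\<nabla>f, \<nabla>|\<nabla>v|\<^sup>2\<rangle> = 2 Hess v (\<nabla>f, \<nabla>v)\<close>.\<close>

lemma hessian_grad_grad:
  assumes c: "c \<in> A" and t: "t \<in> I" and x: "x \<in> chart_dom c"
    and f: "Ck_in c (Suc (Suc k)) I f" and v: "Ck_in c (Suc (Suc k)) I v"
  shows "2 * chart_inner (g t) c (v t) (chart_inner (g t) c (f t) (v t)) x
      - chart_inner (g t) c (f t) (chart_inner (g t) c (v t) (v t)) x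
    = 2 * (grad (g t) c (v t) x \<bullet> (hessian (g t) (f t) c x *v grad (g t) c (v t) x))"
proof -
  let ?V = "\<lambda>i. grad (g t) c (v t) x $ i" and ?F = "\<lambda>i. grad (g t) c (f t) x $ i"
  let ?D = "\<lambda>k i j. pd c k (\<lambda>y. g t c y $ i $ j) x" and ?N = "matrix_inv (g t c x)"
  have inner: "chart_inner (g t) c a b x = (\<Sum>i\<in>UNIV. grad (g t) c a x $ i * pd c i b x)" for a b
    by (subst chart_inner_commute[OF c t x]) (simp add: chart_inner_sum mult.commute)
  have "hessian (g t) (f t) c x $ i $ j = pd c i (pd c j (f t)) x
      - 1/2 * (\<Sum>l\<in>UNIV. ?F l * (?D i j l + ?D j i l - ?D l i j))" for i j
  proof -
    have "(\<Sum>k\<in>UNIV. christoffel (g t) c k i j x * pd c k (f t) x)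
      = (\<Sum>k\<in>UNIV. \<Sum>l\<in>UNIV. 1/2 * (?N $ k $ l * (?D i j l + ?D j i l - ?D l i j)) * pd c k (f t) x)"
      by (simp only: christoffel_def sum_distrib_left sum_distrib_right)
    also have "\<dots> = (\<Sum>l\<in>UNIV. \<Sum>k\<in>UNIV. 1/2 * (?N $ k $ l * (?D i j l + ?D j i l - ?D l i j)) * pd c k (f t) x)"
      by (rule sum.swap)
    also have "\<dots> = 1/2 * (\<Sum>l\<in>UNIV. ?F l * (?D i j l + ?D j i l - ?D l i j))"
    proof -
      have "(\<Sum>k\<in>UNIV. 1/2 * (?N $ k $ l * B) * pd c k (f t) x) = 1/2 * (?F l * B)" for l B
      proof -
        have "(\<Sum>k\<in>UNIV. 1/2 * (?N $ k $ l * B) * pd c k (f t) x)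
          = (\<Sum>k\<in>UNIV. 1/2 * (?N $ l $ k * pd c k (f t) x * B))"
          by (intro sum.cong refl) (subst metric_inv_symmetric[OF c t x], simp)
        then show ?thesis by (simp only: grad_component sum_distrib_left sum_distrib_right)
      qed
      then show ?thesis by (simp only: sum_distrib_left)
    qed
    finally show ?thesis by (simp add: hessian_def)
  qed
  then have "grad (g t) c (v t) x \<bullet> (hessian (g t) (f t) c x *v grad (g t) c (v t) x)
    = (\<Sum>i\<in>UNIV. ?V i * (\<Sum>j\<in>UNIV. (pd c i (pd c j (f t)) x
      - 1/2 * (\<Sum>l\<in>UNIV. ?F l * (?D i j l + ?D j i l - ?D l i j))) * ?V j))"
    by (simp only: inner_vec_def matrix_vector_mult_def vec_lambda_beta inner_real_def)
  moreover have "?D k i j = ?D k j i" for k i j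
    by (rule pd_cong[OF c x]) (rule metric_symmetric[OF c t])
  ultimately show ?thesis
    unfolding inner DERIV_chart_inner_line[OF c t x f v] DERIV_chart_inner_line[OF c t x v v]
    by (subst hessian_sum_identity) (use pd_commute[OF c v t x] in auto)
qed

lemma drift_laplacian_eq:
  assumes c: "c \<in> A" and t: "t \<in> I" and x: "x \<in> chart_dom c"
    and f: "Ck_in c (Suc k) I f" and u: "Ck_in c (Suc (Suc k)) I u"
  shows "drift_laplacian (g t) (f t) c (u t) x = laplacian (g t) c (u t) x - chart_inner (g t) c (f t) (u t) x"
proof -
  have ef: "Ck_in c (Suc k) I (\<lambda>t x. exp (- f t x))"
  proof -
    have "Ck_on (Suc k) (I \<times> chart_img c) (\<lambda>p. exp (- (case p of (t, y) \<Rightarrow> f t (chart_inv c y))))"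
      by (rule Ck_on_chain[where F = "\<lambda>z. exp (- z)" and F' = "\<lambda>z. - exp (- z)"])
        (use f in \<open>auto intro!: derivative_eq_intros Ck_on_minus simp: Ck_in_def\<close>)
    then show ?thesis by (simp add: Ck_in_def case_prod_unfold)
  qed
  have pd_ef: "pd c i (\<lambda>y. exp (- f t y)) x = - exp (- f t x) * pd c i (f t) x" for i
    by (rule pd_eqI)
      (use DERIV_pd[OF c f t x, of i] chart_inv_chart[OF c x] in \<open>auto intro!: derivative_eq_intros\<close>)
  have "divergence (g t) c (\<lambda>y. exp (- f t y) *\<^sub>R grad (g t) c (u t) y) x =
     exp (- f t x) * laplacian (g t) c (u t) x
     + (\<Sum>i\<in>UNIV. pd c i (\<lambda>y. exp (- f t y)) x * grad (g t) c (u t) x $ i)"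
    unfolding laplacian_def by (rule divergence_scaled[OF c t x ef Ck_in_grad[OF c u]])
  also have "\<dots> = exp (- f t x) * (laplacian (g t) c (u t) x - chart_inner (g t) c (f t) (u t) x)"
    by (simp add: pd_ef chart_inner_sum right_diff_distrib sum_distrib_left sum_negf mult_ac)
  finally show ?thesis by (simp add: drift_laplacian_def exp_minus)
qed

lemma DERIV_chart_inner_time:
  assumes c: "c \<in> A" and t: "t \<in> I" and x: "x \<in> chart_dom c"
    and I: "convex I" "\<And>t. t \<in> I \<Longrightarrow> at t within I \<noteq> bot"
    and v: "Ck_in c (Suc (Suc k)) I v"
    and g': "((\<lambda>s. g s c x) has_vector_derivative g') (at t within I)"
  shows "((\<lambda>s. chart_inner (g s) c (v s) (v s) x) has_real_derivative
     2 * chart_inner (g t) c (v t) (time_deriv I v t) x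
     - grad (g t) c (v t) x \<bullet> (g' *v grad (g t) c (v t) x)) (at t within I)"
proof -
  have g'': "((\<lambda>s. g s c x $ i $ j) has_real_derivative g' $ i $ j) (at t within I)" for i j
    using bounded_linear.has_vector_derivative[OF bounded_linear_vec_nth
        bounded_linear.has_vector_derivative[OF bounded_linear_vec_nth g']]
    by (simp add: has_real_derivative_iff_has_vector_derivative)
  have "((\<lambda>s. chart_inner (g s) c (v s) (v s) x) has_real_derivative
     (\<chi> i. pd c i (time_deriv I v t) x) \<bullet> grad (g t) c (v t) x
     + grad (g t) c (v t) x \<bullet> (\<chi> i. pd c i (time_deriv I v t) x)
     - grad (g t) c (v t) x \<bullet> (g' *v grad (g t) c (v t) x)) (at t within I)"
    unfolding chart_inner_def grad_def
    by (rule DERIV_inverse_form)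
      (simp_all only: vec_lambda_beta g'' DERIV_pd_time[OF c v t x I] metric_transpose[OF c t x]
        less_imp_neq[OF metric_det_pos[OF c t x], symmetric] not_False_eq_True)
  moreover have "(\<chi> i. pd c i (time_deriv I v t) x) \<bullet> grad (g t) c (v t) x
      = chart_inner (g t) c (v t) (time_deriv I v t) x"
    by (subst chart_inner_commute[OF c t x]) (simp add: chart_inner_def)
  ultimately show ?thesis by (simp add: inner_commute)
qed

end

section \<open>Partitions of unity\<close>

lemma continuous_on_extend_by_zero:
  fixes F :: "real \<Rightarrow> 'e::euclidean_space \<Rightarrow> real"
  assumes U: "open U" and K: "closed K" "K \<subseteq> U"
    and cont: "continuous_on (I \<times> U) (\<lambda>(t, y). F t y)"
    and zero: "\<And>t y. t \<in> I \<Longrightarrow> y \<in> U \<Longrightarrow> y \<notin> K \<Longrightarrow> F t y = 0"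
  shows "continuous_on (I \<times> UNIV) (\<lambda>(t, y). if y \<in> U then F t y else 0)"
proof -
  have UN: "I \<times> UNIV = I \<times> U \<union> I \<times> (- K)" using K by auto
  have op: "openin (top_of_set (I \<times> UNIV)) (I \<times> W)" if "open W" for W :: "'e set"
    using that by (auto intro!: openin_Times)
  have "continuous_on (I \<times> U) (\<lambda>p. F (fst p) (snd p))" using cont by (simp add: case_prod_unfold)
  then have "continuous_on (I \<times> U \<union> I \<times> (- K)) (\<lambda>p. if snd p \<in> U then F (fst p) (snd p) else 0)"
    by (rule continuous_on_cases_local_open[rotated 2])
      (use op U K zero UN in \<open>auto simp: open_Compl\<close>)
  then show ?thesis unfolding UN by (simp add: case_prod_unfold)
qed

lemma DERIV_positive_part_square: "((\<lambda>q::real. (max 0 q)\<^sup>2) has_real_derivative 2 * max 0 q) (at q)"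
proof -
  consider "q > 0" | "q < 0" | "q = 0" by linarith
  then show ?thesis
  proof cases
    case 1
    have "((\<lambda>q. q\<^sup>2) has_real_derivative 2 * max 0 q) (at q)"
      using 1 by (auto intro!: derivative_eq_intros)
    then show ?thesis
      by (rule has_field_derivative_transform_within_open[of _ _ _ "{0<..}"]) (use 1 in auto)
  next
    case 2
    have "((\<lambda>q. 0) has_real_derivative 2 * max 0 q) (at q)" using 2 by simp
    then show ?thesis
      by (rule has_field_derivative_transform_within_open[of _ _ _ "{..<0}"]) (use 2 in auto)
  next
    case 3
    have "((\<lambda>h::real. (max 0 h)\<^sup>2 / h) \<longlongrightarrow> 0) (at 0)"
    proof (rule Lim_null_comparison)
      show "\<forall>\<^sub>F h in at 0. norm ((max 0 h)\<^sup>2 / h) \<le> \<bar>h\<bar>"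
        by (auto simp: eventually_at max_def power2_eq_square intro!: exI[of _ 1])
      show "((\<lambda>h. \<bar>h\<bar>) \<longlongrightarrow> 0) (at (0::real))" by (auto intro!: tendsto_eq_intros)
    qed
    then show ?thesis using 3 by (simp add: DERIV_def)
  qed
qed

context manifold
begin

definition chart_supported :: "('a \<Rightarrow> real) \<Rightarrow> bool" where
  "chart_supported \<rho> \<longleftrightarrow> (\<exists>c\<in>A. \<exists>K. compact K \<and> K \<subseteq> chart_dom c \<and> (\<forall>x. x \<notin> K \<longrightarrow> \<rho> x = 0))"

text \<open>In a chart centred at \<open>y\<^sub>0\<close> the bump is the squared positive part of \<open>r\<^sup>2 - |y - y\<^sub>0|\<^sup>2\<close>.
  It is continuously differentiable, which suffices for integration by parts.\<close>

lemma bump_function: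
  obtains \<rho> :: "'a \<Rightarrow> real" where "chart_supported \<rho>" "\<And>y. \<rho> y \<ge> 0" "\<rho> x > 0" "Ck_family A 1 J (\<lambda>_. \<rho>)"
proof -
  obtain c where c: "c \<in> A" "x \<in> chart_dom c" by (rule chart_covers)
  define y0 where "y0 = snd c x"
  have "y0 \<in> chart_img c" using c by (simp add: y0_def)
  then obtain r where r: "r > 0" "cball y0 r \<subseteq> chart_img c"
    using open_chart_img[OF c(1)] open_contains_cball by blast
  define q where "q z = r\<^sup>2 - (z - y0) \<bullet> (z - y0)" for z
  define \<beta> where "\<beta> z = (max 0 (q z))\<^sup>2" for z
  define \<beta>' where "\<beta>' z w = 2 * max 0 (q z) * (- 2 * ((z - y0) \<bullet> w))" for z w :: "real^'n"
  define \<rho> where "\<rho> y = (if y \<in> chart_dom c then \<beta> (snd c y) else 0)" for y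
  define K where "K = chart_inv c ` cball y0 r"
  have q_le: "q z \<le> 0" if "z \<notin> cball y0 r" for z
  proof -
    have "r \<le> norm (z - y0)" using that by (simp add: dist_norm norm_minus_commute)
    then show ?thesis using r(1) power_mono[of r "norm (z - y0)" 2]
      by (simp add: q_def power2_norm_eq_inner)
  qed
  have K: "compact K" "K \<subseteq> chart_dom c"
    unfolding K_def using r(2) chart_inv_in[OF c(1)] continuous_on_subset[OF continuous_on_chart_inv[OF c(1)] r(2)]
    by (auto intro!: compact_continuous_image simp del: mem_cball)
  have outside: "snd c y \<notin> cball y0 r" if "y \<in> chart_dom c" "y \<notin> K" for y
    using that chart_inv_chart[OF c(1)] unfolding K_def by (metis imageI)
  have supp: "\<rho> y = 0" if "y \<notin> K" for y
    using outside[OF _ that] q_le by (auto simp: \<rho>_def \<beta>_def)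
  have D\<beta>: "(\<beta> has_derivative \<beta>' z) (at z)" for z
  proof -
    have "(q has_derivative (\<lambda>w. - 2 * ((z - y0) \<bullet> w))) (at z)"
      unfolding q_def by (auto intro!: derivative_eq_intros simp: inner_commute)
    from has_derivative_compose[OF this DERIV_positive_part_square[unfolded has_field_derivative_def]]
    show ?thesis by (simp add: \<beta>_def[abs_def] \<beta>'_def[abs_def] mult.assoc)
  qed
  have "Ck_family A 1 J (\<lambda>_. \<rho>)"
    unfolding Ck_family_def
  proof
    fix d assume d: "d \<in> A"
    let ?U = "snd d ` (chart_dom d \<inter> chart_dom c)" and ?\<tau> = "snd c \<circ> chart_inv d"
    let ?W = "chart_img d \<inter> chart_inv d -` (- K)"
    have U: "open ?U" by (rule chart_image_open[OF d open_Int[OF open_chart_dom[OF d] open_chart_dom[OF c(1)]]]) auto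
    have W: "open ?W"
      by (rule continuous_open_preimage[OF continuous_on_chart_inv[OF d] open_chart_img[OF d]])
        (use compact_imp_closed[OF K(1)] in auto)
    have U_in: "chart_inv d y \<in> chart_dom c" "y \<in> chart_img d" if "y \<in> ?U" for y
      using that chart_inv_chart[OF d] by auto
    have UW: "y \<in> ?U \<or> y \<in> ?W" if "y \<in> chart_img d" for y
    proof (cases "chart_inv d y \<in> K")
      case True
      then have "chart_inv d y \<in> chart_dom d \<inter> chart_dom c" using K chart_inv_in[OF d that] by blast
      then show ?thesis using chart_chart_inv[OF d that] by (metis imageI)
    qed (use that in auto)
    have "Ck_on 1 ?U ?\<tau>" using smooth_transition[OF d c(1)] by (simp only: smooth_on_def)
    then obtain T where T: "\<And>y. y \<in> ?U \<Longrightarrow> (?\<tau> has_derivative T y) (at y within ?U)"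
      "\<And>w. continuous_on ?U (\<lambda>y. T y w)" by (auto simp: One_nat_def)
    define G where "G y w = (if y \<in> ?U then \<beta>' (?\<tau> y) (T y w) else 0)" for y w
    have \<beta>'0: "\<beta>' (?\<tau> y) w = 0" if "y \<in> ?U" "y \<in> ?W" for y w
    proof -
      have "q (?\<tau> y) \<le> 0"
        using outside[OF U_in(1)[OF that(1)]] that(2) by (intro q_le) auto
      then show ?thesis by (simp add: \<beta>'_def)
    qed
    have DU: "((\<lambda>y. \<rho> (chart_inv d y)) has_derivative G y) (at y)" if "y \<in> ?U" for y
    proof -
      have "(?\<tau> has_derivative T y) (at y)" using T(1)[OF that] at_within_open[OF that U] by simp
      from has_derivative_compose[OF this D\<beta>]
      have "((\<lambda>y. \<beta> (?\<tau> y)) has_derivative G y) (at y)" using that by (simp add: G_def[abs_def])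
      then show ?thesis
        by (rule has_derivative_transform_within_open[OF _ U that]) (use U_in(1) in \<open>simp add: \<rho>_def del: imageE\<close>)
    qed
    have DW: "((\<lambda>y. \<rho> (chart_inv d y)) has_derivative G y) (at y)" if "y \<in> ?W" for y
    proof -
      have "G y = (\<lambda>_. 0)" using \<beta>'0[OF _ that] by (auto simp: G_def fun_eq_iff)
      moreover have "((\<lambda>y. 0) has_derivative (\<lambda>_. 0)) (at y)" by simp
      then have "((\<lambda>y. \<rho> (chart_inv d y)) has_derivative (\<lambda>_. 0)) (at y)"
        by (rule has_derivative_transform_within_open[OF _ W that]) (use supp in auto)
      ultimately show ?thesis by simp
    qed
    have contG: "continuous_on (chart_img d) (\<lambda>y. G y w)" for w
    proof -
      have \<tau>: "continuous_on ?U ?\<tau>"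
        unfolding continuous_on_eq_continuous_within using has_derivative_continuous[OF T(1)] by blast
      have "continuous_on ?U (\<lambda>y. \<beta>' (?\<tau> y) (T y w))"
        unfolding \<beta>'_def q_def by (intro continuous_intros \<tau> T(2))
      then have "continuous_on ?U (\<lambda>y. G y w)"
        by (rule continuous_on_eq) (simp add: G_def)
      moreover have "continuous_on ?W (\<lambda>y. G y w)"
        by (rule continuous_on_eq[of _ "\<lambda>_. 0"]) (use \<beta>'0 in \<open>auto simp: G_def simp del: imageE\<close>)
      ultimately have "continuous_on (?U \<union> ?W) (\<lambda>y. G y w)"
        by (intro continuous_on_open_Un U W)
      then show ?thesis by (rule continuous_on_subset) (use UW in blast)
    qed
    show "Ck_in d 1 J (\<lambda>_. \<rho>)"
      unfolding Ck_in_def One_nat_def Ck_on.simps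
    proof (intro exI conjI ballI allI)
      fix p assume "p \<in> J \<times> chart_img d"
      then have "snd p \<in> chart_img d" by auto
      then have D: "((\<lambda>y. \<rho> (chart_inv d y)) has_derivative G (snd p)) (at (snd p))"
        using UW DU DW by blast
      have "((\<lambda>p. \<rho> (chart_inv d (snd p))) has_derivative (\<lambda>w. G (snd p) (snd w))) (at p within J \<times> chart_img d)"
        by (rule has_derivative_compose[where f = snd and g = "\<lambda>y. \<rho> (chart_inv d y)"])
          (use D in \<open>auto intro!: derivative_eq_intros\<close>)
      then show "((\<lambda>(t, y). \<rho> (chart_inv d y)) has_derivative (\<lambda>w. G (snd p) (snd w))) (at p within J \<times> chart_img d)"
        by (simp add: case_prod_unfold)
    next
      show "continuous_on (J \<times> chart_img d) (\<lambda>p. G (snd p) (snd w))" for w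
        by (rule continuous_on_compose2[OF contG]) (auto intro!: continuous_intros)
    qed
  qed
  moreover have "\<rho> x > 0" using c r by (simp add: \<rho>_def \<beta>_def q_def y0_def)
  moreover have "chart_supported \<rho>" unfolding chart_supported_def using c K supp by blast
  moreover have "\<rho> y \<ge> 0" for y by (simp add: \<rho>_def \<beta>_def)
  ultimately show thesis using that[of \<rho>] by simp
qed

lemma partition_of_unity:
  obtains X :: "'a set" and \<eta> :: "'a \<Rightarrow> 'a \<Rightarrow> real"
  where "finite X" "\<And>z. chart_supported (\<eta> z)" "\<And>z. Ck_family A 1 J (\<lambda>_. \<eta> z)" "\<And>x. (\<Sum>z\<in>X. \<eta> z x) = 1"
proof -
  have "\<exists>\<rho>. chart_supported \<rho> \<and> (\<forall>y. \<rho> y \<ge> 0) \<and> \<rho> z > 0 \<and> Ck_family A 1 (insert 0 J) (\<lambda>_. \<rho>)" for z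
    by (rule bump_function[of z "insert 0 J"]) blast
  then obtain \<rho> where \<rho>: "\<And>z. chart_supported (\<rho> z)" "\<And>z y. \<rho> z y \<ge> 0" "\<And>z. \<rho> z z > 0"
    "\<And>z. Ck_family A 1 (insert 0 J) (\<lambda>_. \<rho> z)" by metis
  have cont: "continuous_on UNIV (\<rho> z)" for z
    by (rule Ck_family_continuous[OF \<rho>(4), of 0]) simp
  have op: "open (\<rho> z -` {0<..})" for z
    by (rule open_vimage[OF open_greaterThan cont])
  have "UNIV \<subseteq> (\<Union>z\<in>UNIV. \<rho> z -` {0<..})" using \<rho>(3) by auto
  then obtain X where X: "finite X" "UNIV \<subseteq> (\<Union>z\<in>X. \<rho> z -` {0<..})"
    by (rule compactE_image[OF compact_UNIV op])
  define S where "S x = (\<Sum>z\<in>X. \<rho> z x)" for x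
  have S: "S x > 0" for x
  proof -
    obtain z where "z \<in> X" "\<rho> z x > 0" using X(2) by blast
    then show ?thesis unfolding S_def using X(1) \<rho>(2) by (intro sum_pos2) auto
  qed
  have "Ck_family A 1 J (\<lambda>_ x. \<rho> z x / S x)" for z
    unfolding Ck_family_def
  proof
    fix c assume c: "c \<in> A"
    have r: "Ck_in c 1 J (\<lambda>_. \<rho> z)" for z
      using Ck_in_subset[OF Ck_familyD[OF \<rho>(4) c]] by blast
    then have "Ck_in c 1 J (\<lambda>_. S)" unfolding S_def by (intro Ck_in_sum)
    then have "Ck_on 1 (J \<times> chart_img c) (\<lambda>p. (case p of (t, y) \<Rightarrow> \<rho> z (chart_inv c y))
        / (case p of (t, y) \<Rightarrow> S (chart_inv c y)))"
      by (intro Ck_on_divide r[unfolded Ck_in_def]) (use S in \<open>auto simp: Ck_in_def less_imp_neq[symmetric]\<close>)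
    then show "Ck_in c 1 J (\<lambda>_ x. \<rho> z x / S x)" by (simp add: Ck_in_def case_prod_unfold)
  qed
  moreover have "chart_supported (\<lambda>x. \<rho> z x / S x)" for z
    using \<rho>(1)[of z] unfolding chart_supported_def by (metis div_0)
  moreover have "(\<Sum>z\<in>X. \<rho> z x / S x) = 1" for x
    using S[of x] by (simp add: S_def flip: sum_divide_distrib)
  ultimately show thesis using X(1) by (intro that[of X "\<lambda>z x. \<rho> z x / S x"]) auto
qed

end

section \<open>Integration on the manifold\<close>

context manifold
begin

definition chart_extend :: "('a, 'n) chart \<Rightarrow> ('a \<Rightarrow> real) \<Rightarrow> real^'n \<Rightarrow> real" where
  "chart_extend c u y = (if y \<in> chart_img c then u (chart_inv c y) else 0)"

lemma chart_extend_outside: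
  assumes "c \<in> A" "K \<subseteq> chart_dom c" "\<And>x. x \<in> chart_dom c \<Longrightarrow> x \<notin> K \<Longrightarrow> u x = 0" "y \<notin> snd c ` K"
  shows "chart_extend c u y = 0"
  using assms chart_inv_in[OF assms(1), of y] chart_chart_inv[OF assms(1), of y]
  unfolding chart_extend_def by (metis imageI)

lemma chart_image_compact:
  assumes "c \<in> A" "compact K" "K \<subseteq> chart_dom c"
  shows "compact (snd c ` K)" "snd c ` K \<subseteq> chart_img c"
  using assms continuous_on_subset[OF continuous_on_chart[OF assms(1)] assms(3)]
  by (auto intro: compact_continuous_image)

lemma continuous_on_chart_extend:
  assumes c: "c \<in> A" and K: "compact K" "K \<subseteq> chart_dom c"
    and u: "Ck_in c k I u" and zero: "\<And>t x. t \<in> I \<Longrightarrow> x \<in> chart_dom c \<Longrightarrow> x \<notin> K \<Longrightarrow> u t x = 0"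
  shows "continuous_on (I \<times> UNIV) (\<lambda>(t, y). chart_extend c (u t) y)"
  unfolding chart_extend_def
proof (rule continuous_on_extend_by_zero[where K = "snd c ` K"])
  show "continuous_on (I \<times> chart_img c) (\<lambda>(t, y). u t (chart_inv c y))"
    using u Ck_on_continuous by (simp add: Ck_in_def)
  show "u t (chart_inv c y) = 0" if "t \<in> I" "y \<in> chart_img c" "y \<notin> snd c ` K" for t y
    using chart_extend_outside[OF c K(2) zero[OF that(1)] that(3)] that(2) by (simp add: chart_extend_def del: imageE)
qed (use open_chart_img[OF c] chart_image_compact[OF c K] compact_imp_closed in auto)

text \<open>For a field of compact support in the chart domain, extended by zero, translation invariance of
  Lebesgue measure applies.\<close>

lemma lborel_integral_pd_eq_0:
  assumes c: "c \<in> A" and K: "compact K" "K \<subseteq> chart_dom c" and t: "t \<in> I"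
    and u: "Ck_in c 1 I u" and zero: "\<And>x. x \<in> chart_dom c \<Longrightarrow> x \<notin> K \<Longrightarrow> u t x = 0"
  shows "(\<integral>y. chart_extend c (pd c i (u t)) y \<partial>lborel) = 0"
    and "integrable lborel (chart_extend c (pd c i (u t)))"
proof -
  note K' = chart_image_compact[OF c K]
  have u': "Ck_in c (Suc 0) {t} u" using Ck_in_subset[OF u, of "{t}"] t by simp
  have pd_zero: "pd c i (u t) x = 0" if "x \<in> chart_dom c" "x \<notin> K" for x
  proof -
    have "pd c i (u t) x = pd c i (\<lambda>_. 0) x"
      by (rule pd_cong_open[OF c that(1), of "- K"])
        (use that zero compact_imp_closed[OF K(1)] in auto)
    then show ?thesis by (simp add: pd_def)
  qed
  have cont: "continuous_on UNIV (chart_extend c (u t))" "continuous_on UNIV (chart_extend c (pd c i (u t)))"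
    by (rule continuous_on_slice[OF continuous_on_chart_extend[OF c K u']]; use zero in auto)
      (rule continuous_on_slice[OF continuous_on_chart_extend[OF c K Ck_in_pd[OF c u']]]; use pd_zero in auto)
  have out: "chart_extend c (u t) y = 0" "chart_extend c (pd c i (u t)) y = 0" if "y \<notin> snd c ` K" for y
    using chart_extend_outside[OF c K(2) _ that] zero pd_zero by blast+
  show "integrable lborel (chart_extend c (pd c i (u t)))"
    by (rule integrable_compact_support[OF cont(2) K'(1) out(2)])
  show "(\<integral>y. chart_extend c (pd c i (u t)) y \<partial>lborel) = 0"
  proof (rule lborel_integral_directional_derivative_eq_0[OF K'(1) out cont])
    fix y
    let ?e = "\<lambda>s. y + s *\<^sub>R axis i (1::real)"
    show "((\<lambda>s. chart_extend c (u t) (?e s)) has_real_derivative chart_extend c (pd c i (u t)) y) (at 0)"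
    proof (cases "y \<in> chart_img c")
      case True
      have "((\<lambda>s. u t (chart_inv c (?e s))) has_real_derivative pd c i (u t) (chart_inv c (?e 0))) (at 0)"
        by (rule DERIV_pd_line[OF c u' _]) (use True in auto)
      then have "((\<lambda>s. chart_extend c (u t) (?e s)) has_real_derivative pd c i (u t) (chart_inv c (?e 0))) (at 0)"
        by (rule has_field_derivative_transform_within_open[where S = "?e -` chart_img c"])
          (use True in \<open>auto intro!: open_vimage open_chart_img c continuous_intros simp: chart_extend_def simp del: imageE\<close>)
      then show ?thesis using True by (simp add: chart_extend_def)
    next
      case False
      then have y: "y \<notin> snd c ` K" using K'(2) by blast
      have "((\<lambda>s. 0) has_real_derivative 0) (at 0)" by simp
      then have "((\<lambda>s. chart_extend c (u t) (?e s)) has_real_derivative 0) (at 0)"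
        by (rule has_field_derivative_transform_within_open[where S = "?e -` (- snd c ` K)"])
          (use y out in \<open>auto intro!: open_vimage compact_imp_closed K' continuous_intros simp del: imageE\<close>)
      then show ?thesis using out(2)[OF y] by simp
    qed
  qed
qed

end

locale riemannian_volume_family = riemannian_family A I g
  for A :: "('a::t2_space, 'n::finite) chart set" and I :: "real set" and g :: "real \<Rightarrow> ('a, 'n) tensor2" +
  fixes \<mu> :: "real \<Rightarrow> 'a measure"
  assumes volume: "\<And>t. t \<in> I \<Longrightarrow> riemannian_volume A (g t) (\<mu> t)"
begin

abbreviation vol :: "real \<Rightarrow> ('a, 'n) chart \<Rightarrow> 'a \<Rightarrow> real" where
  "vol t c x \<equiv> sqrt (det (g t c x))"

lemma sets_volume: "t \<in> I \<Longrightarrow> sets (\<mu> t) = sets borel"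
  using volume by (simp add: riemannian_volume_def)

lemma space_volume: "t \<in> I \<Longrightarrow> space (\<mu> t) = UNIV"
  using sets_eq_imp_space_eq[OF sets_volume] by simp

lemma emeasure_volume:
  assumes "t \<in> I" "c \<in> A" "B \<in> sets borel" "B \<subseteq> chart_dom c"
  shows "emeasure (\<mu> t) B = (\<integral>\<^sup>+y. ennreal (vol t c (chart_inv c y)) * indicator (snd c ` B) y \<partial>lborel)"
  using volume[OF assms(1)] assms(2-4) unfolding riemannian_volume_def by blast

text \<open>On a chart domain the volume measure is the image of \<open>sqrt (det g) dx\<close> under the inverse
  chart, so integrals of functions supported there are Lebesgue integrals in coordinates.\<close>

lemma
  fixes u :: "'a \<Rightarrow> real"
  assumes c: "c \<in> A" and t: "t \<in> I" and K: "compact K" "K \<subseteq> chart_dom c"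
    and u: "continuous_on UNIV u" and zero: "\<And>x. x \<notin> K \<Longrightarrow> u x = 0"
  shows integrable_chart_supported: "integrable (\<mu> t) u"
    and integral_chart_supported: "(\<integral>x. u x \<partial>\<mu> t) = (\<integral>y. chart_extend c (\<lambda>x. vol t c x * u x) y \<partial>lborel)"
proof -
  let ?dom = "chart_dom c" and ?img = "chart_img c"
  define \<psi> where "\<psi> y = (if y \<in> ?img then chart_inv c y else undefined)" for y
  define w where "w y = (if y \<in> ?img then vol t c (chart_inv c y) else 0)" for y
  have [measurable]: "?dom \<in> sets borel" "?img \<in> sets borel"
    using open_chart_dom[OF c] open_chart_img[OF c] by auto
  have [measurable]: "\<psi> \<in> borel_measurable borel" unfolding \<psi>_def
    by (rule borel_measurable_continuous_on_if) (use continuous_on_chart_inv[OF c] in auto)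
  have [measurable]: "w \<in> borel_measurable borel" unfolding w_def
    by (rule borel_measurable_continuous_on_if) (use Ck_in_continuous_slice[OF Ck_in_sqrt_det[OF c] t] in auto)
  have [measurable]: "u \<in> borel_measurable borel" by (rule borel_measurable_continuous_onI[OF u])
  have w0: "w y \<ge> 0" for y
    using metric_det_pos[OF c t chart_inv_in[OF c]] by (auto simp: w_def less_imp_le simp del: imageE)
  let ?M = "density (\<mu> t) (\<lambda>x. ennreal (indicator ?dom x))" and ?N = "density lborel (\<lambda>y. ennreal (w y))"
  have meas: "borel_measurable (\<mu> t) = borel_measurable borel"
    using measurable_cong_sets[OF sets_volume[OF t] refl] by blast
  have MN: "?M = distr ?N borel \<psi>"
  proof (rule measure_eqI)
    show "sets ?M = sets (distr ?N borel \<psi>)" by (simp add: sets_volume[OF t])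
    fix B assume "B \<in> sets ?M"
    then have B[measurable]: "B \<in> sets borel" by (simp add: sets_volume[OF t])
    have "emeasure ?M B = (\<integral>\<^sup>+x. indicator (?dom \<inter> B) x \<partial>\<mu> t)"
    proof -
      have "(\<lambda>x. ennreal (indicator ?dom x) * indicator B x) = indicator (?dom \<inter> B)"
        by (auto simp: fun_eq_iff indicator_def)
      then show ?thesis by (subst emeasure_density) (simp_all add: sets_volume[OF t] meas)
    qed
    also have "\<dots> = emeasure (\<mu> t) (?dom \<inter> B)"
      by (rule nn_integral_indicator) (simp add: sets_volume[OF t])
    also have "\<dots> = (\<integral>\<^sup>+y. ennreal (vol t c (chart_inv c y)) * indicator (snd c ` (?dom \<inter> B)) y \<partial>lborel)"
      by (rule emeasure_volume[OF t c]) auto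
    also have "\<dots> = (\<integral>\<^sup>+y. ennreal (w y) * indicator (\<psi> -` B) y \<partial>lborel)"
    proof (rule nn_integral_cong)
      fix y
      have "y \<in> snd c ` (?dom \<inter> B) \<longleftrightarrow> y \<in> ?img \<and> chart_inv c y \<in> B"
        using chart_inv_in[OF c, of y] chart_chart_inv[OF c, of y] chart_inv_chart[OF c] by (auto intro: rev_image_eqI)
      then show "ennreal (vol t c (chart_inv c y)) * indicator (snd c ` (?dom \<inter> B)) y
        = ennreal (w y) * indicator (\<psi> -` B) y"
        by (simp add: w_def \<psi>_def indicator_def)
    qed
    also have "\<dots> = emeasure ?N (\<psi> -` B)"
      by (rule emeasure_density[symmetric]) (auto intro!: measurable_sets_borel[of _ borel])
    also have "\<dots> = emeasure (distr ?N borel \<psi>) B"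
      by (subst emeasure_distr) auto
    finally show "emeasure ?M B = emeasure (distr ?N borel \<psi>) B" .
  qed
  have u_dom: "indicator ?dom x * u x = u x" for x
    using zero K by (cases "x \<in> ?dom") auto
  have wu: "w y * u (\<psi> y) = chart_extend c (\<lambda>x. vol t c x * u x) y" for y
    by (simp add: w_def \<psi>_def chart_extend_def del: imageE)
  have ext: "continuous_on ({t} \<times> UNIV) (\<lambda>(s, y). chart_extend c (\<lambda>x. vol s c x * u x) y)"
  proof (rule continuous_on_chart_extend[OF c K])
    have "continuous_on ?img (\<lambda>y. u (chart_inv c y))"
      by (rule continuous_on_compose2[OF u continuous_on_chart_inv[OF c]]) auto
    then have "Ck_in c 0 {t} (\<lambda>_. u)"
      unfolding Ck_in_def Ck_on.simps case_prod_unfold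
      by (rule continuous_on_compose2) (auto intro!: continuous_intros)
    moreover have "Ck_in c 0 {t} (\<lambda>t. vol t c)"
      using Ck_in_subset[OF Ck_in_sqrt_det[OF c]] t by blast
    ultimately show "Ck_in c 0 {t} (\<lambda>s x. vol s c x * u x)" by (intro Ck_in_mult)
  qed (use zero in auto)
  have "integrable lborel (chart_extend c (\<lambda>x. vol t c x * u x))"
    by (rule integrable_compact_support[OF continuous_on_slice[OF ext] chart_image_compact(1)[OF c K]])
      (use chart_extend_outside[OF c K(2)] zero in auto)
  then have "integrable ?N (\<lambda>y. u (\<psi> y))"
    by (subst integrable_density) (auto simp: w0 wu)
  then have "integrable ?M u"
    unfolding MN by (subst integrable_distr_eq) auto
  then show "integrable (\<mu> t) u"
    by (subst (asm) integrable_density) (auto simp: meas u_dom)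
  have "(\<integral>x. u x \<partial>\<mu> t) = (\<integral>x. u x \<partial>?M)"
    by (subst integral_density) (auto simp: meas u_dom)
  also have "\<dots> = (\<integral>y. u (\<psi> y) \<partial>?N)" unfolding MN by (rule integral_distr) auto
  also have "\<dots> = (\<integral>y. chart_extend c (\<lambda>x. vol t c x * u x) y \<partial>lborel)"
    by (subst integral_density) (auto simp: w0 wu)
  finally show "(\<integral>x. u x \<partial>\<mu> t) = (\<integral>y. chart_extend c (\<lambda>x. vol t c x * u x) y \<partial>lborel)" .
qed

lemma integrable_volume:
  fixes u :: "'a \<Rightarrow> real"
  assumes t: "t \<in> I" and u: "continuous_on UNIV u"
  shows "integrable (\<mu> t) u"
proof -
  obtain X :: "'a set" and \<eta> where X: "finite X" "\<And>z. chart_supported (\<eta> z)"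
    "\<And>z. Ck_family A 1 I (\<lambda>_. \<eta> z)" "\<And>x. (\<Sum>z\<in>X. \<eta> z x) = 1"
    using partition_of_unity[of I] by metis
  have "integrable (\<mu> t) (\<lambda>x. \<eta> z x * u x)" for z
  proof -
    obtain c K where c: "c \<in> A" "compact K" "K \<subseteq> chart_dom c" "\<And>x. x \<notin> K \<Longrightarrow> \<eta> z x = 0"
      using X(2)[of z] unfolding chart_supported_def by blast
    show ?thesis
      by (rule integrable_chart_supported[OF c(1) t c(2,3)])
        (use c(4) Ck_family_continuous[OF X(3) t] u in \<open>auto intro!: continuous_intros\<close>)
  qed
  then have "integrable (\<mu> t) (\<lambda>x. \<Sum>z\<in>X. \<eta> z x * u x)" by (intro Bochner_Integration.integrable_sum)
  then show ?thesis using X(4) by (simp flip: sum_distrib_right)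
qed

lemma integral_combination:
  fixes u :: "'a \<Rightarrow> real"
  assumes t: "t \<in> I" and cont: "continuous_on UNIV a" "continuous_on UNIV b" "continuous_on UNIV c"
    and eq: "\<And>x. u x = r * a x + s * b x + q * c x"
  shows "(\<integral>x. u x \<partial>\<mu> t) = r * (\<integral>x. a x \<partial>\<mu> t) + s * (\<integral>x. b x \<partial>\<mu> t) + q * (\<integral>x. c x \<partial>\<mu> t)"
  unfolding eq using cont[THEN integrable_volume[OF t]] by simp

text \<open>A nonnegative continuous function with vanishing integral vanishes, because coordinate images of
  nonempty open sets have positive Lebesgue measure and the volume density is positive.\<close>

lemma continuous_integral_eq_0:
  fixes u :: "'a \<Rightarrow> real"
  assumes t: "t \<in> I" and u: "continuous_on UNIV u" "\<And>x. u x \<ge> 0" and int: "(\<integral>x. u x \<partial>\<mu> t) = 0"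
  shows "u x = 0"
proof (rule ccontr)
  assume "u x \<noteq> 0"
  then have ux: "u x > 0" using u(2)[of x] by linarith
  obtain c where c: "c \<in> A" "x \<in> chart_dom c" by (rule chart_covers)
  let ?B = "chart_dom c \<inter> u -` {0<..}"
  have B: "open ?B" "x \<in> ?B"
    using c ux open_vimage[OF open_greaterThan u(1)] open_chart_dom[OF c(1)] by auto
  have oB: "open (snd c ` ?B)" by (rule chart_image_open[OF c(1) B(1)]) auto
  have "AE x in \<mu> t. u x = 0"
    using integral_nonneg_eq_0_iff_AE[OF integrable_volume[OF t u(1)]] u(2) int by auto
  moreover have Bs: "?B \<in> sets (\<mu> t)" using B(1) by (simp add: sets_volume[OF t])
  moreover have "AE x in \<mu> t. x \<notin> ?B" using \<open>AE x in \<mu> t. u x = 0\<close> by eventually_elim auto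
  moreover have "{x \<in> space (\<mu> t). \<not> x \<notin> ?B} = ?B" by (auto simp: space_volume[OF t])
  ultimately have "emeasure (\<mu> t) ?B = 0"
    using AE_iff_measurable[OF Bs, of "\<lambda>x. x \<notin> ?B"] by blast
  moreover have "emeasure (\<mu> t) ?B =
      (\<integral>\<^sup>+y. ennreal (sqrt (det (g t c (chart_inv c y)))) * indicator (snd c ` ?B) y \<partial>lborel)"
    by (rule emeasure_volume[OF t c(1)]) (use B(1) in auto)
  ultimately have z: "(\<integral>\<^sup>+y. ennreal (sqrt (det (g t c (chart_inv c y)))) * indicator (snd c ` ?B) y \<partial>lborel) = 0"
    by simp
  have pos: "ennreal (sqrt (det (g t c (chart_inv c y)))) \<noteq> 0" if "y \<in> snd c ` ?B" for y
    using that metric_det_pos[OF c(1) t, of "chart_inv c y"] chart_inv_chart[OF c(1)] by (auto simp: ennreal_eq_0_iff not_le)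
  have "(\<lambda>y. ennreal (sqrt (det (g t c (chart_inv c y)))) * indicator (snd c ` ?B) y)
      = (\<lambda>y. ennreal (if y \<in> snd c ` ?B then sqrt (det (g t c (chart_inv c y))) else 0))"
    by (auto simp: fun_eq_iff indicator_def)
  moreover have "(\<lambda>y. if y \<in> snd c ` ?B then sqrt (det (g t c (chart_inv c y))) else 0) \<in> borel_measurable borel"
  proof (rule borel_measurable_continuous_on_if)
    show "continuous_on (snd c ` ?B) (\<lambda>y. sqrt (det (g t c (chart_inv c y))))"
      by (rule continuous_on_subset[OF Ck_in_continuous_slice[OF Ck_in_sqrt_det[OF c(1)] t]]) auto
  qed (use oB in auto)
  ultimately have "AE y in lborel. ennreal (sqrt (det (g t c (chart_inv c y)))) * indicator (snd c ` ?B) y = 0"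
    using z by (subst (asm) nn_integral_0_iff_AE) (auto simp: fun_eq_iff)
  then have "AE y in lborel. y \<notin> snd c ` ?B"
    by eventually_elim (use pos in \<open>auto simp: indicator_def simp del: imageE\<close>)
  then have "emeasure lborel (snd c ` ?B) = 0"
    using AE_iff_measurable[of "snd c ` ?B" lborel "\<lambda>y. y \<notin> snd c ` ?B"] oB by auto
  then have "snd c ` ?B \<in> null_sets lborel" using oB by (auto simp: null_sets_def)
  then have "negligible (snd c ` ?B)" by (simp add: negligible_iff_null_sets null_sets_completionI)
  then have "snd c ` ?B = {}" using open_not_negligible[OF oB] by blast
  then show False using B(2) by blast
qed

end

section \<open>Green's formula and the first variation of integrals\<close>

context riemannian_volume_family
begin

lemma grad_inner_commute:
  assumes "t \<in> I" "Ck_family A (Suc k) I a" "Ck_family A (Suc k) I b"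
  shows "grad_inner A (g t) (a t) (b t) x = grad_inner A (g t) (b t) (a t) x"
proof -
  obtain c where "c \<in> A" "x \<in> chart_dom c" by (rule chart_covers)
  then show ?thesis
    using grad_inner_eq[OF _ _ assms(1,2,3)] grad_inner_eq[OF _ _ assms(1,3,2)] chart_inner_commute[OF _ assms(1)] by metis
qed

lemma Ck_family_mult: "Ck_family A k I a \<Longrightarrow> Ck_family A k I b \<Longrightarrow> Ck_family A k I (\<lambda>t x. a t x * b t x)"
  by (auto simp: Ck_family_def intro: Ck_in_mult)

lemma Ck_family_add: "Ck_family A k I a \<Longrightarrow> Ck_family A k I b \<Longrightarrow> Ck_family A k I (\<lambda>t x. a t x + b t x)"
  by (auto simp: Ck_family_def intro: Ck_in_add)

lemma Ck_family_diff: "Ck_family A k I a \<Longrightarrow> Ck_family A k I b \<Longrightarrow> Ck_family A k I (\<lambda>t x. a t x - b t x)"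
  by (auto simp: Ck_family_def intro: Ck_in_diff)

lemma Ck_family_const: "Ck_family A k I (\<lambda>t x. r)"
  by (auto simp: Ck_family_def intro: Ck_in_const)

lemma Ck_family_Suc_imp: "Ck_family A (Suc k) I a \<Longrightarrow> Ck_family A k I a"
  by (auto simp: Ck_family_def intro: Ck_in_Suc_imp)

lemma grad_inner_mult:
  assumes t: "t \<in> I" and a: "Ck_family A (Suc k) I a" and b: "Ck_family A (Suc k) I b" and w: "Ck_family A (Suc k) I w"
  shows "grad_inner A (g t) (\<lambda>x. a t x * b t x) (w t) x
    = a t x * grad_inner A (g t) (b t) (w t) x + b t x * grad_inner A (g t) (a t) (w t) x"
proof -
  obtain c where c: "c \<in> A" "x \<in> chart_dom c" by (rule chart_covers)
  show ?thesis
    unfolding grad_inner_eq[OF c t Ck_family_mult[OF a b] w] grad_inner_eq[OF c t b w] grad_inner_eq[OF c t a w]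
      chart_inner_sum pd_mult[OF c(1) t c(2) Ck_familyD[OF a c(1)] Ck_familyD[OF b c(1)]]
    by (simp add: sum_distrib_left sum.distrib algebra_simps)
qed

lemma grad_inner_sum:
  assumes t: "t \<in> I" and a: "\<And>z. Ck_family A (Suc k) I (a z)" and w: "Ck_family A (Suc k) I w"
    and s: "Ck_family A (Suc k) I s" and sum: "\<And>x. s t x = (\<Sum>z\<in>X. a z t x)"
  shows "grad_inner A (g t) (s t) (w t) x = (\<Sum>z\<in>X. grad_inner A (g t) (a z t) (w t) x)"
proof -
  obtain c where c: "c \<in> A" "x \<in> chart_dom c" by (rule chart_covers)
  have "pd c i (s t) x = (\<Sum>z\<in>X. pd c i (a z t) x)" for i
    using pd_cong[OF c sum] pd_sum[OF c(1) t c(2) Ck_familyD[OF a c(1)]] by simp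
  then show ?thesis
    unfolding grad_inner_eq[OF c t s w] grad_inner_eq[OF c t a w] chart_inner_sum
    by (subst sum.swap) (simp add: sum_distrib_right)
qed

lemma grad_inner_eq_0_outside:
  assumes t: "t \<in> I" and a: "Ck_family A (Suc k) I a" and w: "Ck_family A (Suc k) I w"
    and K: "compact K" "\<And>x. x \<notin> K \<Longrightarrow> a t x = 0" and x: "x \<notin> K"
  shows "grad_inner A (g t) (a t) (w t) x = 0"
proof -
  obtain c where c: "c \<in> A" "x \<in> chart_dom c" by (rule chart_covers)
  have "pd c i (a t) x = pd c i (\<lambda>_. 0) x" for i
    by (rule pd_cong_open[OF c, of "- K"]) (use K x compact_imp_closed in auto)
  then show ?thesis
    unfolding grad_inner_eq[OF c t a w] chart_inner_sum by (simp add: pd_def)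
qed

text \<open>In coordinates the integrand is the divergence of a compactly supported vector field with
  respect to the density \<open>sqrt (det g)\<close>.\<close>

lemma green_chart_supported:
  assumes t: "t \<in> I" and w: "Ck_family A (Suc 0) I w" and supp: "chart_supported (w t)"
    and \<psi>: "Ck_family A (Suc (Suc 0)) I \<psi>" and L: "continuous_on UNIV L"
    and lap: "\<And>c x. c \<in> A \<Longrightarrow> x \<in> chart_dom c \<Longrightarrow> laplacian (g t) c (\<psi> t) x = L x"
  shows "(\<integral>x. w t x * L x + grad_inner A (g t) (w t) (\<psi> t) x \<partial>\<mu> t) = 0"
proof -
  obtain c K where c: "c \<in> A" and K: "compact K" "K \<subseteq> chart_dom c" "\<And>x. x \<notin> K \<Longrightarrow> w t x = 0"
    using supp unfolding chart_supported_def by blast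
  note \<psi>1 = Ck_family_Suc_imp[OF \<psi>]
  let ?u = "\<lambda>x. w t x * L x + grad_inner A (g t) (w t) (\<psi> t) x"
  let ?X = "\<lambda>t y. w t y *\<^sub>R grad (g t) c (\<psi> t) y"
  let ?U = "\<lambda>i t y. vol t c y * ?X t y $ i"
  have X: "Ck_in c (Suc 0) I (\<lambda>t y. ?X t y $ i)" for i
    using Ck_in_mult[OF Ck_familyD[OF w c] Ck_in_grad[OF c Ck_familyD[OF \<psi> c]]] by simp
  have U: "Ck_in c 1 I (?U i)" for i
    using Ck_in_mult[OF Ck_in_sqrt_det[OF c] X] by simp
  have cont: "continuous_on UNIV ?u"
    using Ck_family_continuous[OF w t] L Ck_family_continuous[OF Ck_family_grad_inner[OF w \<psi>1] t]
    by (auto intro!: continuous_intros)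
  have "(\<integral>x. ?u x \<partial>\<mu> t) = (\<integral>y. chart_extend c (\<lambda>x. vol t c x * ?u x) y \<partial>lborel)"
    by (rule integral_chart_supported[OF c t K(1,2) cont])
      (use K(3) grad_inner_eq_0_outside[OF t w \<psi>1 K(1,3)] in auto)
  also have "chart_extend c (\<lambda>x. vol t c x * ?u x) = (\<lambda>y. \<Sum>i\<in>UNIV. chart_extend c (pd c i (?U i t)) y)"
  proof
    fix y
    show "chart_extend c (\<lambda>x. vol t c x * ?u x) y = (\<Sum>i\<in>UNIV. chart_extend c (pd c i (?U i t)) y)"
    proof (cases "y \<in> chart_img c")
      case True
      let ?x = "chart_inv c y"
      have x: "?x \<in> chart_dom c" by (rule chart_inv_in[OF c True])
      have "(\<Sum>i\<in>UNIV. pd c i (?U i t) ?x) = vol t c ?x * divergence (g t) c (?X t) ?x"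
        by (rule divergence_density[OF c t x X])
      also have "divergence (g t) c (?X t) ?x
          = w t ?x * laplacian (g t) c (\<psi> t) ?x + (\<Sum>i\<in>UNIV. pd c i (w t) ?x * grad (g t) c (\<psi> t) ?x $ i)"
        unfolding laplacian_def
        by (rule divergence_scaled[OF c t x Ck_familyD[OF w c] Ck_in_grad[OF c Ck_familyD[OF \<psi> c]]])
      also have "\<dots> = ?u ?x"
        by (simp only: lap[OF c x] grad_inner_eq[OF c x t w \<psi>1] chart_inner_sum)
      finally show ?thesis using True by (simp add: chart_extend_def del: imageE)
    qed (simp add: chart_extend_def)
  qed
  also have "(\<integral>y. (\<Sum>i\<in>UNIV. chart_extend c (pd c i (?U i t)) y) \<partial>lborel) = 0"
  proof (subst Bochner_Integration.integral_sum)
    show "integrable lborel (chart_extend c (pd c i (?U i t)))" for i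
      by (rule lborel_integral_pd_eq_0(2)[OF c K(1,2) t U]) (simp add: K(3))
    show "(\<Sum>i\<in>UNIV. \<integral>y. chart_extend c (pd c i (?U i t)) y \<partial>lborel) = 0"
      by (rule sum.neutral, intro ballI lborel_integral_pd_eq_0(1)[OF c K(1,2) t U]) (simp add: K(3))
  qed
  finally show ?thesis .
qed

text \<open>The Laplacian enters as a function \<open>L\<close> on the manifold that represents it in every chart.\<close>

lemma green:
  assumes t: "t \<in> I" and \<phi>: "Ck_family A (Suc 0) I \<phi>"
    and \<psi>: "Ck_family A (Suc (Suc 0)) I \<psi>" and L: "continuous_on UNIV L"
    and lap: "\<And>c x. c \<in> A \<Longrightarrow> x \<in> chart_dom c \<Longrightarrow> laplacian (g t) c (\<psi> t) x = L x"
  shows "(\<integral>x. \<phi> t x * L x \<partial>\<mu> t) = - (\<integral>x. grad_inner A (g t) (\<phi> t) (\<psi> t) x \<partial>\<mu> t)"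
proof -
  obtain X :: "'a set" and \<eta> where X: "finite X" "\<And>z. chart_supported (\<eta> z)"
    "\<And>z. Ck_family A 1 I (\<lambda>_. \<eta> z)" "\<And>x. (\<Sum>z\<in>X. \<eta> z x) = 1"
    using partition_of_unity[of I] by metis
  note \<psi>1 = Ck_family_Suc_imp[OF \<psi>]
  let ?w = "\<lambda>z t x. \<eta> z x * \<phi> t x"
  have w: "Ck_family A (Suc 0) I (?w z)" for z
    using Ck_family_mult[OF X(3)[of z, unfolded One_nat_def] \<phi>] .
  have sum_w: "\<phi> t x = (\<Sum>z\<in>X. ?w z t x)" for x
    using X(4) by (simp flip: sum_distrib_right)
  have supp: "chart_supported (?w z t)" for z
    using X(2)[of z] unfolding chart_supported_def by (metis mult_zero_left)
  have "\<phi> t x * L x + grad_inner A (g t) (\<phi> t) (\<psi> t) x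
      = (\<Sum>z\<in>X. ?w z t x * L x + grad_inner A (g t) (?w z t) (\<psi> t) x)" for x
    unfolding grad_inner_sum[OF t w \<psi>1 \<phi> sum_w] sum.distrib
    by (subst sum_w) (simp add: sum_distrib_right)
  moreover have int: "integrable (\<mu> t) (\<lambda>x. \<phi> t x * L x)" "integrable (\<mu> t) (grad_inner A (g t) (\<phi> t) (\<psi> t))"
    "integrable (\<mu> t) (\<lambda>x. ?w z t x * L x + grad_inner A (g t) (?w z t) (\<psi> t) x)" for z
    by (intro integrable_volume[OF t] continuous_on_add continuous_on_mult L Ck_family_continuous[OF \<phi> t]
        Ck_family_continuous[OF w t] Ck_family_continuous[OF Ck_family_grad_inner[OF \<phi> \<psi>1] t]
        Ck_family_continuous[OF Ck_family_grad_inner[OF w \<psi>1] t])+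
  ultimately have "(\<integral>x. \<phi> t x * L x + grad_inner A (g t) (\<phi> t) (\<psi> t) x \<partial>\<mu> t)
      = (\<Sum>z\<in>X. \<integral>x. ?w z t x * L x + grad_inner A (g t) (?w z t) (\<psi> t) x \<partial>\<mu> t)"
    by (simp add: Bochner_Integration.integral_sum[OF int(3)])
  also have "\<dots> = 0"
    by (intro sum.neutral ballI green_chart_supported[OF t w supp \<psi> L lap])
  finally show ?thesis using int(1,2) by simp
qed

text \<open>The first variation of an integral: the integrand and the volume density both move.\<close>

lemma DERIV_integral:
  assumes I: "convex I" and t: "t \<in> I"
    and u: "Ck_family A 0 I u" and u': "Ck_family A 0 I u'" and q: "Ck_family A 0 I q"
    and du: "\<And>t x. t \<in> I \<Longrightarrow> ((\<lambda>s. u s x) has_real_derivative u' t x) (at t within I)"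
    and dvol: "\<And>c t x. c \<in> A \<Longrightarrow> t \<in> I \<Longrightarrow> x \<in> chart_dom c \<Longrightarrow>
        ((\<lambda>s. vol s c x) has_real_derivative vol t c x * q t x) (at t within I)"
  shows "((\<lambda>s. \<integral>x. u s x \<partial>\<mu> s) has_real_derivative (\<integral>x. u' t x + u t x * q t x \<partial>\<mu> t)) (at t within I)"
proof -
  obtain X :: "'a set" and \<eta> where X: "finite X" "\<And>z. chart_supported (\<eta> z)"
    "\<And>z. Ck_family A 1 I (\<lambda>_. \<eta> z)" "\<And>x. (\<Sum>z\<in>X. \<eta> z x) = 1"
    using partition_of_unity[of I] by metis
  let ?u' = "\<lambda>t x. u' t x + u t x * q t x"
  have \<eta>: "Ck_family A 0 I (\<lambda>_. \<eta> z)" for z using Ck_family_Suc_imp X(3)[of z] by simp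
  have u'': "Ck_family A 0 I ?u'" by (intro Ck_family_add Ck_family_mult u u' q)
  have split: "(\<integral>x. w s x \<partial>\<mu> s) = (\<Sum>z\<in>X. \<integral>x. \<eta> z x * w s x \<partial>\<mu> s)"
    if "s \<in> I" and w: "Ck_family A 0 I w" for s w
  proof -
    have "(\<integral>x. w s x \<partial>\<mu> s) = (\<integral>x. (\<Sum>z\<in>X. \<eta> z x * w s x) \<partial>\<mu> s)"
      using X(4) by (simp flip: sum_distrib_right)
    also have "\<dots> = (\<Sum>z\<in>X. \<integral>x. \<eta> z x * w s x \<partial>\<mu> s)"
      by (rule Bochner_Integration.integral_sum, rule integrable_volume[OF that(1)])
        (rule Ck_family_continuous[OF Ck_family_mult[OF \<eta> w] that(1)])
    finally show ?thesis .
  qed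
  have "((\<lambda>s. \<integral>x. \<eta> z x * u s x \<partial>\<mu> s) has_real_derivative (\<integral>x. \<eta> z x * ?u' t x \<partial>\<mu> t)) (at t within I)" for z
  proof -
    obtain c K where c: "c \<in> A" and K: "compact K" "K \<subseteq> chart_dom c" "\<And>x. x \<notin> K \<Longrightarrow> \<eta> z x = 0"
      using X(2)[of z] unfolding chart_supported_def by blast
    let ?F = "\<lambda>w s. chart_extend c (\<lambda>x. vol s c x * (\<eta> z x * w s x))"
    have F: "(\<integral>x. \<eta> z x * w s x \<partial>\<mu> s) = (\<integral>y. ?F w s y \<partial>lborel)"
      if "s \<in> I" and w: "Ck_family A 0 I w" for s w
      by (rule integral_chart_supported[OF c that(1) K(1,2) Ck_family_continuous[OF Ck_family_mult[OF \<eta> w] that(1)]])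
        (simp add: K(3))
    have cont: "continuous_on (I \<times> UNIV) (\<lambda>(s, y). ?F w s y)" if w: "Ck_family A 0 I w" for w
      by (rule continuous_on_chart_extend[OF c K(1,2) Ck_in_mult[OF Ck_in_sqrt_det[OF c] Ck_familyD[OF Ck_family_mult[OF \<eta> w] c]]])
        (simp add: K(3))
    have out: "?F w s y = 0" if "y \<notin> snd c ` K" for w s y
      by (rule chart_extend_outside[OF c K(2) _ that]) (simp add: K(3))
    have "((\<lambda>s. \<integral>y. ?F u s y \<partial>lborel) has_real_derivative (\<integral>y. ?F ?u' t y \<partial>lborel)) (at t within I)"
    proof (rule deriv_lborel_integral_compact_support[where F = "?F u" and F' = "?F ?u'",
          OF I t chart_image_compact(1)[OF c K(1,2)] _ _ cont[OF u] cont[OF u'']])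
      show "?F u s y = 0" "?F ?u' s y = 0" if "s \<in> I" "y \<notin> snd c ` K" for s y
        by (rule out[OF that(2)])+
      fix s y assume s: "s \<in> I"
      show "((\<lambda>s. ?F u s y) has_real_derivative ?F ?u' s y) (at s within I)"
      proof (cases "y \<in> chart_img c")
        case True
        note x = chart_inv_in[OF c True]
        let ?x = "chart_inv c y"
        have "((\<lambda>s. vol s c ?x * (\<eta> z ?x * u s ?x)) has_real_derivative
            vol s c ?x * q s ?x * (\<eta> z ?x * u s ?x) + \<eta> z ?x * u' s ?x * vol s c ?x) (at s within I)"
          by (rule DERIV_mult[OF dvol[OF c s x] DERIV_cmult[OF du[OF s]]])
        then show ?thesis using True by (simp add: chart_extend_def algebra_simps del: imageE)
      qed (simp add: chart_extend_def)
    qed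
    then have "((\<lambda>s. \<integral>y. ?F u s y \<partial>lborel) has_real_derivative (\<integral>x. \<eta> z x * ?u' t x \<partial>\<mu> t)) (at t within I)"
      by (simp only: F[OF t u''])
    then show ?thesis
      by (rule has_field_derivative_transform_within[where d = 1]) (simp_all add: F u t)
  qed
  then have "((\<lambda>s. \<Sum>z\<in>X. \<integral>x. \<eta> z x * u s x \<partial>\<mu> s) has_real_derivative (\<Sum>z\<in>X. \<integral>x. \<eta> z x * ?u' t x \<partial>\<mu> t)) (at t within I)"
    by (rule DERIV_sum)
  then have "((\<lambda>s. \<Sum>z\<in>X. \<integral>x. \<eta> z x * u s x \<partial>\<mu> s) has_real_derivative (\<integral>x. ?u' t x \<partial>\<mu> t)) (at t within I)"
    by (simp only: split[OF t u''])
  then show ?thesis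
    by (rule has_field_derivative_transform_within[where d = 1]) (simp_all add: split u t)
qed

end

section \<open>The heat equation along the conformal Ricci flow\<close>

lemma (in riemannian_family) Ck_in_laplacian:
  assumes c: "c \<in> A" and u: "Ck_in c (Suc (Suc k)) I u"
  shows "Ck_in c k I (\<lambda>t. laplacian (g t) c (u t))"
proof -
  have chr: "Ck_in c k I (\<lambda>t. christoffel (g t) c a i j)" for a i j
    unfolding christoffel_def[abs_def]
    by (intro Ck_in_mult Ck_in_const Ck_in_sum Ck_in_matrix_inv Ck_in_add Ck_in_diff Ck_in_pd[OF c Ck_in_metric] c)
  show ?thesis
    unfolding laplacian_def[abs_def] divergence_def[abs_def]
    by (intro Ck_in_sum Ck_in_add Ck_in_mult chr Ck_in_pd[OF c Ck_in_grad[OF c u]] Ck_in_grad[OF c Ck_in_Suc_imp[OF u]])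
qed

lemma Ck_on_bounded_linear:
  assumes "bounded_linear L"
  shows "Ck_on k S L"
proof (cases k)
  case 0
  then show ?thesis by (simp add: linear_continuous_on[OF assms])
next
  case (Suc n)
  show ?thesis
    unfolding Suc Ck_on.simps
    by (intro exI[of _ "\<lambda>_. L"] conjI ballI allI Ck_on_const bounded_linear_imp_has_derivative assms)
qed

lemma smooth_family_Ck: "smooth_family A I u \<Longrightarrow> Ck_family A k I u"
  by (simp add: smooth_family_def Ck_family_def smooth_family_in_def Ck_in_def smooth_on_def)

locale conformal_heat_flow = riemannian_volume_family A "{0..<T}" g \<mu>
  for A :: "('a::t2_space, 'n::finite) chart set" and T :: real
    and g :: "real \<Rightarrow> ('a, 'n) tensor2" and \<mu> :: "real \<Rightarrow> 'a measure" +
  fixes m :: nat and p H f v :: "real \<Rightarrow> 'a \<Rightarrow> real"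
  assumes dim: "CARD('n) = m + 1"
    and flow: "conformal_Ricci_flow A m T g p"
    and scal: "\<And>t c x. t \<in> {0..<T} \<Longrightarrow> c \<in> A \<Longrightarrow> x \<in> chart_dom c \<Longrightarrow>
                 scal (g t) c x = - (real m * (real m + 1))"
    and H_smooth: "smooth_family A {0..<T} H"
    and H_pos: "\<And>t x. t \<in> {0..<T} \<Longrightarrow> H t x > 0"
    and H_heat: "\<And>t c x. t \<in> {0..<T} \<Longrightarrow> c \<in> A \<Longrightarrow> x \<in> chart_dom c \<Longrightarrow>
        ((\<lambda>s. H s x) has_real_derivative
           - laplacian (g t) c (H t) x + (real m + 1) * p t x * H t x) (at t within {0..<T})"
    and f: "\<And>t x. t \<in> {0..<T} \<Longrightarrow>
              H t x = (4 * pi * (T - t)) powr (- (real m + 1) / 2) * exp (- f t x)"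
    and v_smooth: "smooth_family A {0..<T} v"
    and v_heat: "heat_solution A T g p v"
begin

abbreviation I :: "real set" where "I \<equiv> {0..<T}"

abbreviation G :: "real \<Rightarrow> ('a \<Rightarrow> real) \<Rightarrow> ('a \<Rightarrow> real) \<Rightarrow> 'a \<Rightarrow> real" where
  "G t \<equiv> grad_inner A (g t)"

abbreviation pbar :: "real \<Rightarrow> real" where "pbar \<equiv> max_pressure p"

lemma convex_I: "convex I"
  by (rule convex_real_interval)

lemma nontrivial_I: "t \<in> I \<Longrightarrow> at t within I \<noteq> bot"
proof -
  assume "t \<in> I"
  then have "t islimpt {t<..<T}" "{t<..<T} \<subseteq> I" by (auto intro: islimpt_greaterThanLessThan1)
  then have "t islimpt I" by (rule islimpt_subset)
  then show ?thesis by (simp add: trivial_limit_within)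
qed

lemma H_family: "Ck_family A k I H" by (rule smooth_family_Ck[OF H_smooth])

lemma v_family: "Ck_family A k I v" by (rule smooth_family_Ck[OF v_smooth])

lemma p_family: "Ck_family A k I p"
  using flow by (intro smooth_family_Ck) (simp add: conformal_Ricci_flow_def)

lemma time_deriv_family:
  assumes "\<And>k. Ck_family A k I u"
  shows "Ck_family A k I (time_deriv I u)"
  using Ck_in_time_deriv[OF _ Ck_familyD[OF assms[of "Suc k"]] nontrivial_I] by (simp add: Ck_family_def)

lemma DERIV_time:
  assumes "\<And>k. Ck_family A k I u" "t \<in> I"
  shows "((\<lambda>s. u s x) has_real_derivative time_deriv I u t x) (at t within I)"
proof -
  obtain c where "c \<in> A" "x \<in> chart_dom c" by (rule chart_covers)
  then show ?thesis
    using DERIV_time_deriv[OF _ Ck_familyD[OF assms(1)[of "Suc 0"]] assms(2) _ nontrivial_I[OF assms(2)]] by blast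
qed

lemma f_eq: "t \<in> I \<Longrightarrow> f t x = - (real m + 1) / 2 * ln (4 * pi * (T - t)) - ln (H t x)"
  using f[of t x] by (simp add: ln_mult ln_powr)

lemma f_family: "Ck_family A k I f"
  unfolding Ck_family_def
proof
  fix c assume c: "c \<in> A"
  have H': "Ck_on k (I \<times> chart_img c) (\<lambda>q. ln (case q of (t, y) \<Rightarrow> H t (chart_inv c y)))"
    by (rule Ck_on_ln) (use H_pos Ck_familyD[OF H_family c] in \<open>auto simp: Ck_in_def\<close>)
  have t': "Ck_on k (I \<times> chart_img c) (\<lambda>q. ln (4 * pi * (T - fst q)))"
  proof (rule Ck_on_ln)
    show "Ck_on k (I \<times> chart_img c) (\<lambda>q. 4 * pi * (T - fst q))"
      by (intro Ck_on_mult Ck_on_const Ck_on_diff Ck_on_bounded_linear bounded_linear_fst)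
  qed auto
  have "Ck_on k (I \<times> chart_img c) (\<lambda>q. - (real m + 1) / 2 * ln (4 * pi * (T - fst q))
      - ln (case q of (t, y) \<Rightarrow> H t (chart_inv c y)))"
    by (intro Ck_on_diff Ck_on_cmult H' t')
  then show "Ck_in c k I f"
    unfolding Ck_in_def by (rule Ck_on_cong[THEN iffD1, rotated]) (auto simp: f_eq)
qed

text \<open>The Laplacians of \<open>H t\<close> and \<open>v t\<close> as functions on the manifold: the evolution equations
  express them through chart-free quantities.\<close>

definition lap_H :: "real \<Rightarrow> 'a \<Rightarrow> real" where
  "lap_H t x = (real m + 1) * p t x * H t x - time_deriv I H t x"

definition lap_v :: "real \<Rightarrow> 'a \<Rightarrow> real" where
  "lap_v t x = time_deriv I v t x - pbar t * v t x"

lemma laplacian_H: "t \<in> I \<Longrightarrow> c \<in> A \<Longrightarrow> x \<in> chart_dom c \<Longrightarrow> laplacian (g t) c (H t) x = lap_H t x"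
  using has_real_derivative_unique_within[OF H_heat DERIV_time[OF H_family] nontrivial_I, of t c x]
  by (simp add: lap_H_def)

lemma laplacian_v:
  assumes "t \<in> I" "c \<in> A" "x \<in> chart_dom c"
  shows "laplacian (g t) c (v t) x = lap_v t x"
proof -
  obtain v' where "((\<lambda>s. v s x) has_real_derivative v') (at t within I)"
    "v' - laplacian (g t) c (v t) x = pbar t * v t x"
    using v_heat assms unfolding heat_solution_def by meson
  then show ?thesis
    using has_real_derivative_unique_within[OF _ DERIV_time[OF v_family assms(1)] nontrivial_I[OF assms(1)]]
    by (simp add: lap_v_def algebra_simps)
qed

lemma continuous_lap_H: "t \<in> I \<Longrightarrow> continuous_on UNIV (lap_H t)"
  unfolding lap_H_def[abs_def]
  by (intro continuous_intros Ck_family_continuous[OF p_family] Ck_family_continuous[OF H_family]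
      Ck_family_continuous[OF time_deriv_family[OF H_family]])

lemma continuous_lap_v: "t \<in> I \<Longrightarrow> continuous_on UNIV (lap_v t)"
  unfolding lap_v_def[abs_def]
  by (intro continuous_intros Ck_family_continuous[OF v_family]
      Ck_family_continuous[OF time_deriv_family[OF v_family]])

lemma G_family: "(\<And>k. Ck_family A k I a) \<Longrightarrow> (\<And>k. Ck_family A k I b) \<Longrightarrow> Ck_family A k I (\<lambda>t. G t (a t) (b t))"
  by (rule Ck_family_grad_inner)

lemma G_commute: "t \<in> I \<Longrightarrow> (\<And>k. Ck_family A k I a) \<Longrightarrow> (\<And>k. Ck_family A k I b) \<Longrightarrow>
    G t (a t) (b t) x = G t (b t) (a t) x"
  by (rule grad_inner_commute)

text \<open>\<open>\<nabla>H = - H \<nabla>f\<close>.\<close>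

lemma G_H:
  assumes t: "t \<in> I" and w: "\<And>k. Ck_family A k I w"
  shows "G t (H t) (w t) x = - H t x * G t (f t) (w t) x"
proof -
  obtain c where c: "c \<in> A" "x \<in> chart_dom c" by (rule chart_covers)
  have "pd c i (H t) x = - H t x * pd c i (f t) x" for i
  proof (rule pd_eqI)
    show "((\<lambda>s. H t (chart_inv c (snd c x + s *\<^sub>R axis i 1))) has_real_derivative - H t x * pd c i (f t) x) (at 0)"
      unfolding f[OF t]
      by (rule derivative_eq_intros DERIV_pd[OF c(1) Ck_familyD[OF f_family c(1)] t c(2)] refl)+
        (simp add: chart_inv_chart[OF c])
  qed
  then show ?thesis
    unfolding grad_inner_eq[OF c t H_family w] grad_inner_eq[OF c t f_family w] chart_inner_sum
    by (simp add: sum_distrib_left mult.assoc sum_negf)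
qed

lemma p_le_pbar:
  assumes t: "t \<in> I"
  shows "p t x \<le> pbar t"
proof -
  have "compact (range (p t))"
    by (rule compact_continuous_image[OF Ck_family_continuous[OF p_family t] compact_UNIV])
  then have "bdd_above (range (p t))" by (intro bounded_imp_bdd_above compact_imp_bounded)
  then show ?thesis unfolding max_pressure_def by (rule cSUP_upper[OF UNIV_I])
qed

text \<open>Along the flow \<open>\<partial>\<^sub>t log sqrt (det g)\<close> is minus the trace of \<open>Ric + (m + p) g\<close>, which the
  constraint on the scalar curvature reduces to a multiple of the pressure.\<close>

lemma DERIV_vol:
  assumes c: "c \<in> A" and t: "t \<in> I" and x: "x \<in> chart_dom c"
  shows "((\<lambda>s. vol s c x) has_real_derivative vol t c x * (- (real m + 1) * p t x)) (at t within I)"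
proof -
  let ?N = "matrix_inv (g t c x)"
  define M where "M = (-2) *\<^sub>R (Ric (g t) c x + (real m + p t x) *\<^sub>R g t c x)"
  have "((\<lambda>s. g s c x) has_vector_derivative M) (at t within I)"
    using flow c t x unfolding conformal_Ricci_flow_def M_def by blast
  then have "((\<lambda>s. g s c x $ i $ j) has_real_derivative M $ i $ j) (at t within I)" for i j
    using bounded_linear.has_vector_derivative[OF bounded_linear_vec_nth
        bounded_linear.has_vector_derivative[OF bounded_linear_vec_nth]]
    by (simp add: has_real_derivative_iff_has_vector_derivative)
  from DERIV_sqrt_det[OF this metric_det_pos[OF c t x]]
  have "((\<lambda>s. vol s c x) has_real_derivative
      vol t c x * (1/2 * (\<Sum>i\<in>UNIV. \<Sum>j\<in>UNIV. ?N $ i $ j * M $ j $ i))) (at t within I)" .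
  note D = this
  have tr: "(\<Sum>i\<in>UNIV. \<Sum>j\<in>UNIV. ?N $ i $ j * M $ j $ i) = - 2 * (real m + 1) * p t x"
  proof -
    have "(\<Sum>i\<in>UNIV. \<Sum>j\<in>UNIV. ?N $ i $ j * Ric (g t) c x $ j $ i) = scal (g t) c x"
      unfolding scal_def by (subst sum.swap) (simp add: metric_inv_symmetric[OF c t x])
    moreover have "(\<Sum>i\<in>UNIV. \<Sum>j\<in>UNIV. ?N $ i $ j * g t c x $ j $ i) = real m + 1"
    proof -
      have "(\<Sum>i\<in>UNIV. \<Sum>j\<in>UNIV. ?N $ i $ j * g t c x $ j $ i) = (\<Sum>i\<in>UNIV. (?N ** g t c x) $ i $ i)"
        by (simp add: matrix_matrix_mult_def)
      also have "\<dots> = real m + 1"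
        by (simp add: matrix_inv_left[OF metric_invertible[OF c t x]] mat_def dim)
      finally show ?thesis .
    qed
    moreover have "(\<Sum>i\<in>UNIV. \<Sum>j\<in>UNIV. ?N $ i $ j * M $ j $ i)
      = - 2 * ((\<Sum>i\<in>UNIV. \<Sum>j\<in>UNIV. ?N $ i $ j * Ric (g t) c x $ j $ i)
         + (real m + p t x) * (\<Sum>i\<in>UNIV. \<Sum>j\<in>UNIV. ?N $ i $ j * g t c x $ j $ i))"
    proof -
      have "?N $ i $ j * M $ j $ i = - 2 * (?N $ i $ j * Ric (g t) c x $ j $ i)
          + - 2 * ((real m + p t x) * (?N $ i $ j * g t c x $ j $ i))" for i j
        by (simp add: M_def algebra_simps)
      then show ?thesis
        by (simp only: sum.distrib flip: sum_distrib_left) (simp add: algebra_simps)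
    qed
    ultimately show ?thesis by (simp add: scal[OF t c x] algebra_simps)
  qed
  show ?thesis by (rule DERIV_cong[OF D], unfold tr) simp
qed

text \<open>Since \<open>d\<mu>\<close> absorbs the zeroth order term of the conjugate heat equation, the weighted measure
  evolves by \<open>\<partial>\<^sub>t (H d\<mu>) = - (\<Delta>H) d\<mu>\<close>.\<close>

lemma DERIV_weighted_integral:
  assumes t: "t \<in> I" and u: "\<And>k. Ck_family A k I u"
  shows "((\<lambda>s. \<integral>x. u s x * H s x \<partial>\<mu> s) has_real_derivative
      (\<integral>x. time_deriv I u t x * H t x \<partial>\<mu> t) - (\<integral>x. H t x * G t (u t) (f t) x \<partial>\<mu> t)) (at t within I)"
proof -
  have "((\<lambda>s. \<integral>x. u s x * H s x \<partial>\<mu> s) has_real_derivative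
      (\<integral>x. (time_deriv I u t x * H t x + time_deriv I H t x * u t x)
        + u t x * H t x * (- (real m + 1) * p t x) \<partial>\<mu> t)) (at t within I)"
    by (rule DERIV_integral[OF convex_I t])
      (intro Ck_family_mult Ck_family_add Ck_family_const u H_family p_family time_deriv_family
        DERIV_mult DERIV_time DERIV_vol | assumption)+
  also have "(\<integral>x. (time_deriv I u t x * H t x + time_deriv I H t x * u t x)
        + u t x * H t x * (- (real m + 1) * p t x) \<partial>\<mu> t)
      = 1 * (\<integral>x. time_deriv I u t x * H t x \<partial>\<mu> t) + (- 1) * (\<integral>x. u t x * lap_H t x \<partial>\<mu> t) + 0 * (\<integral>x. 0 \<partial>\<mu> t)"
    by (rule integral_combination[OF t]; (intro continuous_on_mult continuous_on_const
        continuous_lap_H t Ck_family_continuous[OF u] Ck_family_continuous[OF H_family]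
        Ck_family_continuous[OF time_deriv_family[OF u]])?) (simp add: lap_H_def algebra_simps)
  also have "(\<integral>x. u t x * lap_H t x \<partial>\<mu> t) = - (\<integral>x. G t (u t) (H t) x \<partial>\<mu> t)"
    by (rule green[OF t u H_family continuous_lap_H[OF t] laplacian_H[OF t]])
  also have "G t (u t) (H t) = (\<lambda>x. - (H t x * G t (u t) (f t) x))"
    using G_commute[OF t u H_family] G_commute[OF t u f_family] G_H[OF t u] by (simp add: fun_eq_iff)
  finally show ?thesis by simp
qed

text \<open>The drifting Laplacian of \<open>v\<close>, again as a function on the manifold.\<close>

definition drift :: "real \<Rightarrow> 'a \<Rightarrow> real" where
  "drift t x = lap_v t x - G t (f t) (v t) x"

lemma continuous_drift: "t \<in> I \<Longrightarrow> continuous_on UNIV (drift t)"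
  unfolding drift_def[abs_def]
  by (intro continuous_on_diff continuous_lap_v Ck_family_continuous[OF G_family[OF f_family v_family]])

lemma drift_laplacian_v:
  assumes "t \<in> I" "c \<in> A" "x \<in> chart_dom c"
  shows "drift_laplacian (g t) (f t) c (v t) x = drift t x"
  unfolding drift_laplacian_eq[OF assms(2,1,3) Ck_familyD[OF f_family assms(2)] Ck_familyD[OF v_family assms(2)]]
    laplacian_v[OF assms] drift_def grad_inner_eq[OF assms(2,3,1) f_family v_family] ..

lemma continuous_H: "t \<in> I \<Longrightarrow> continuous_on UNIV (H t)"
  by (rule Ck_family_continuous[OF H_family])

text \<open>\<open>\<integral> \<phi> \<L>v dV = - \<integral> \<langle>\<nabla>\<phi>, \<nabla>v\<rangle> dV\<close>: Green's formula for the test function \<open>H \<phi>\<close>, where the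
  gradient of \<open>H\<close> supplies the drift.\<close>

lemma weighted_green:
  assumes t: "t \<in> I" and \<phi>: "\<And>k. Ck_family A k I \<phi>"
  shows "(\<integral>x. H t x * (\<phi> t x * drift t x) \<partial>\<mu> t) = - (\<integral>x. H t x * G t (\<phi> t) (v t) x \<partial>\<mu> t)"
proof -
  note \<phi>c = Ck_family_continuous[OF \<phi> t] and Hc = continuous_H[OF t]
    and Gc = Ck_family_continuous[OF G_family[OF f_family v_family] t]
    and Gc' = Ck_family_continuous[OF G_family[OF \<phi> v_family] t]
  have "(\<integral>x. H t x * (\<phi> t x * drift t x) \<partial>\<mu> t)
      = 1 * (\<integral>x. H t x * \<phi> t x * lap_v t x \<partial>\<mu> t) + (- 1) * (\<integral>x. H t x * \<phi> t x * G t (f t) (v t) x \<partial>\<mu> t) + 0 * (\<integral>x. 0 \<partial>\<mu> t)"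
    by (rule integral_combination[OF t]; (intro continuous_on_mult continuous_on_const \<phi>c Hc Gc continuous_lap_v t)?)
      (simp add: drift_def algebra_simps)
  also have "(\<integral>x. H t x * \<phi> t x * lap_v t x \<partial>\<mu> t) = - (\<integral>x. G t (\<lambda>x. H t x * \<phi> t x) (v t) x \<partial>\<mu> t)"
    by (rule green[OF t Ck_family_mult[OF H_family \<phi>] v_family continuous_lap_v[OF t] laplacian_v[OF t]])
  also have "(\<integral>x. G t (\<lambda>x. H t x * \<phi> t x) (v t) x \<partial>\<mu> t)
      = 1 * (\<integral>x. H t x * G t (\<phi> t) (v t) x \<partial>\<mu> t) + (- 1) * (\<integral>x. H t x * \<phi> t x * G t (f t) (v t) x \<partial>\<mu> t) + 0 * (\<integral>x. 0 \<partial>\<mu> t)"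
    by (rule integral_combination[OF t]; (intro continuous_on_mult continuous_on_const \<phi>c Hc Gc Gc')?)
      (simp add: grad_inner_mult[OF t H_family \<phi> v_family] G_H[OF t v_family] algebra_simps)
  finally show ?thesis by simp
qed

definition mass :: "real \<Rightarrow> real" where "mass t = (\<integral>x. (v t x)\<^sup>2 * H t x \<partial>\<mu> t)"
definition energy :: "real \<Rightarrow> real" where "energy t = (\<integral>x. G t (v t) (v t) x * H t x \<partial>\<mu> t)"
definition drift_mass :: "real \<Rightarrow> real" where "drift_mass t = (\<integral>x. (drift t x)\<^sup>2 * H t x \<partial>\<mu> t)"

lemma integral_v_drift: "t \<in> I \<Longrightarrow> (\<integral>x. H t x * (v t x * drift t x) \<partial>\<mu> t) = - energy t"
  using weighted_green[OF _ v_family] by (simp add: energy_def mult.commute)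

text \<open>\<open>\<partial>\<^sub>t (v\<^sup>2) = 2 v (\<Delta>v + pbar v)\<close>, and the motion of the weighted measure turns \<open>\<Delta>v\<close> into \<open>\<L>v\<close>.\<close>

lemma DERIV_mass:
  assumes t: "t \<in> I"
  shows "(mass has_real_derivative 2 * pbar t * mass t - 2 * energy t) (at t within I)"
proof -
  let ?w = "\<lambda>t x. v t x * v t x"
  have w: "Ck_family A k I ?w" for k by (intro Ck_family_mult v_family)
  have dw: "time_deriv I ?w t x = 2 * v t x * time_deriv I v t x" for x
    by (rule has_real_derivative_unique_within[OF DERIV_time[OF w t] _ nontrivial_I[OF t]],
        rule DERIV_cong[OF DERIV_mult[OF DERIV_time[OF v_family t] DERIV_time[OF v_family t]]]) simp
  have Gw: "G t (?w t) (f t) x = 2 * v t x * G t (f t) (v t) x" for x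
    unfolding grad_inner_mult[OF t v_family v_family f_family] G_commute[OF t v_family f_family] by simp
  note cont = continuous_H[OF t] Ck_family_continuous[OF v_family t] continuous_drift[OF t]
    Ck_family_continuous[OF w t] Ck_family_continuous[OF time_deriv_family[OF w] t]
    Ck_family_continuous[OF G_family[OF w f_family] t]
  have "(\<integral>x. time_deriv I ?w t x * H t x \<partial>\<mu> t) = 1 * (\<integral>x. H t x * G t (?w t) (f t) x \<partial>\<mu> t)
      + (2 * pbar t) * mass t + 2 * (\<integral>x. H t x * (v t x * drift t x) \<partial>\<mu> t)"
    unfolding mass_def
    by (rule integral_combination[OF t]; (intro continuous_on_mult continuous_on_power cont)?)
      (simp add: dw Gw drift_def lap_v_def power2_eq_square algebra_simps)
  then have "(\<integral>x. time_deriv I ?w t x * H t x \<partial>\<mu> t) - (\<integral>x. H t x * G t (?w t) (f t) x \<partial>\<mu> t)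
      = 2 * pbar t * mass t - 2 * energy t"
    by (simp add: integral_v_drift[OF t])
  with DERIV_weighted_integral[OF t w] show ?thesis
    by (simp add: mass_def[abs_def] power2_eq_square)
qed

text \<open>The Ricci tensor enters through \<open>\<partial>\<^sub>t g\<close>, the Hessian of \<open>f\<close> through the iterated gradient
  products: together they form the Bakry-Emery tensor.\<close>

lemma time_deriv_energy_density:
  assumes t: "t \<in> I" and c: "c \<in> A" and x: "x \<in> chart_dom c"
  defines "V \<equiv> grad (g t) c (v t) x"
  shows "time_deriv I (\<lambda>t. G t (v t) (v t)) t x + 2 * G t (v t) (G t (f t) (v t)) x - G t (f t) (G t (v t) (v t)) x
    = 2 * (V \<bullet> (bakry_emery_Ric (g t) (f t) c x *v V)) + 2 * (real m + p t x) * G t (v t) (v t) x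
      + 2 * G t (v t) (time_deriv I v t) x"
proof -
  note Gv = G_family[OF v_family v_family] and Gf = G_family[OF f_family v_family]
  note eq = grad_inner_eq[OF c x t]
  let ?R = "Ric (g t) c x" and ?g = "g t c x"
  have "((\<lambda>s. g s c x) has_vector_derivative (-2) *\<^sub>R (?R + (real m + p t x) *\<^sub>R ?g)) (at t within I)"
    using flow c t x unfolding conformal_Ricci_flow_def by blast
  from DERIV_chart_inner_time[OF c t x convex_I nontrivial_I Ck_familyD[OF v_family c] this]
  have D: "((\<lambda>s. chart_inner (g s) c (v s) (v s) x) has_real_derivative
     2 * chart_inner (g t) c (v t) (time_deriv I v t) x
     - V \<bullet> (((-2) *\<^sub>R (?R + (real m + p t x) *\<^sub>R ?g)) *v V)) (at t within I)"
    unfolding V_def .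
  have "((\<lambda>s. G s (v s) (v s) x) has_real_derivative
     2 * chart_inner (g t) c (v t) (time_deriv I v t) x
     - V \<bullet> (((-2) *\<^sub>R (?R + (real m + p t x) *\<^sub>R ?g)) *v V)) (at t within I)"
    by (rule has_field_derivative_transform_within[OF D, of 1])
      (use t grad_inner_eq[OF c x _ v_family v_family] in auto)
  then have "time_deriv I (\<lambda>t. G t (v t) (v t)) t x = 2 * chart_inner (g t) c (v t) (time_deriv I v t) x
     - V \<bullet> (((-2) *\<^sub>R (?R + (real m + p t x) *\<^sub>R ?g)) *v V)"
    by (rule has_real_derivative_unique_within[OF DERIV_time[OF Gv t] _ nontrivial_I[OF t]])
  moreover have "V \<bullet> (((-2) *\<^sub>R (?R + (real m + p t x) *\<^sub>R ?g)) *v V)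
      = - 2 * (V \<bullet> (?R *v V)) - 2 * (real m + p t x) * chart_inner (g t) c (v t) (v t) x"
    unfolding chart_inner_metric[OF c t x, symmetric] V_def[symmetric]
  proof -
    have "((-2) *\<^sub>R (?R + (real m + p t x) *\<^sub>R ?g)) *v V = (-2) *\<^sub>R (?R *v V + (real m + p t x) *\<^sub>R (?g *v V))"
      by (simp only: scaleR_matrix_vector_assoc[symmetric] matrix_vector_mult_add_rdistrib)
    then show "V \<bullet> (((-2) *\<^sub>R (?R + (real m + p t x) *\<^sub>R ?g)) *v V)
        = - 2 * (V \<bullet> (?R *v V)) - 2 * (real m + p t x) * (V \<bullet> (?g *v V))"
      by (simp only: inner_scaleR_right inner_add_right) (simp add: algebra_simps)
  qed
  moreover have "2 * G t (v t) (G t (f t) (v t)) x - G t (f t) (G t (v t) (v t)) x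
      = 2 * (V \<bullet> (hessian (g t) (f t) c x *v V))"
  proof -
    have "pd c i (G t (a t) (b t)) x = pd c i (chart_inner (g t) c (a t) (b t)) x"
      if "\<And>k. Ck_family A k I a" "\<And>k. Ck_family A k I b" for i a b
      by (rule pd_cong[OF c x]) (rule grad_inner_eq[OF c _ t that])
    then have "chart_inner (g t) c w (G t (a t) (b t)) x = chart_inner (g t) c w (chart_inner (g t) c (a t) (b t)) x"
      if "\<And>k. Ck_family A k I a" "\<And>k. Ck_family A k I b" for w a b
      using that by (simp add: chart_inner_def grad_def)
    then show ?thesis
      unfolding eq[OF v_family Gf] eq[OF f_family Gv] V_def
      using hessian_grad_grad[OF c t x Ck_familyD[OF f_family c] Ck_familyD[OF v_family c]]
        f_family v_family by simp
  qed
  moreover have "V \<bullet> (bakry_emery_Ric (g t) (f t) c x *v V) = V \<bullet> (?R *v V) + V \<bullet> (hessian (g t) (f t) c x *v V)"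
    by (simp add: bakry_emery_Ric_def matrix_vector_mult_add_rdistrib inner_add_right)
  ultimately show ?thesis
    unfolding eq[OF v_family v_family] eq[OF v_family time_deriv_family[OF v_family]] by simp
qed

lemma G_nonneg:
  assumes t: "t \<in> I"
  shows "G t (v t) (v t) x \<ge> 0"
proof -
  obtain c where c: "c \<in> A" "x \<in> chart_dom c" by (rule chart_covers)
  let ?V = "grad (g t) c (v t) x"
  have "?V \<bullet> (g t c x *v ?V) \<ge> 0"
    using metric[OF t] c unfolding riemannian_metric_def
    by (cases "?V = 0") (auto intro: less_imp_le)
  then show ?thesis
    unfolding grad_inner_eq[OF c t v_family v_family] chart_inner_metric[OF c(1) t c(2)] .
qed

text \<open>Here \<open>\<kappa> = k / h\<close>. By \<open>time_deriv_energy_density\<close> the integrand of \<open>D'\<close> is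
  \<open>2 Ric\<^sub>f(\<nabla>v, \<nabla>v) + 2 (m + p) |\<nabla>v|\<^sup>2 + 2 \<langle>\<nabla>w, \<nabla>v\<rangle>\<close> with \<open>w = \<partial>\<^sub>t v - \<langle>\<nabla>f, \<nabla>v\<rangle>\<close>. Since \<open>w\<close> equals
  \<open>\<L>v + pbar v\<close>, \<open>\<integral> \<langle>\<nabla>w, \<nabla>v\<rangle> dV = - E + pbar D\<close> by the weighted Green
  formula.\<close>

lemma DERIV_energy:
  assumes t: "t \<in> I"
    and Ric_bound: "\<And>c x. c \<in> A \<Longrightarrow> x \<in> chart_dom c \<Longrightarrow>
      tensor_le (bakry_emery_Ric (g t) (f t) c x) ((\<kappa> / 2 - real m) *\<^sub>R g t c x)"
  shows "\<exists>D. (energy has_real_derivative D) (at t within I) \<and> D \<le> (\<kappa> + 4 * pbar t) * energy t - 2 * drift_mass t"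
proof -
  let ?e = "\<lambda>t. G t (v t) (v t)" and ?w = "\<lambda>t x. time_deriv I v t x - G t (f t) (v t) x"
  note e = G_family[OF v_family v_family] and Gf = G_family[OF f_family v_family]
    and dv = time_deriv_family[OF v_family]
  have w: "Ck_family A k I ?w" for k by (intro Ck_family_diff dv Gf)
  note cont = continuous_H[OF t] Ck_family_continuous[OF v_family t] continuous_drift[OF t]
    Ck_family_continuous[OF w t] Ck_family_continuous[OF e t] Ck_family_continuous[OF time_deriv_family[OF e] t]
    Ck_family_continuous[OF G_family[OF e f_family] t] Ck_family_continuous[OF G_family[OF w v_family] t]
  let ?D = "(\<integral>x. time_deriv I ?e t x * H t x \<partial>\<mu> t) - (\<integral>x. H t x * G t (?e t) (f t) x \<partial>\<mu> t)"
  have D: "(energy has_real_derivative ?D) (at t within I)"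
    using DERIV_weighted_integral[OF t e] by (simp add: energy_def[abs_def])
  have G_w: "G t (?w t) (v t) x = G t (v t) (time_deriv I v t) x - G t (v t) (G t (f t) (v t)) x" for x
  proof -
    obtain c where c: "c \<in> A" "x \<in> chart_dom c" by (rule chart_covers)
    have "G t (v t) (?w t) x = G t (v t) (time_deriv I v t) x - G t (v t) (G t (f t) (v t)) x"
    proof -
      have "pd c i (?w t) x = pd c i (time_deriv I v t) x - pd c i (G t (f t) (v t)) x" for i
        by (rule pd_eqI, rule DERIV_diff)
          (rule DERIV_pd[OF c(1) Ck_familyD[OF dv c(1)] t c(2)] DERIV_pd[OF c(1) Ck_familyD[OF Gf c(1)] t c(2)])+
      then show ?thesis
        unfolding grad_inner_eq[OF c t v_family w] grad_inner_eq[OF c t v_family dv] grad_inner_eq[OF c t v_family Gf]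
          chart_inner_sum grad_component
        by (simp add: right_diff_distrib sum_subtractf)
    qed
    then show ?thesis using G_commute[OF t w v_family] by simp
  qed
  have pointwise: "time_deriv I ?e t x * H t x - H t x * G t (?e t) (f t) x
      \<le> (\<kappa> + 2 * pbar t) * (?e t x * H t x) + 2 * (H t x * G t (?w t) (v t) x)" for x
  proof -
    obtain c where c: "c \<in> A" "x \<in> chart_dom c" by (rule chart_covers)
    let ?V = "grad (g t) c (v t) x"
    have "?V \<bullet> (bakry_emery_Ric (g t) (f t) c x *v ?V) \<le> ?V \<bullet> (((\<kappa> / 2 - real m) *\<^sub>R g t c x) *v ?V)"
      using Ric_bound[OF c] by (simp add: tensor_le_def)
    also have "\<dots> = (\<kappa> / 2 - real m) * ?e t x"
      unfolding grad_inner_eq[OF c t v_family v_family] chart_inner_metric[OF c(1) t c(2), symmetric]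
      by (simp flip: scaleR_matrix_vector_assoc)
    finally have "time_deriv I ?e t x - G t (?e t) (f t) x
        \<le> (\<kappa> + 2 * p t x) * ?e t x + 2 * G t (?w t) (v t) x"
      using time_deriv_energy_density[OF t c] unfolding G_w G_commute[OF t e f_family]
      by (simp add: algebra_simps)
    also have "\<dots> \<le> (\<kappa> + 2 * pbar t) * ?e t x + 2 * G t (?w t) (v t) x"
      using p_le_pbar[OF t, of x] G_nonneg[OF t, of x] by (simp add: mult_right_mono)
    finally have "H t x * (time_deriv I ?e t x - G t (?e t) (f t) x)
        \<le> H t x * ((\<kappa> + 2 * pbar t) * ?e t x + 2 * G t (?w t) (v t) x)"
      using H_pos[OF t, of x] by (intro mult_left_mono) auto
    then show ?thesis by (simp add: algebra_simps)
  qed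
  have "(\<integral>x. H t x * (?w t x * drift t x) \<partial>\<mu> t)
      = 1 * drift_mass t + pbar t * (\<integral>x. H t x * (v t x * drift t x) \<partial>\<mu> t) + 0 * (\<integral>x. 0 \<partial>\<mu> t)"
    unfolding drift_mass_def
    by (rule integral_combination[OF t]; (intro continuous_on_mult continuous_on_const continuous_on_power cont)?)
      (simp add: drift_def lap_v_def power2_eq_square algebra_simps)
  then have w_int: "(\<integral>x. H t x * G t (?w t) (v t) x \<partial>\<mu> t) = pbar t * energy t - drift_mass t"
    using weighted_green[OF t w] by (simp add: integral_v_drift[OF t])
  have "?D = (\<integral>x. time_deriv I ?e t x * H t x - H t x * G t (?e t) (f t) x \<partial>\<mu> t)"
    by (rule Bochner_Integration.integral_diff[symmetric]; intro integrable_volume[OF t] continuous_on_mult cont)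
  also have "\<dots> \<le> (\<integral>x. (\<kappa> + 2 * pbar t) * (?e t x * H t x) + 2 * (H t x * G t (?w t) (v t) x) \<partial>\<mu> t)"
    by (rule integral_mono[OF _ _ pointwise]; intro integrable_volume[OF t] continuous_on_diff continuous_on_add
        continuous_on_mult continuous_on_const cont)
  also have "\<dots> = (\<kappa> + 2 * pbar t) * energy t + 2 * (\<integral>x. H t x * G t (?w t) (v t) x \<partial>\<mu> t) + 0 * (\<integral>x. 0 \<partial>\<mu> t)"
    unfolding energy_def
    by (rule integral_combination[OF t]; (intro continuous_on_mult continuous_on_const cont)?) simp
  also have "\<dots> = (\<kappa> + 4 * pbar t) * energy t - 2 * drift_mass t" by (simp add: w_int algebra_simps)
  finally show ?thesis using D by blast
qed

text \<open>Expand \<open>\<integral> (\<L>\<^sub>f v + c v)\<^sup>2 dV \<ge> 0\<close>; the cross term is the energy by the weighted Green formula.\<close>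

lemma integral_drift_plus_v_square:
  assumes t: "t \<in> I"
  shows "(\<integral>x. (drift t x + r * v t x)\<^sup>2 * H t x \<partial>\<mu> t) = drift_mass t - 2 * r * energy t + r\<^sup>2 * mass t"
proof -
  note cont = continuous_H[OF t] Ck_family_continuous[OF v_family t] continuous_drift[OF t]
  have "(\<integral>x. (drift t x + r * v t x)\<^sup>2 * H t x \<partial>\<mu> t)
     = 1 * drift_mass t + (2 * r) * (\<integral>x. H t x * (v t x * drift t x) \<partial>\<mu> t) + r\<^sup>2 * mass t"
    unfolding drift_mass_def mass_def
    by (rule integral_combination[OF t]; (intro continuous_on_mult continuous_on_power cont)?)
      (simp add: power2_eq_square algebra_simps)
  then show ?thesis by (simp add: integral_v_drift[OF t])
qed

lemma energy_square_le:
  assumes t: "t \<in> I" and mass: "mass t > 0"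
  shows "(energy t)\<^sup>2 \<le> mass t * drift_mass t"
    and "(energy t)\<^sup>2 = mass t * drift_mass t \<Longrightarrow> - drift t x = energy t / mass t * v t x"
proof -
  let ?r = "energy t / mass t"
  let ?u = "\<lambda>x. (drift t x + ?r * v t x)\<^sup>2 * H t x"
  have u: "continuous_on UNIV ?u"
    by (intro continuous_on_mult continuous_on_power continuous_on_add continuous_on_const
        continuous_H[OF t] Ck_family_continuous[OF v_family t] continuous_drift[OF t])
  have u0: "?u x \<ge> 0" for x using H_pos[OF t, of x] by simp
  have eq: "(\<integral>x. ?u x \<partial>\<mu> t) * mass t = mass t * drift_mass t - (energy t)\<^sup>2"
    unfolding integral_drift_plus_v_square[OF t] using mass by (simp add: field_simps power2_eq_square)
  have "(\<integral>x. ?u x \<partial>\<mu> t) \<ge> 0" using u0 by simp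
  then show "(energy t)\<^sup>2 \<le> mass t * drift_mass t"
    using mult_nonneg_nonneg[of "\<integral>x. ?u x \<partial>\<mu> t" "mass t"] eq mass by linarith
  assume "(energy t)\<^sup>2 = mass t * drift_mass t"
  then have "(\<integral>x. ?u x \<partial>\<mu> t) = 0" using eq mass by simp
  from continuous_integral_eq_0[OF t u u0 this, of x]
  show "- drift t x = ?r * v t x" using H_pos[OF t, of x] by simp
qed

text \<open>The heat equation itself determines \<open>pbar\<close> wherever \<open>v\<close> does not vanish, so the continuity
  of the maximal pressure in time follows from the smoothness of \<open>v\<close>.\<close>

lemma continuous_on_pbar:
  assumes J: "J \<subseteq> I" and v: "\<And>t. t \<in> J \<Longrightarrow> \<exists>x. v t x \<noteq> 0"
  shows "continuous_on J pbar"
  unfolding continuous_on_def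
proof
  fix t assume t: "t \<in> J"
  then obtain x where x: "v t x \<noteq> 0" using v by blast
  obtain c where c: "c \<in> A" "x \<in> chart_dom c" by (rule chart_covers)
  let ?q = "\<lambda>s. (time_deriv I v s x - laplacian (g s) c (v s) x) / v s x"
  have lim: "((\<lambda>s. u s x) \<longlongrightarrow> u t x) (at t within J)" if "Ck_in c k I u" for u k
    using continuous_on_subset[OF Ck_in_time_continuous[OF c(1) that c(2)] J] t by (simp add: continuous_on_def)
  have lv: "((\<lambda>s. v s x) \<longlongrightarrow> v t x) (at t within J)" by (rule lim[OF Ck_familyD[OF v_family c(1)]])
  have qlim: "(?q \<longlongrightarrow> ?q t) (at t within J)"
    by (intro tendsto_divide tendsto_diff lv x lim[OF Ck_familyD[OF time_deriv_family[OF v_family] c(1)]]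
        lim[OF Ck_in_laplacian[OF c(1) Ck_familyD[OF v_family c(1)]]])
  have q: "?q s = pbar s" if "s \<in> J" "v s x \<noteq> 0" for s
    using that J laplacian_v[OF _ c, of s] by (auto simp: lap_v_def field_simps)
  have ev: "\<forall>\<^sub>F s in at t within J. ?q s = pbar s"
  proof -
    have "\<forall>\<^sub>F s in at t within J. s \<in> J" by (simp add: eventually_at_filter)
    with tendsto_imp_eventually_ne[OF lv x] show ?thesis by eventually_elim (rule q)
  qed
  show "(pbar \<longlongrightarrow> pbar t) (at t within J)"
    using Lim_transform_eventually[OF qlim ev] unfolding q[OF t x] .
qed

end

section \<open>Monotonicity of the parabolic frequency\<close>

text \<open>\<open>Q'\<close> is the derivative of \<open>h D w / N\<close> by the product rule, where the exponential weight \<open>w\<close> has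
  the logarithmic derivative \<open>- (2 P + (h' + k) / h)\<close>. The terms in \<open>h'\<close> cancel; of the
  \<open>4 P D\<close> in the bound for \<open>D'\<close>, one half is absorbed by \<open>w\<close> and the other by \<open>N'\<close>.\<close>

lemma frequency_derivative_algebra:
  fixes h h' D D' N N' P k E w :: real
  assumes N: "N > 0" and h: "h \<noteq> 0" and w: "w > 0"
    and N': "N' = 2 * P * N - 2 * D" and D': "D' \<le> (k / h + 4 * P) * D - 2 * E"
    and CS: "D\<^sup>2 \<le> N * E"
  defines "Q' \<equiv> ((h' * D + D' * h) * N - h * D * N') / (N * N) * w + h * D / N * (w * - (2 * P + (h' + k) / h))"
  shows "h * Q' \<le> 0" and "Q' = 0 \<Longrightarrow> D\<^sup>2 = N * E"
proof -
  have Q': "h * Q' = h\<^sup>2 * w / N * (D' - (k / h + 4 * P) * D + 2 * D\<^sup>2 / N)"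
    unfolding Q'_def N' using N h by (simp add: field_simps power2_eq_square)
  have "2 * D\<^sup>2 / N \<le> 2 * E" using CS N by (simp add: field_simps)
  then have le: "D' - (k / h + 4 * P) * D + 2 * D\<^sup>2 / N \<le> 0" using D' by linarith
  have c: "h\<^sup>2 * w / N > 0" using h w N by simp
  show "h * Q' \<le> 0" unfolding Q' by (rule mult_nonneg_nonpos[OF less_imp_le[OF c] le])
  assume "Q' = 0"
  then have "D' - (k / h + 4 * P) * D + 2 * D\<^sup>2 / N = 0" using Q' h w N by simp
  then have "2 * E \<le> 2 * D\<^sup>2 / N" using D' by linarith
  then have "N * E \<le> D\<^sup>2" using N by (simp add: field_simps)
  then show "D\<^sup>2 = N * E" using CS by simp
qed

lemma smooth_on_interval_C1:
  fixes h :: "real \<Rightarrow> real"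
  assumes "smooth_on {a..b} h" "a < b"
  shows "t \<in> {a..b} \<Longrightarrow> (h has_real_derivative vector_derivative h (at t within {a..b})) (at t within {a..b})"
    and "continuous_on {a..b} (\<lambda>t. vector_derivative h (at t within {a..b}))"
proof -
  have "Ck_on (Suc 0) {a..b} h" using assms(1) by (simp only: smooth_on_def)
  then obtain h' where h': "\<And>t. t \<in> {a..b} \<Longrightarrow> (h has_derivative h' t) (at t within {a..b})"
    and cont: "continuous_on {a..b} (\<lambda>t. h' t 1)" by (auto simp del: atLeastAtMost_iff)
  have der: "(h has_real_derivative h' t 1) (at t within {a..b})" if "t \<in> {a..b}" for t
  proof -
    have "h' t = (*) (h' t 1)"
    proof (rule ext)
      show "h' t r = h' t 1 * r" for r
        using linear_scale[OF has_derivative_linear[OF h'[OF that]], of r 1] by (simp add: mult.commute)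
    qed
    then show ?thesis using h'[OF that] by (simp add: has_field_derivative_def)
  qed
  have vd: "vector_derivative h (at t within {a..b}) = h' t 1" if "t \<in> {a..b}" for t
    using der[OF that] that assms(2)
    by (intro vector_derivative_within_cbox[of a b, unfolded cbox_interval])
      (auto simp: has_real_derivative_iff_has_vector_derivative)
  show "t \<in> {a..b} \<Longrightarrow> (h has_real_derivative vector_derivative h (at t within {a..b})) (at t within {a..b})"
    using der vd by simp
  show "continuous_on {a..b} (\<lambda>t. vector_derivative h (at t within {a..b}))"
    by (rule continuous_on_eq[OF cont vd[symmetric]])
qed

lemma weighted_integral:
  fixes u :: "'a::topological_space \<Rightarrow> real"
  assumes "sets \<mu> = sets borel" "continuous_on UNIV u" "continuous_on UNIV H" "\<And>x. H x > 0"
  shows "(\<integral>x. u x \<partial>weighted_measure \<mu> H) = (\<integral>x. u x * H x \<partial>\<mu>)"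
proof -
  have "borel_measurable \<mu> = borel_measurable borel" using measurable_cong_sets[OF assms(1) refl] by blast
  then show ?thesis
    unfolding weighted_measure_def
    by (subst integral_density) (use assms in \<open>auto intro!: borel_measurable_continuous_onI simp: less_imp_le mult.commute\<close>)
qed

theorem theorem1p1:
  fixes A :: "('a::t2_space, 'n::finite) chart set"
    and m :: nat and T t0 t1 :: real
    and g :: "real \<Rightarrow> ('a, 'n) tensor2"
    and p H f v :: "real \<Rightarrow> 'a \<Rightarrow> real"
    and \<mu> V :: "real \<Rightarrow> 'a measure"
    and x0 :: 'a
    and h k Q :: "real \<Rightarrow> real"
  assumes manifold: "closed_connected_manifold A"
    and dim: "CARD('n) = m + 1" "m + 1 \<ge> 3"
    and T_pos: "T > 0"
    and flow: "conformal_Ricci_flow A m T g p"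
    and scal: "\<And>t c x. t \<in> {0..<T} \<Longrightarrow> c \<in> A \<Longrightarrow> x \<in> chart_dom c \<Longrightarrow>
                 scal (g t) c x = - (real m * (real m + 1))"
    and volume: "\<And>t. t \<in> {0..<T} \<Longrightarrow> riemannian_volume A (g t) (\<mu> t)"
    and H: "fundamental_conjugate_heat_solution A m T g p \<mu> x0 H"
    and f: "\<And>t x. t \<in> {0..<T} \<Longrightarrow>
              H t x = (4 * pi * (T - t)) powr (- (real m + 1) / 2) * exp (- f t x)"
    and V: "\<And>t. V t = weighted_measure (\<mu> t) (H t)"
    and V_prob: "\<And>t. t \<in> {0..<T} \<Longrightarrow> emeasure (V t) UNIV = 1"
    and v_smooth: "smooth_family A {0..<T} v"
    and v_W22: "\<And>t. t \<in> {0..<T} \<Longrightarrow> v t \<in> W22_0 A (g t) (V t)"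
    and dv_W22: "\<And>t. t \<in> {0..<T} \<Longrightarrow>
          (\<lambda>x. vector_derivative (\<lambda>s. v s x) (at t within {0..<T})) \<in> W22_0 A (g t) (V t)"
    and v_heat: "heat_solution A T g p v"
    and times: "0 \<le> t0" "t0 < t1" "t1 < T"
    and v_nonzero: "\<And>t. t \<in> {t0..t1} \<Longrightarrow> (\<integral>x. (v t x)\<^sup>2 \<partial>V t) \<noteq> 0"
    and h_smooth: "smooth_on {t0..t1} h"
    and k_smooth: "smooth_on {t0..t1} k"
    and h_sign: "(\<forall>t\<in>{t0..t1}. h t > 0) \<or> (\<forall>t\<in>{t0..t1}. h t < 0)"
    and Ric_bound: "\<And>t c x. t \<in> {t0..t1} \<Longrightarrow> c \<in> A \<Longrightarrow> x \<in> chart_dom c \<Longrightarrow>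
          tensor_le (bakry_emery_Ric (g t) (f t) c x)
            ((k t / (2 * h t) + scal (g t) c x / (real m + 1)) *\<^sub>R g t c x)"
    and Q: "Q = parabolic_frequency A g p V v h k t0 t1"
  shows "((\<forall>t\<in>{t0..t1}. h t > 0) \<longrightarrow> antimono_on {t0..t1} Q) \<and>
         ((\<forall>t\<in>{t0..t1}. h t < 0) \<longrightarrow> mono_on {t0..t1} Q) \<and>
         (\<forall>t\<in>{t0..t1}. (Q has_real_derivative 0) (at t within {t0..t1}) \<longrightarrow>
            (\<exists>c. drift_eigenfunction A (g t) (f t) c (v t)))"
proof -
  interpret conformal_heat_flow A T g \<mu> m p H f v
  proof unfold_locales
    show "closed_connected_manifold A" by (rule manifold)
    show "riemannian_metric A (g t)" if "t \<in> {0..<T}" for t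
      using flow that by (simp add: conformal_Ricci_flow_def)
    show "smooth_family_in c {0..<T} (\<lambda>t. g t c)" if "c \<in> A" for c
      using flow that by (simp add: conformal_Ricci_flow_def)
    show "smooth_family A {0..<T} H" "\<And>t x. t \<in> {0..<T} \<Longrightarrow> H t x > 0"
      "\<And>t c x. t \<in> {0..<T} \<Longrightarrow> c \<in> A \<Longrightarrow> x \<in> chart_dom c \<Longrightarrow>
        ((\<lambda>s. H s x) has_real_derivative
           - laplacian (g t) c (H t) x + (real m + 1) * p t x * H t x) (at t within {0..<T})"
      using H unfolding fundamental_conjugate_heat_solution_def by blast+
  qed (fact dim(1) flow scal volume f v_smooth v_heat)+
  let ?J = "{t0..t1}" and ?h' = "\<lambda>t. vector_derivative h (at t within {t0..t1})"
  have J: "?J \<subseteq> {0..<T}" using times by auto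
  have JT: "t \<in> {0..<T}" if "t \<in> ?J" for t using J that by blast
  have h0: "h t \<noteq> 0" if "t \<in> ?J" for t using h_sign that by force
  have mass_V: "(\<integral>x. (v t x)\<^sup>2 \<partial>V t) = mass t" if "t \<in> {0..<T}" for t
    unfolding V mass_def
    by (intro weighted_integral sets_volume continuous_on_power Ck_family_continuous[OF v_family]
        continuous_H H_pos that)
  have energy_V: "(\<integral>x. in_chart A (\<lambda>c. grad_norm2 (g t) c (v t)) x \<partial>V t) = energy t" if t: "t \<in> {0..<T}" for t
  proof -
    have "in_chart A (\<lambda>c. grad_norm2 (g t) c (v t)) x = grad_inner A (g t) (v t) (v t) x" for x
      by (rule in_chart_eq)
        (simp add: grad_norm2_eq[OF _ t] grad_inner_eq[OF _ _ t v_family v_family])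
    then show ?thesis
      unfolding V energy_def
      by (simp, intro weighted_integral sets_volume Ck_family_continuous[OF G_family[OF v_family v_family]]
          continuous_H H_pos t)
  qed
  have mass_pos: "mass t > 0" if "t \<in> ?J" for t
  proof -
    have "mass t \<ge> 0" unfolding mass_def using H_pos[OF JT[OF that]] by (simp add: less_imp_le)
    then show ?thesis using v_nonzero[OF that] mass_V[OF JT[OF that]] by simp
  qed
  have v0: "\<exists>x. v t x \<noteq> 0" if "t \<in> ?J" for t
  proof (rule ccontr)
    assume "\<not> (\<exists>x. v t x \<noteq> 0)"
    then have "mass t = 0" by (simp add: mass_def)
    then show False using mass_pos[OF that] by simp
  qed
  have "\<exists>D. (energy has_real_derivative D) (at t within {0..<T}) \<and>
      D \<le> (k t / h t + 4 * max_pressure p t) * energy t - 2 * drift_mass t" if t: "t \<in> ?J" for t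
  proof (rule DERIV_energy[OF JT[OF t]])
    fix c x assume c: "c \<in> A" "x \<in> chart_dom c"
    have "scal (g t) c x / (real m + 1) = - real m"
      unfolding scal[OF JT[OF t] c] by (simp add: field_simps)
    then show "tensor_le (bakry_emery_Ric (g t) (f t) c x) ((k t / h t / 2 - real m) *\<^sub>R g t c x)"
      using Ric_bound[OF t c] by (simp add: mult.commute)
  qed
  then obtain E' where E': "\<And>t. t \<in> ?J \<Longrightarrow> (energy has_real_derivative E' t) (at t within {0..<T})"
    "\<And>t. t \<in> ?J \<Longrightarrow> E' t \<le> (k t / h t + 4 * max_pressure p t) * energy t - 2 * drift_mass t" by metis
  \<comment> \<open>\<open>w\<close> is the exponential weight of \<open>Q\<close>, and \<open>Q'\<close> below the derivative of \<open>Q\<close>.\<close>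
  define \<Phi> where "\<Phi> s = 2 * max_pressure p s + (?h' s + k s) / h s" for s
  define w where "w t = exp (- integral {t0..t} \<Phi>)" for t
  define Q' where "Q' t = ((?h' t * energy t + E' t * h t) * mass t
      - h t * energy t * (2 * max_pressure p t * mass t - 2 * energy t)) / (mass t * mass t) * w t
      + h t * energy t / mass t * (w t * - \<Phi> t)" for t
  have Q_eq: "Q t = h t * energy t / mass t * w t" if "t \<in> ?J" for t
    unfolding Q parabolic_frequency_def mass_V[OF JT[OF that]] energy_V[OF JT[OF that]] w_def \<Phi>_def ..
  have "continuous_on ?J h" "continuous_on ?J k"
    using h_smooth k_smooth unfolding smooth_on_def by (metis Ck_on.simps(1))+
  then have "continuous_on ?J \<Phi>"
    unfolding \<Phi>_def
    by (intro continuous_intros continuous_on_pbar[OF J v0] smooth_on_interval_C1(2)[OF h_smooth times(2)] ballI h0) auto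
  then have w': "(w has_real_derivative w t * - \<Phi> t) (at t within ?J)" if "t \<in> ?J" for t
    unfolding w_def using integral_has_real_derivative[OF _ that]
    by (auto intro!: derivative_eq_intros)
  have DQ: "(Q has_real_derivative Q' t) (at t within ?J)" if t: "t \<in> ?J" for t
  proof -
    have "((\<lambda>t. h t * energy t / mass t * w t) has_real_derivative Q' t) (at t within ?J)"
      unfolding Q'_def
      by (rule DERIV_cong[OF DERIV_mult[OF DERIV_divide[OF DERIV_mult[OF smooth_on_interval_C1(1)[OF h_smooth times(2) t]
              has_field_derivative_subset[OF E'(1)[OF t] J]] has_field_derivative_subset[OF DERIV_mass[OF JT[OF t]] J]] w'[OF t]]])
        (use mass_pos[OF t] in \<open>auto simp: mult.commute\<close>)
    then show ?thesis
      by (rule has_field_derivative_transform_within[where d = 1]) (use t Q_eq in auto)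
  qed
  have sign: "h t * Q' t \<le> 0" and zero: "Q' t = 0 \<Longrightarrow> (energy t)\<^sup>2 = mass t * drift_mass t"
    if t: "t \<in> ?J" for t
    unfolding Q'_def \<Phi>_def
    by (rule frequency_derivative_algebra[OF mass_pos[OF t] h0[OF t] _ refl E'(2)[OF t] energy_square_le(1)[OF JT[OF t] mass_pos[OF t]]];
        simp add: w_def)+
  have contQ: "continuous_on {a..b} Q" if "t0 \<le> a" "b \<le> t1" for a b
  proof -
    have "continuous_on ?J Q"
      unfolding continuous_on_eq_continuous_within using DERIV_continuous[OF DQ] by blast
    then show ?thesis by (rule continuous_on_subset) (use that in auto)
  qed
  have DQ_inner: "(Q has_real_derivative Q' t) (at t)" if "t0 < t" "t < t1" for t
    using DQ[of t] that by (simp add: at_within_Icc_at)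
  have "antimono_on ?J Q" if h: "\<forall>t\<in>?J. h t > 0"
  proof (rule monotone_onI)
    fix a b assume ab: "a \<in> ?J" "b \<in> ?J" "a \<le> b"
    show "Q b \<le> Q a"
    proof (rule DERIV_nonpos_imp_decreasing_open[OF ab(3)])
      fix t assume "a < t" "t < b"
      then have t: "t0 < t" "t < t1" "t \<in> ?J" using ab by auto
      have "Q' t \<le> 0" using sign[OF t(3)] h t(3) by (simp add: mult_le_0_iff) force
      then show "\<exists>y. (Q has_real_derivative y) (at t) \<and> y \<le> 0" using DQ_inner[OF t(1,2)] by blast
    qed (use contQ ab in auto)
  qed
  moreover have "mono_on ?J Q" if h: "\<forall>t\<in>?J. h t < 0"
  proof (rule monotone_onI)
    fix a b assume ab: "a \<in> ?J" "b \<in> ?J" "a \<le> b"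
    show "Q a \<le> Q b"
    proof (rule DERIV_nonneg_imp_increasing_open[OF ab(3)])
      fix t assume "a < t" "t < b"
      then have t: "t0 < t" "t < t1" "t \<in> ?J" using ab by auto
      have "Q' t \<ge> 0" using sign[OF t(3)] h t(3) by (simp add: mult_le_0_iff) force
      then show "\<exists>y. (Q has_real_derivative y) (at t) \<and> 0 \<le> y" using DQ_inner[OF t(1,2)] by blast
    qed (use contQ ab in auto)
  qed
  moreover have "\<exists>c. drift_eigenfunction A (g t) (f t) c (v t)"
    if t: "t \<in> ?J" and Q0: "(Q has_real_derivative 0) (at t within ?J)" for t
  proof -
    have "at t within ?J \<noteq> bot"
      using t times(2) by (simp add: trivial_limit_within islimpt_Icc)
    then have "Q' t = 0" by (rule has_real_derivative_unique_within[OF DQ[OF t] Q0])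
    then have "- drift t x = energy t / mass t * v t x" for x
      using energy_square_le(2)[OF JT[OF t] mass_pos[OF t] zero[OF t]] by blast
    then have "drift_eigenfunction A (g t) (f t) (energy t / mass t) (v t)"
      unfolding drift_eigenfunction_def using v0[OF t] drift_laplacian_v[OF JT[OF t]] by simp
    then show ?thesis by blast
  qed
  ultimately show ?thesis by blast
qed

end
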